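(* Let $k\ge 2$ be fixed, and assume the Minimal Cycle Conjecture (as stated in the context). Let $S=\{s_1,\dots,s_k\}$ consist of $k$ elements of $S_n$, each chosen independently according to the uniform distribution on $S_n$. Then, almost always, Step 1 of the generic membership search algorithm (described in the context) produces a $c$-cycle $\mu$, expressed as a product of $O(n\log n)$ elements of $S^{\pm1}$, in time and space $O(n^3)$ (or, alternatively, in time $O(n^3\log n)$ and space $O(n)$).
   Context: Notation: $S_n$ is the symmetric group on $\{1,\dots,n\}$. For $S=\{s_1,\dots,s_k\}$, $S^{\pm1}=\{s_1,\dots,s_k,s_1^{-1},\dots,s_k^{-1}\}$. The number $c$ is $3$ if all elements of $S$ are even permutations (so that $\langle S\rangle$ is, almost always, $A_n$), and $2$ otherwise (so that $\langle S\rangle$ is, almost always, $S_n$). "Almost always" means with probability approaching $1$ as $n\to\infty$. Standard CPU operations (on integers of $O(\log n)$ bits) are considered as requiring constant time, and space is measured in machine words. Minimal Cycle Conjecture: Let $S$ be a set of $k$ elements of $S_n$, each chosen independently according to the uniform distribution on $S_n$. Let $c=3$ if all elements of $S$ are even, and $c=2$ otherwise. Consider the list consisting of the elements of $S^{\pm1}$, followed by all products of two elements of $S^{\pm1}$, followed by all products of three elements of $S^{\pm1}$, etc. Then, almost always, there is among the first $n^2$ elements of the list an element $\tau$ such that $\tau^m$ is a $c$-cycle for some $m\le n$. Step 1 of the generic membership search algorithm: Consider the elements $\tau\in\langle s_1,\dots,s_k\rangle$ one at a time, in breadth-first order (first the elements of $S^{\pm1}$, then the free-reduced products of two elements of $S^{\pm1}$,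 etc.), until there is $m\in\{1,\dots,n\}$ such that $\tau^m$ is a $c$-cycle; set $\mu=\tau^m$ and stop. In the two alternatives for the complexity, either previously computed products are stored and each new product is computed from a stored one by a single multiplication by an element of $S^{\pm1}$, or the whole product is recomputed for each new word. *)

theory Defs
  imports
    "HOL-Probability.Probability"
    "HOL-Combinatorics.Cycles"
    "HOL-Library.Landau_Symbols"
begin

section \<open>Words in the generators and the Minimal Cycle Conjecture\<close>

text \<open>
  The symmetric group on \<open>{1..n}\<close> consists of the functions \<open>p\<close> with \<open>p permutes {1..n}\<close>.
  A list \<open>s\<close> of \<open>k\<close> permutations has \<open>2 * k\<close> letters: letter \<open>a < k\<close> stands for \<open>s ! a\<close> and
  letter \<open>k + a\<close> for its inverse.
\<close>

definition signed_gens :: "(nat \<Rightarrow> nat) list \<Rightarrow> (nat \<Rightarrow> nat) list" where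
  "signed_gens s = s @ map inv s"

definition inv_letter :: "nat \<Rightarrow> nat \<Rightarrow> nat" where
  "inv_letter k a = (a + k) mod (2 * k)"

definition freely_reduced :: "nat \<Rightarrow> nat list \<Rightarrow> bool" where
  "freely_reduced k w \<longleftrightarrow> successively (\<lambda>a b. b \<noteq> inv_letter k a) w"

definition word_prod :: "(nat \<Rightarrow> nat) list \<Rightarrow> nat list \<Rightarrow> nat \<Rightarrow> nat" where
  "word_prod s w = foldr (\<lambda>a p. (signed_gens s ! a) \<circ> p) w id"

text \<open>Words of a given length, in lexicographic order.\<close>

primrec words :: "nat \<Rightarrow> nat \<Rightarrow> nat list list" where
  "words k 0 = [[]]"
| "words k (Suc l) = concat (map (\<lambda>a. map (\<lambda>w. a # w) (words k l)) [0..<2 * k])"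

text \<open>
  The first \<open>N\<close> entries of the infinite list of all words of length 1, then of length 2, etc.
  For \<open>k > 0\<close> every length contributes at least one word, so the lengths up to \<open>N\<close> suffice.
\<close>

definition first_words :: "nat \<Rightarrow> nat \<Rightarrow> nat list list" where
  "first_words k N = take N (concat (map (words k) [1..<Suc N]))"

definition is_cycle :: "nat \<Rightarrow> (nat \<Rightarrow> nat) \<Rightarrow> bool" where
  "is_cycle c p \<longleftrightarrow> (\<exists>cs. cycle cs \<and> length cs = c \<and> p = cycle_of_list cs)"

definition target_length :: "(nat \<Rightarrow> nat) list \<Rightarrow> nat" where
  "target_length s = (if \<forall>p\<in>set s. evenperm p then 3 else 2)"

definition random_gens :: "nat \<Rightarrow> nat \<Rightarrow> (nat \<Rightarrow> nat) list pmf" where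
  "random_gens k n = replicate_pmf k (pmf_of_set {p. p permutes {1..n}})"

definition almost_always :: "nat \<Rightarrow> (nat \<Rightarrow> (nat \<Rightarrow> nat) list \<Rightarrow> bool) \<Rightarrow> bool" where
  "almost_always k P \<longleftrightarrow>
     (\<lambda>n. measure_pmf.prob (random_gens k n) {s. P n s}) \<longlonglongrightarrow> 1"

definition minimal_cycle_conjecture :: "nat \<Rightarrow> bool" where
  "minimal_cycle_conjecture k \<longleftrightarrow>
     almost_always k (\<lambda>n s. \<exists>w\<in>set (first_words k (n\<^sup>2)). \<exists>m\<le>n.
       is_cycle (target_length s) (word_prod s w ^^ m))"

text \<open>
  The word that ends the search in Step 1: the first freely reduced word, in breadth-first order,
  whose product \<open>\<tau>\<close> has a suitable power.
\<close>

definition step1_selects :: "nat \<Rightarrow> (nat \<Rightarrow> nat) list \<Rightarrow> nat list \<Rightarrow> bool" where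
  "step1_selects n s w \<longleftrightarrow> (\<exists>N.
     find (\<lambda>v. \<exists>m\<in>{1..n}. is_cycle (target_length s) (word_prod s v ^^ m))
       (filter (freely_reduced (length s)) (first_words (length s) N)) = Some w)"


section \<open>A structured random access machine\<close>

text \<open>
  The machine has one register for each element of \<open>reg\<close> and one array of cells for each element of
  \<open>arr\<close>, all zero initially except for the input. Both types are finite, so the whole memory
  consists of a constant number of registers and a constant number of arrays.
\<close>

datatype reg = Deg | NGen | Cyc | Ltr | Pos | Pt | Par | Cnt | Lcm | Len | GcdA | GcdB | Tmp
  | Base | Num | Head | Pow | WLen | Idx

datatype arr = Gen | Prod | Last | Parent | Mark | Word | Mu

datatype binop = Plus | Minus | Times | Div | Mod | Eq | Less | Conj | Disj

datatype exp = Lit nat | Reg reg | Cell arr exp | Op binop exp exp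

datatype com =
    Skip
  | Assign reg exp    (infix "::=" 62)
  | Store arr exp exp ("_\<lbrakk>_\<rbrakk> ::= _" [63, 0, 62] 62)
  | Seq com com       (infixr ";;" 60)
  | If exp com com    ("(IF _/ THEN _/ ELSE _)" [0, 0, 61] 61)
  | While exp com     ("(WHILE _/ DO _)" [0, 61] 61)

record state =
  regs :: "reg \<Rightarrow> nat"
  mem :: "arr \<Rightarrow> nat \<Rightarrow> nat"

text \<open>Subtraction is truncated; truth values are 0 and 1, and any nonzero value counts as true.\<close>

fun binop_val :: "binop \<Rightarrow> nat \<Rightarrow> nat \<Rightarrow> nat" where
  "binop_val Plus x y = x + y"
| "binop_val Minus x y = x - y"
| "binop_val Times x y = x * y"
| "binop_val Div x y = x div y"
| "binop_val Mod x y = x mod y"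
| "binop_val Eq x y = (if x = y then 1 else 0)"
| "binop_val Less x y = (if x < y then 1 else 0)"
| "binop_val Conj x y = (if x \<noteq> 0 \<and> y \<noteq> 0 then 1 else 0)"
| "binop_val Disj x y = (if x \<noteq> 0 \<or> y \<noteq> 0 then 1 else 0)"

primrec val :: "exp \<Rightarrow> state \<Rightarrow> nat" where
  "val (Lit v) \<sigma> = v"
| "val (Reg x) \<sigma> = regs \<sigma> x"
| "val (Cell A e) \<sigma> = mem \<sigma> A (val e \<sigma>)"
| "val (Op f e1 e2) \<sigma> = binop_val f (val e1 \<sigma>) (val e2 \<sigma>)"

text \<open>
  \<open>safe W M e \<sigma>\<close>: evaluating \<open>e\<close> only produces machine words, i.e. numbers below \<open>W\<close>, and only
  accesses array cells with index below \<open>M\<close>. An unsafe evaluation blocks the execution.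
\<close>

primrec safe :: "nat \<Rightarrow> nat \<Rightarrow> exp \<Rightarrow> state \<Rightarrow> bool" where
  "safe W M (Lit v) \<sigma> \<longleftrightarrow> v < W"
| "safe W M (Reg x) \<sigma> \<longleftrightarrow> regs \<sigma> x < W"
| "safe W M (Cell A e) \<sigma> \<longleftrightarrow> safe W M e \<sigma> \<and> val e \<sigma> < M \<and> mem \<sigma> A (val e \<sigma>) < W"
| "safe W M (Op f e1 e2) \<sigma> \<longleftrightarrow>
     safe W M e1 \<sigma> \<and> safe W M e2 \<sigma> \<and> binop_val f (val e1 \<sigma>) (val e2 \<sigma>) < W"

text \<open>Every literal, register access, cell access and operation takes one unit of time.\<close>

primrec cost :: "exp \<Rightarrow> nat" where
  "cost (Lit v) = 1"
| "cost (Reg x) = 1"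
| "cost (Cell A e) = cost e + 1"
| "cost (Op f e1 e2) = cost e1 + cost e2 + 1"

text \<open>
  \<open>exec W M c \<sigma> t \<tau>\<close>: with machine words below \<open>W\<close> and \<open>M\<close> cells in each array, the program \<open>c\<close>
  started in \<open>\<sigma>\<close> terminates in \<open>\<tau>\<close> after time \<open>t\<close>.
\<close>

inductive exec :: "nat \<Rightarrow> nat \<Rightarrow> com \<Rightarrow> state \<Rightarrow> nat \<Rightarrow> state \<Rightarrow> bool" for W M where
  Skip: "exec W M Skip \<sigma> 1 \<sigma>"
| Assign: "safe W M e \<sigma> \<Longrightarrow>
    exec W M (x ::= e) \<sigma> (cost e + 1) (\<sigma>\<lparr>regs := (regs \<sigma>)(x := val e \<sigma>)\<rparr>)"
| Store: "\<lbrakk>safe W M i \<sigma>; val i \<sigma> < M; safe W M e \<sigma>\<rbrakk> \<Longrightarrow>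
    exec W M (A\<lbrakk>i\<rbrakk> ::= e) \<sigma> (cost i + cost e + 1)
      (\<sigma>\<lparr>mem := (mem \<sigma>)(A := (mem \<sigma> A)(val i \<sigma> := val e \<sigma>))\<rparr>)"
| Seq: "\<lbrakk>exec W M c1 \<sigma>1 t1 \<sigma>2; exec W M c2 \<sigma>2 t2 \<sigma>3\<rbrakk> \<Longrightarrow> exec W M (c1;; c2) \<sigma>1 (t1 + t2) \<sigma>3"
| IfTrue: "\<lbrakk>safe W M b \<sigma>; val b \<sigma> \<noteq> 0; exec W M c1 \<sigma> t \<sigma>'\<rbrakk> \<Longrightarrow>
    exec W M (IF b THEN c1 ELSE c2) \<sigma> (cost b + t + 1) \<sigma>'"
| IfFalse: "\<lbrakk>safe W M b \<sigma>; val b \<sigma> = 0; exec W M c2 \<sigma> t \<sigma>'\<rbrakk> \<Longrightarrow>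
    exec W M (IF b THEN c1 ELSE c2) \<sigma> (cost b + t + 1) \<sigma>'"
| WhileFalse: "\<lbrakk>safe W M b \<sigma>; val b \<sigma> = 0\<rbrakk> \<Longrightarrow> exec W M (WHILE b DO c) \<sigma> (cost b + 1) \<sigma>"
| WhileTrue: "\<lbrakk>safe W M b \<sigma>1; val b \<sigma>1 \<noteq> 0; exec W M c \<sigma>1 t1 \<sigma>2;
      exec W M (WHILE b DO c) \<sigma>2 t2 \<sigma>3\<rbrakk> \<Longrightarrow>
    exec W M (WHILE b DO c) \<sigma>1 (cost b + t1 + t2 + 1) \<sigma>3"

definition memory_size :: "nat \<Rightarrow> nat" where
  "memory_size M = card (UNIV :: arr set) * M + card (UNIV :: reg set)"

abbreviation plus_exp (infixl "\<^bold>+" 75) where "plus_exp \<equiv> Op Plus"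
abbreviation minus_exp (infixl "\<^bold>-" 75) where "minus_exp \<equiv> Op Minus"
abbreviation times_exp (infixl "\<^bold>*" 80) where "times_exp \<equiv> Op Times"
abbreviation div_exp (infixl "DIV" 80) where "div_exp \<equiv> Op Div"
abbreviation mod_exp (infixl "MOD" 80) where "mod_exp \<equiv> Op Mod"
abbreviation eq_exp (infix "\<^bold>=" 70) where "eq_exp \<equiv> Op Eq"
abbreviation less_exp (infix "\<^bold><" 70) where "less_exp \<equiv> Op Less"
abbreviation conj_exp (infixr "\<^bold>\<and>" 67) where "conj_exp \<equiv> Op Conj"
abbreviation disj_exp (infixr "\<^bold>\<or>" 66) where "disj_exp \<equiv> Op Disj"
abbreviation not_exp ("\<^bold>\<not> _" [69] 69) where "not_exp e \<equiv> Op Eq e (Lit 0)"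

definition for_loop :: "reg \<Rightarrow> exp \<Rightarrow> exp \<Rightarrow> com \<Rightarrow> com"
    ("(FOR _ FROM _ BELOW _/ DO _)" [0, 0, 0, 61] 61) where
  "FOR x FROM lo BELOW hi DO c =
     x ::= lo;; WHILE Reg x \<^bold>< hi DO (c;; x ::= Reg x \<^bold>+ Lit 1)"


section \<open>Step 1 of the membership search\<close>

text \<open>
  A permutation of \<open>{1..n}\<close> occupies a row of \<open>n + 1\<close> cells, of which cell \<open>i\<close> contains the image
  of \<open>i\<close>; cell 0 contains 0. Row \<open>a\<close> of \<open>Gen\<close> is the permutation denoted by letter \<open>a\<close>; the
  input provides the first \<open>k\<close> rows.
\<close>

definition input_state :: "nat \<Rightarrow> (nat \<Rightarrow> nat) list \<Rightarrow> state" where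
  "input_state n s =
     \<lparr>regs = (\<lambda>_. 0)(Deg := n, NGen := length s),
      mem = (\<lambda>_ _. 0)(Gen := \<lambda>i. if i < length s * (n + 1)
                                  then (s ! (i div (n + 1))) (i mod (n + 1)) else 0)\<rparr>"

abbreviation width :: exp where "width \<equiv> Reg Deg \<^bold>+ Lit 1"
abbreviation num_letters :: exp where "num_letters \<equiv> Lit 2 \<^bold>* Reg NGen"

definition compute_inverses :: com where
  "compute_inverses =
     FOR Ltr FROM Lit 0 BELOW Reg NGen DO
       FOR Pos FROM Lit 0 BELOW width DO
         Gen\<lbrakk>(Reg NGen \<^bold>+ Reg Ltr) \<^bold>* width \<^bold>+ Cell Gen (Reg Ltr \<^bold>* width \<^bold>+ Reg Pos)\<rbrakk> ::= Reg Pos"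

text \<open>The parity of each generator is found by sorting a copy of it with transpositions.\<close>

definition compute_target_length :: com where
  "compute_target_length =
     Cyc ::= Lit 3;;
     FOR Ltr FROM Lit 0 BELOW Reg NGen DO (
       Par ::= Lit 0;;
       FOR Pos FROM Lit 0 BELOW width DO
         Mark\<lbrakk>Reg Pos\<rbrakk> ::= Cell Gen (Reg Ltr \<^bold>* width \<^bold>+ Reg Pos);;
       FOR Pos FROM Lit 0 BELOW width DO
         WHILE \<^bold>\<not> (Cell Mark (Reg Pos) \<^bold>= Reg Pos) DO (
           Pt ::= Cell Mark (Reg Pos);;
           Mark\<lbrakk>Reg Pos\<rbrakk> ::= Cell Mark (Reg Pt);;
           Mark\<lbrakk>Reg Pt\<rbrakk> ::= Reg Pt;;
           Par ::= Lit 1 \<^bold>- Reg Par);;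
       IF Reg Par THEN Cyc ::= Lit 2 ELSE Skip)"

text \<open>
  Let \<open>\<tau>\<close> be the permutation in the row of \<open>Prod\<close> that starts at \<open>Base\<close>. For prime \<open>c\<close>, the power
  \<open>\<tau> ^^ m\<close> is a \<open>c\<close>-cycle iff \<open>c\<close> does not divide \<open>m\<close>, exactly one cycle of \<open>\<tau>\<close> has length \<open>c\<close>,
  and the lengths of all other cycles divide \<open>m\<close>. Hence \<open>m\<close> may be taken to be the least common
  multiple of those other lengths, if this is at most \<open>n\<close>. The program sets \<open>Pow\<close> to this \<open>m\<close>, or
  to 0 if there is none. \<open>Lcm\<close> is no longer updated once it exceeds \<open>n\<close>.
\<close>

definition find_power :: com where
  "find_power =
     FOR Pos FROM Lit 0 BELOW width DO
       Mark\<lbrakk>Reg Pos\<rbrakk> ::= Lit 0;;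
     Cnt ::= Lit 0;;
     Lcm ::= Lit 1;;
     FOR Pos FROM Lit 1 BELOW width DO (
       Len ::= Lit 0;;
       Pt ::= Reg Pos;;
       WHILE \<^bold>\<not> Cell Mark (Reg Pt) DO (
         Mark\<lbrakk>Reg Pt\<rbrakk> ::= Lit 1;;
         Pt ::= Cell Prod (Reg Base \<^bold>+ Reg Pt);;
         Len ::= Reg Len \<^bold>+ Lit 1);;
       IF Reg Len \<^bold>= Reg Cyc THEN
         Cnt ::= Reg Cnt \<^bold>+ Lit 1
       ELSE IF Lit 0 \<^bold>< Reg Len \<^bold>\<and> Reg Lcm \<^bold>< width THEN (
         GcdA ::= Reg Lcm;;
         GcdB ::= Reg Len;;
         WHILE Lit 0 \<^bold>< Reg GcdB DO (
           Tmp ::= Reg GcdA MOD Reg GcdB;;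
           GcdA ::= Reg GcdB;;
           GcdB ::= Reg Tmp);;
         Lcm ::= Reg Lcm DIV Reg GcdA \<^bold>* Reg Len)
       ELSE Skip);;
     IF Reg Cnt \<^bold>= Lit 1 \<^bold>\<and> Reg Lcm \<^bold>< width \<^bold>\<and> Lit 0 \<^bold>< Reg Lcm MOD Reg Cyc
     THEN Pow ::= Reg Lcm
     ELSE Pow ::= Lit 0"

definition compute_mu :: com where
  "compute_mu =
     FOR Pos FROM Lit 1 BELOW width DO (
       Pt ::= Reg Pos;;
       FOR Idx FROM Lit 0 BELOW Reg Pow DO
         Pt ::= Cell Prod (Reg Base \<^bold>+ Reg Pt);;
       Mu\<lbrakk>Reg Pos\<rbrakk> ::= Reg Pt)"

text \<open>
  First alternative: all products are stored. Row \<open>q\<close> of \<open>Prod\<close> is the product of the \<open>q\<close>-th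
  freely reduced word (row 0 belongs to the empty word); this word is the \<open>Parent\<lbrakk>q\<rbrakk>\<close>-th one followed
  by the letter \<open>Last\<lbrakk>q\<rbrakk>\<close>. The rows are extended in the order in which they were created.
\<close>

definition stored_step1 :: com where
  "stored_step1 =
     compute_inverses;;
     compute_target_length;;
     FOR Pos FROM Lit 0 BELOW width DO
       Prod\<lbrakk>Reg Pos\<rbrakk> ::= Reg Pos;;
     Num ::= Lit 0;; Head ::= Lit 0;; Ltr ::= Lit 0;; Pow ::= Lit 0;;
     WHILE \<^bold>\<not> Reg Pow DO
       IF Reg Ltr \<^bold>= num_letters THEN (
         Head ::= Reg Head \<^bold>+ Lit 1;;
         Ltr ::= Lit 0)
       ELSE (
         IF Reg Head \<^bold>= Lit 0 \<^bold>\<or>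
            \<^bold>\<not> (Reg Ltr \<^bold>= (Cell Last (Reg Head) \<^bold>+ Reg NGen) MOD num_letters)
         THEN (
           Num ::= Reg Num \<^bold>+ Lit 1;;
           Base ::= Reg Num \<^bold>* width;;
           FOR Pos FROM Lit 0 BELOW width DO
             Prod\<lbrakk>Reg Base \<^bold>+ Reg Pos\<rbrakk> ::=
               Cell Prod (Reg Head \<^bold>* width \<^bold>+ Cell Gen (Reg Ltr \<^bold>* width \<^bold>+ Reg Pos));;
           Parent\<lbrakk>Reg Num\<rbrakk> ::= Reg Head;;
           Last\<lbrakk>Reg Num\<rbrakk> ::= Reg Ltr;;
           find_power)
         ELSE Skip;;
         Ltr ::= Reg Ltr \<^bold>+ Lit 1);;
     compute_mu;;
     Head ::= Reg Num;;
     WLen ::= Lit 0;;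
     WHILE Reg Head DO (
       Word\<lbrakk>Reg WLen\<rbrakk> ::= Cell Last (Reg Head);;
       WLen ::= Reg WLen \<^bold>+ Lit 1;;
       Head ::= Cell Parent (Reg Head))"

text \<open>
  Second alternative: \<open>Word\<close> contains the current word, last letter first, and runs through all
  words in breadth-first order; for each freely reduced one the whole product is computed afresh.
\<close>

definition check_reduced :: com where
  "check_reduced =
     Par ::= Lit 1;;
     FOR Idx FROM Lit 1 BELOW Reg WLen DO
       IF Cell Word (Reg Idx) \<^bold>=
          (Cell Word (Reg Idx \<^bold>- Lit 1) \<^bold>+ Reg NGen) MOD num_letters
       THEN Par ::= Lit 0
       ELSE Skip"

definition compute_product :: com where
  "compute_product =
     FOR Pos FROM Lit 0 BELOW width DO (
       Pt ::= Reg Pos;;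
       FOR Idx FROM Lit 0 BELOW Reg WLen DO
         Pt ::= Cell Gen (Cell Word (Reg Idx) \<^bold>* width \<^bold>+ Reg Pt);;
       Prod\<lbrakk>Reg Pos\<rbrakk> ::= Reg Pt)"

definition next_word :: com where
  "next_word =
     Idx ::= Lit 0;;
     WHILE Reg Idx \<^bold>< Reg WLen \<^bold>\<and> Cell Word (Reg Idx) \<^bold>+ Lit 1 \<^bold>= num_letters DO (
       Word\<lbrakk>Reg Idx\<rbrakk> ::= Lit 0;;
       Idx ::= Reg Idx \<^bold>+ Lit 1);;
     IF Reg Idx \<^bold>= Reg WLen THEN (
       Word\<lbrakk>Reg Idx\<rbrakk> ::= Lit 0;;
       WLen ::= Reg WLen \<^bold>+ Lit 1)
     ELSE
       Word\<lbrakk>Reg Idx\<rbrakk> ::= Cell Word (Reg Idx) \<^bold>+ Lit 1"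

definition recomputing_step1 :: com where
  "recomputing_step1 =
     compute_inverses;;
     compute_target_length;;
     WLen ::= Lit 0;; Base ::= Lit 0;; Pow ::= Lit 0;;
     WHILE \<^bold>\<not> Reg Pow DO (
       next_word;;
       check_reduced;;
       IF Reg Par THEN (compute_product;; find_power) ELSE Skip);;
     compute_mu"

text \<open>
  The output consists of the selected word, the exponent \<open>m\<close> in \<open>Pow\<close>, and the permutation \<open>\<mu>\<close> in
  \<open>Mu\<close>. The word and \<open>m\<close> express \<open>\<mu>\<close> as the product of the \<open>m\<close>-fold repetition of the word.
\<close>

definition output_word :: "state \<Rightarrow> nat list" where
  "output_word \<sigma> = rev (map (mem \<sigma> Word) [0..<regs \<sigma> WLen])"

definition step1_output :: "nat \<Rightarrow> (nat \<Rightarrow> nat) list \<Rightarrow> state \<Rightarrow> nat list \<Rightarrow> (nat \<Rightarrow> nat) \<Rightarrow> bool" where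
  "step1_output n s \<sigma> u \<mu> \<longleftrightarrow>
     (let w = output_word \<sigma>; m = regs \<sigma> Pow in
        step1_selects n s w \<and> m \<in> {1..n} \<and> u = concat (replicate m w) \<and>
        \<mu> = word_prod s w ^^ m \<and> (\<forall>i\<in>{1..n}. mem \<sigma> Mu i = \<mu> i))"

text \<open>
  \<open>prog\<close> performs Step 1 with machine words below \<open>W\<close>, in time \<open>T\<close> and space \<open>S\<close>, and the \<open>c\<close>-cycle
  produced is expressed as a product of at most \<open>L\<close> generators and inverses of generators.
\<close>

definition performs_step1 ::
    "com \<Rightarrow> nat \<Rightarrow> real \<Rightarrow> real \<Rightarrow> real \<Rightarrow> nat \<Rightarrow> (nat \<Rightarrow> nat) list \<Rightarrow> bool" where
  "performs_step1 prog W T S L n s \<longleftrightarrow>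
     (\<exists>M t \<sigma> u \<mu>. exec W M prog (input_state n s) t \<sigma> \<and>
        real t \<le> T \<and> real (memory_size M) \<le> S \<and>
        step1_output n s \<sigma> u \<mu> \<and> is_cycle (target_length s) \<mu> \<and>
        set u \<subseteq> {..<2 * length s} \<and> word_prod s u = \<mu> \<and> real (length u) \<le> L)"

end

theory Submission
  imports Defs
begin

text \<open>
  Free reduction never moves a word backwards in the breadth-first list, so the conjecture provides,
  almost always, a freely reduced word among the first \<open>n\<^sup>2\<close> words whose product has a \<open>c\<close>-cycle among
  its powers with exponent at most \<open>n\<close>. The first such word is the one that Step 1 selects. Everything
  else is deterministic: for each such input of degree \<open>n \<ge> 2\<close>, both programs find this word within the
  stated resources.

  The words are numbered like the nodes of a complete \<open>2k\<close>-ary heap: word \<open>i + 1\<close> is word \<open>i div 2k\<close>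
  followed by letter \<open>i mod 2k\<close>. In this numbering (\<open>bfs_word\<close>, \<open>first_words_eq\<close>) the list of the
  conjecture is simply the sequence of words \<open>1, 2, 3, ...\<close>; the successor of a word is the increment of
  an odometer (\<open>bfs_word_Suc_eq_bump\<close>), which is what the recomputing program does, and the children of
  a word form a block of consecutive words, which is why a queue produces the reduced words in order
  (\<open>reduced_indices_next\<close>). It also gives \<open>4 ^ length \<le> 3 * index + 1\<close>, so that a word among the first
  \<open>n\<^sup>2\<close> has length \<open>O(log n)\<close>. As the exponent is at most \<open>n\<close>, this yields the \<open>O(n log n)\<close> factors.

  For prime \<open>c\<close>, a power \<open>p ^^ m\<close> is a \<open>c\<close>-cycle iff \<open>c\<close> does not divide \<open>m\<close>, the points on cycles of
  length \<open>c\<close> are exactly \<open>c\<close> in number, and all other cycle lengths divide \<open>m\<close> (\<open>power_is_cycle_iff\<close>).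
  The least exponent is thus a least common multiple, which is found in time \<open>O(n)\<close>
  (\<open>wp_find_power\<close>): tracing a cycle of length \<open>l\<close> takes \<open>O(l)\<close> steps, and so does the
  Euclidean algorithm that follows, as its second argument starts at \<open>l\<close> and decreases. The cycle
  lengths add up to \<open>n\<close>.

  Hence \<open>O(n)\<close> steps per word suffice if the product comes from a stored one, which gives \<open>O(n\<^sup>3)\<close> for
  \<open>n\<^sup>2\<close> words, whereas recomputing a product of \<open>O(log n)\<close> factors takes \<open>O(n log n)\<close> steps. The remaining
  work (inverses, parities, the output) is \<open>O(n\<^sup>2)\<close>. The programs are verified with a predicate
  transformer \<open>wp\<close> whose assertions also speak about the elapsed time, so that amortised bounds are
  ordinary loop invariants.
\<close>

section \<open>Enumerating the words\<close>

text \<open>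
  The words over the letters below \<open>b\<close> as the nodes of a heap: the root 0 is the empty word, and the
  children \<open>b * i + 1, ..., b * i + b\<close> of node \<open>i\<close> extend word \<open>i\<close> by one letter.
\<close>

function bfs_word :: "nat \<Rightarrow> nat \<Rightarrow> nat list" where
  "bfs_word b 0 = []"
| "bfs_word b (Suc i) = bfs_word b (i div b) @ [i mod b]"
  by pat_completeness auto
termination
  by (relation "Wellfounded.measure snd") (auto simp: le_imp_less_Suc)

text \<open>
  The index of the first word of length \<open>l\<close>.
\<close>

fun level_start :: "nat \<Rightarrow> nat \<Rightarrow> nat" where
  "level_start b 0 = 0"
| "level_start b (Suc l) = Suc (level_start b l * b)"

text \<open>
  Lexicographic order extends words at the front in the recursion for \<open>words\<close>, while breadth-first
  order extends them at the end; both give the same list.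
\<close>

lemma words_Suc_snoc:
  "words k (Suc l) = concat (map (\<lambda>w. map (\<lambda>a. w @ [a]) [0..<2 * k]) (words k l))"
proof (induction l)
  case 0
  show ?case by (simp add: comp_def concat_map_singleton map_concat)
next
  case (Suc l)
  have nested: "concat (map (\<lambda>a. concat (map (f \<circ> g a) ys)) xs)
    = concat (map f (concat (map (\<lambda>a. map (g a) ys) xs)))"
    for f :: "nat list \<Rightarrow> nat list list" and g :: "nat \<Rightarrow> nat list \<Rightarrow> nat list" and xs ys
    by (induction xs) (auto simp: comp_def)
  have "words k (Suc (Suc l)) = concat (map (\<lambda>a. map ((#) a) (words k (Suc l))) [0..<2 * k])"
    by simp
  also have "\<dots> = concat (map (\<lambda>a. concat (map (\<lambda>w. map (\<lambda>a'. (a # w) @ [a']) [0..<2 * k])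
      (words k l))) [0..<2 * k])"
    by (subst Suc) (simp add: map_concat comp_def)
  also have "\<dots> = concat (map (\<lambda>w. map (\<lambda>a. w @ [a]) [0..<2 * k]) (words k (Suc l)))"
    using nested[of "\<lambda>w. map (\<lambda>a. w @ [a]) [0..<2 * k]" "(#)" "words k l" "[0..<2 * k]"]
      by (simp add: comp_def)
  finally show ?case .
qed

lemma concat_children_upt:
  assumes "b > 0"
  shows "concat (map (\<lambda>j. map (\<lambda>a. bfs_word b j @ [a]) [0..<b]) [i..<i + d])
    = map (bfs_word b) [Suc (i * b)..<Suc ((i + d) * b)]"
proof (induction d)
  case (Suc d)
  have "map (\<lambda>a. bfs_word b (i + d) @ [a]) [0..<b]
      = map (bfs_word b) [Suc ((i + d) * b)..<Suc ((i + d) * b) + b]"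
    using assms by (intro nth_equalityI) (auto simp del: upt_Suc)
  moreover have "[Suc (i * b)..<Suc ((i + Suc d) * b)]
      = [Suc (i * b)..<Suc ((i + d) * b)] @ [Suc ((i + d) * b)..<Suc ((i + d) * b) + b]"
    using upt_add_eq_append[of "Suc (i * b)" "Suc ((i + d) * b)" b] by (simp add: algebra_simps)
  ultimately show ?case using Suc by simp
qed simp

lemma level_start_mono: "b > 0 \<Longrightarrow> level_start b l < level_start b (Suc l)"
  by (induction l) (simp, metis Suc_less_eq level_start.simps(2) mult_less_mono1)

lemma words_eq_bfs_words:
  assumes "k > 0"
  shows "words k l = map (bfs_word (2 * k)) [level_start (2 * k) l..<level_start (2 * k) (Suc l)]"
proof (induction l)
  case (Suc l)
  define d where "d = level_start (2 * k) (Suc l) - level_start (2 * k) l"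
  have d: "level_start (2 * k) (Suc l) = level_start (2 * k) l + d"
    using level_start_mono[of "2 * k" l] assms by (simp add: d_def)
  have "words k (Suc l) = concat (map (\<lambda>j. map (\<lambda>a. bfs_word (2 * k) j @ [a]) [0..<2 * k])
      [level_start (2 * k) l..<level_start (2 * k) l + d])"
    unfolding words_Suc_snoc Suc d by (simp add: comp_def)
  also have "\<dots> = map (bfs_word (2 * k)) [level_start (2 * k) (Suc l)..<level_start (2 * k) (Suc (Suc
    l))]"
    using assms concat_children_upt[of "2 * k" "level_start (2 * k) l" d] d
    by simp
  finally show ?case .
qed simp

text \<open>
  As the words of length \<open>l\<close> occupy the indices from \<open>level_start\<close> of \<open>l\<close> up to \<open>level_start\<close> of
  \<open>l + 1\<close>, the concatenation of the levels is the sequence of indices without gaps.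
\<close>

lemma first_words_eq:
  assumes "k > 0"
  shows "first_words k N = map (bfs_word (2 * k)) [1..<Suc N]"
proof -
  have "concat (map (words k) [1..<Suc N]) = map (bfs_word (2 * k)) [1..<level_start (2 * k) (Suc N)]"
  proof (induction N)
    case (Suc N)
    have "1 \<le> level_start (2 * k) (Suc N)" by simp
    moreover have "level_start (2 * k) (Suc N) \<le> level_start (2 * k) (Suc (Suc N))"
      using level_start_mono[of "2 * k" "Suc N"] assms by simp
    ultimately have split: "[1..<level_start (2 * k) (Suc N)]
        @ [level_start (2 * k) (Suc N)..<level_start (2 * k) (Suc (Suc N))]
        = [1..<level_start (2 * k) (Suc (Suc N))]"
      by (metis le_add_diff_inverse upt_add_eq_append)
    have "concat (map (words k) [1..<Suc (Suc N)])
        = concat (map (words k) [1..<Suc N]) @ words k (Suc N)"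
      by simp
    also have "\<dots> = map (bfs_word (2 * k)) [1..<level_start (2 * k) (Suc N)]
        @ map (bfs_word (2 * k)) [level_start (2 * k) (Suc N)..<level_start (2 * k) (Suc (Suc N))]"
      by (simp only: Suc words_eq_bfs_words[OF assms])
    finally show ?case
      by (simp only: split flip: map_append)
  qed simp
  moreover have "N \<le> level_start (2 * k) N" for N
    using assms
  proof (induction N)
    case (Suc N)
    then show ?case
      using mult_le_mono[of N "level_start (2 * k) N" 1 "2 * k"] by simp
  qed simp
  then have "Suc N \<le> level_start (2 * k) (Suc N)" .
  ultimately show ?thesis
    by (simp add: first_words_def take_map del: upt_Suc level_start.simps)
qed

text \<open>
  Passing from a word to its parent divides the index by at least four.
\<close>

lemma four_power_length_bfs_word:
  "b \<ge> 4 \<Longrightarrow> 4 ^ length (bfs_word b i) \<le> 3 * i + 1"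
proof (induction b i rule: bfs_word.induct)
  case (2 b i)
  have "i div b * 4 \<le> i" using 2(2) by (metis div_times_less_eq_dividend le_trans mult_le_mono2)
  then show ?case using 2 by simp
qed simp

lemma bfs_word_letters: "b > 0 \<Longrightarrow> set (bfs_word b i) \<subseteq> {..<b}"
  by (induction b i rule: bfs_word.induct) auto

lemma freely_reduced_snoc:
  "freely_reduced k (w @ [a]) \<longleftrightarrow> freely_reduced k w \<and> (w \<noteq> [] \<longrightarrow> a \<noteq> inv_letter k (last w))"
  by (auto simp: freely_reduced_def successively_append_iff)

lemma word_prod_append: "word_prod s (v @ w) = word_prod s v \<circ> word_prod s w"
  by (induction v) (simp_all add: word_prod_def comp_assoc)

lemma word_prod_snoc: "word_prod s (w @ [a]) = word_prod s w \<circ> signed_gens s ! a"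
  by (simp add: word_prod_append) (simp add: word_prod_def)

lemma word_prod_replicate: "word_prod s (concat (replicate m w)) = word_prod s w ^^ m"
  by (induction m) (simp_all add: word_prod_append, simp add: word_prod_def)

lemma signed_gens_permutes:
  assumes "\<forall>p\<in>set s. p permutes A" "a < 2 * length s"
  shows "signed_gens s ! a permutes A"
proof -
  have "signed_gens s ! a \<in> set (signed_gens s)"
    using assms(2) by (intro nth_mem) (simp add: signed_gens_def)
  then consider "signed_gens s ! a \<in> set s" | p where "p \<in> set s" "signed_gens s ! a = inv p"
    by (auto simp: signed_gens_def)
  then show ?thesis
    by cases (use assms(1) permutes_inv in auto)
qed

lemma word_prod_permutes:
  assumes "\<forall>p\<in>set s. p permutes A" "set w \<subseteq> {..<2 * length s}"
  shows "word_prod s w permutes A"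
  using assms(2)
proof (induction w rule: rev_induct)
  case Nil
  show ?case using permutes_id by (simp add: word_prod_def id_def)
next
  case (snoc a w)
  then have "signed_gens s ! a permutes A" "word_prod s w permutes A"
    using signed_gens_permutes[OF assms(1), of a] by simp_all
  then show ?case unfolding word_prod_snoc by (rule permutes_compose)
qed

lemma inv_letter_cancel:
  assumes "\<forall>p\<in>set s. p permutes A" "a < 2 * length s"
  shows "signed_gens s ! inv_letter (length s) a \<circ> signed_gens s ! a = id"
    and "signed_gens s ! a \<circ> signed_gens s ! inv_letter (length s) a = id"
proof -
  define k where "k = length s"
  consider "a < k" | "k \<le> a" "a < 2 * k" using assms(2) k_def by linarith
  then have "signed_gens s ! inv_letter k a \<circ> signed_gens s ! a = id \<and>
      signed_gens s ! a \<circ> signed_gens s ! inv_letter k a = id"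
  proof cases
    case 1
    moreover have "s ! a permutes A" using 1 assms(1) by (simp add: k_def)
    ultimately show ?thesis
      by (simp add: inv_letter_def signed_gens_def nth_append k_def permutes_inv_o)
  next
    case 2
    define a' where "a' = a - k"
    have a': "a = a' + k" "a' < k" using 2 by (auto simp: a'_def)
    have "inv_letter k a = a'"
      using a' by (simp add: inv_letter_def mult_2[symmetric] add.assoc)
    moreover have "s ! a' permutes A" using a' assms(1) by (simp add: k_def)
    ultimately show ?thesis
      using a' by (simp add: signed_gens_def nth_append k_def permutes_inv_o)
  qed
  then show "signed_gens s ! inv_letter (length s) a \<circ> signed_gens s ! a = id"
    and "signed_gens s ! a \<circ> signed_gens s ! inv_letter (length s) a = id"
    by (simp_all add: k_def)
qed

lemma inv_letter_less: "k > 0 \<Longrightarrow> inv_letter k a < 2 * k"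
  by (simp add: inv_letter_def)

text \<open>
  A word is its parent followed by a letter. The reduced form of the parent, obtained by induction,
  either accepts this letter or ends in its inverse; in the latter case it is shortened to its own
  parent. Both operations lead to an index that is no larger, because children are ordered like their
  parents.
\<close>

lemma freely_reduced_bfs_word_exists:
  assumes "\<forall>p\<in>set s. p permutes A" "length s > 0"
  shows "\<exists>j\<le>i. freely_reduced (length s) (bfs_word (2 * length s) j) \<and>
    word_prod s (bfs_word (2 * length s) j) = word_prod s (bfs_word (2 * length s) i)"
proof (induction i rule: less_induct)
  case (less i)
  let ?b = "2 * length s"
  let ?w = "bfs_word ?b"
  have div_of_pair: "(j * b + a) div b = j" if "a < b" for j a b :: nat
    using that by simp
  show ?case
  proof (cases i)
    case 0
    then show ?thesis by (simp add: freely_reduced_def)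
  next
    case (Suc i')
    define a where "a = i' mod ?b"
    have a: "a < ?b" using assms(2) by (simp add: a_def)
    obtain j where j: "j \<le> i' div ?b" "freely_reduced (length s) (?w j)"
        "word_prod s (?w j) = word_prod s (?w (i' div ?b))"
      using less[of "i' div ?b"] Suc by (auto simp: le_imp_less_Suc)
    have i: "?w i = ?w (i' div ?b) @ [a]" by (simp add: Suc a_def)
    show ?thesis
    proof (cases "?w j \<noteq> [] \<longrightarrow> a \<noteq> inv_letter (length s) (last (?w j))")
      case True
      have "j * ?b + a \<le> i'"
        using j(1) unfolding a_def by (metis add_le_mono1 div_mult_mod_eq mult_le_mono1)
      moreover have "(j * ?b + a) div ?b = j" using a by (rule div_of_pair)
      then have "?w (Suc (j * ?b + a)) = ?w j @ [a]" using a by simp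
      ultimately show ?thesis
        using j True i Suc by (intro exI[of _ "Suc (j * ?b + a)"]) (simp add: freely_reduced_snoc
          word_prod_snoc)
    next
      case False
      then obtain j' where j': "j = Suc j'" by (cases j) auto
      define v where "v = ?w (j' div ?b)"
      have w: "?w j = v @ [j' mod ?b]" by (simp add: j' v_def)
      with False have "a = inv_letter (length s) (j' mod ?b)" by simp
      moreover have "j' mod ?b < ?b" using assms(2) by simp
      ultimately have "signed_gens s ! (j' mod ?b) \<circ> signed_gens s ! a = id"
        using inv_letter_cancel(2)[OF assms(1)] by blast
      then have "word_prod s (?w i) = word_prod s v"
        using j(3) by (simp add: i w word_prod_snoc flip: j(3)) (simp add: comp_assoc)
      moreover have "freely_reduced (length s) v" using j(2) w by (simp add: freely_reduced_snoc)
      moreover have "j' div ?b \<le> i"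
      proof -
        have "j' div ?b \<le> j" unfolding j' by (meson div_le_dividend le_Suc_eq)
        also have "j \<le> i'" using j(1) div_le_dividend le_trans by blast
        finally show ?thesis by (simp add: Suc)
      qed
      ultimately show ?thesis by (auto simp: v_def)
    qed
  qed
qed

lemma step1_selectsI:
  assumes "length s > 0" "0 < j" "freely_reduced (length s) (bfs_word (2 * length s) j)"
    and "\<exists>m\<in>{1..n}. is_cycle (target_length s) (word_prod s (bfs_word (2 * length s) j) ^^ m)"
    and before: "\<And>i m. \<lbrakk>0 < i; i < j; freely_reduced (length s) (bfs_word (2 * length s) i); m \<in> {1..n}\<rbrakk>
      \<Longrightarrow>
      \<not> is_cycle (target_length s) (word_prod s (bfs_word (2 * length s) i) ^^ m)"
  shows "step1_selects n s (bfs_word (2 * length s) j)"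
proof -
  let ?P = "\<lambda>v. \<exists>m\<in>{1..n}. is_cycle (target_length s) (word_prod s v ^^ m)"
  let ?w = "bfs_word (2 * length s)"
  have "[1..<Suc j] = [1..<j] @ [j]" using assms(2) by simp
  then have "filter (freely_reduced (length s)) (first_words (length s) j)
      = filter (freely_reduced (length s)) (map ?w [1..<j]) @ [?w j]"
    using assms(3) by (simp add: first_words_eq[OF assms(1)])
  moreover have "find ?P (filter (freely_reduced (length s)) (map ?w [1..<j])) = None"
    using before by (force simp: find_None_iff)
  moreover have "find Q (xs @ [x]) = Some x" if "find Q xs = None" "Q x" for Q xs and x :: "nat list"
    using that by (induction xs) (auto split: if_splits)
  ultimately show ?thesis
    using assms(4) unfolding step1_selects_def by (intro exI[of _ j]) simp
qed

text \<open>
  The odometer on words that are stored with their last letter first; an overflow adds a digit.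
\<close>

fun bump :: "nat \<Rightarrow> nat list \<Rightarrow> nat list" where
  "bump b [] = [0]"
| "bump b (a # r) = (if Suc a = b then 0 # bump b r else Suc a # r)"

text \<open>
  Incrementing the index increments the last letter, or resets it to 0 and moves on to the next parent:
  the carry of the odometer.
\<close>

lemma bfs_word_Suc_eq_bump:
  "b > 0 \<Longrightarrow> bfs_word b (Suc j) = rev (bump b (rev (bfs_word b j)))"
proof (induction j rule: less_induct)
  case (less j)
  show ?case
  proof (cases j)
    case (Suc i)
    show ?thesis
    proof (cases "Suc (i mod b) = b")
      case True
      then have "Suc i div b = Suc (i div b)" "Suc i mod b = 0"
        by (simp_all add: div_Suc mod_Suc)
      moreover have "bfs_word b (Suc (i div b)) = rev (bump b (rev (bfs_word b (i div b))))"
        using less Suc by (simp add: le_imp_less_Suc del: bfs_word.simps)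
      ultimately show ?thesis using True
        by (simp add: Suc bfs_word.simps(2)[of b "Suc i"] del: bfs_word.simps) (simp add: bfs_word.simps)
    next
      case False
      then have "Suc i div b = i div b" "Suc i mod b = Suc (i mod b)"
        using less(2) by (simp_all add: div_Suc mod_Suc)
      then show ?thesis using False by (simp add: Suc)
    qed
  qed simp
qed

lemma inv_letter_invol: "a < 2 * k \<Longrightarrow> inv_letter k (inv_letter k a) = a"
proof -
  assume "a < 2 * k"
  then consider "a < k" | "k \<le> a" "a < 2 * k" by linarith
  then show ?thesis
  proof cases
    case 1
    have "(a + k + k) mod (2 * k) = (a + 2 * k) mod (2 * k)" by (simp add: mult_2 add.assoc)
    then show ?thesis using 1 by (simp add: inv_letter_def)
  next
    case 2
    have "a + k = a - k + 2 * k" using 2 by simp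
    then have "(a + k) mod (2 * k) = (a - k) mod (2 * k)" by (simp only: mod_add_self2)
    then show ?thesis using 2 by (simp add: inv_letter_def)
  qed
qed

lemma freely_reduced_rev:
  assumes "set r \<subseteq> {..<2 * k}"
  shows "freely_reduced k (rev r) \<longleftrightarrow> (\<forall>i. Suc i < length r \<longrightarrow> r ! Suc i \<noteq> inv_letter k (r ! i))"
proof -
  have "r ! i = inv_letter k (r ! Suc i) \<longleftrightarrow> r ! Suc i = inv_letter k (r ! i)" if "Suc i < length r" for i
  proof -
    have "r ! j < 2 * k" if "j < length r" for j using assms nth_mem[OF that] by auto
    then have "r ! i < 2 * k" "r ! Suc i < 2 * k" using that by auto
    then show ?thesis using inv_letter_invol by metis
  qed
  then show ?thesis unfolding freely_reduced_def successively_rev by (auto simp: successively_conv_nth)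
qed

lemma mod_inv_letter: "(a + k) mod (2 * k) = inv_letter k a"
  by (simp add: inv_letter_def)

section \<open>Powers that are cycles\<close>

text \<open>
  The two properties of a cycle that matter below: its set of moved points has \<open>c\<close> elements, and it is
  a single orbit.
\<close>

lemma is_cycleE:
  assumes "is_cycle c p" "c \<ge> 2"
  obtains C where "finite C" "card C = c" "\<And>i. p i \<noteq> i \<longleftrightarrow> i \<in> C"
    "\<And>i. i \<in> C \<Longrightarrow> C \<subseteq> range (\<lambda>j. (p ^^ j) i)"
proof -
  obtain cs where cs: "cycle cs" "length cs = c" "p = cycle_of_list cs"
    using assms by (auto simp: is_cycle_def)
  have step: "(p ^^ m) (cs ! a) = cs ! ((m + a) mod c)" if "a < c" for a m
    using cyclic_rotation[OF cs(1), of m] that cs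
    by (metis nth_map nth_rotate add.commute)
  show thesis
  proof
    show "finite (set cs)" "card (set cs) = c" using cs distinct_card by auto
    show "p i \<noteq> i \<longleftrightarrow> i \<in> set cs" for i
    proof
      assume "i \<in> set cs"
      then obtain a where a: "a < c" "i = cs ! a" using cs by (auto simp: in_set_conv_nth)
      have "p i = cs ! (Suc a mod c)" using step[of a 1] a by simp
      moreover have "Suc a mod c \<noteq> a" using a assms(2)
        by (metis Suc_lessI less_2_cases_iff lessI mod_less mod_self n_not_Suc_n not_less)
      moreover have "Suc a mod c < c" using a by simp
      ultimately show "p i \<noteq> i" using cs(1,2) a by (simp add: nth_eq_iff_index_eq)
    qed (use cs id_outside_supp[of i cs] in auto)
    show "set cs \<subseteq> range (\<lambda>j. (p ^^ j) i)" if i: "i \<in> set cs" for i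
    proof
      fix x assume "x \<in> set cs"
      then obtain a b where ab: "a < c" "b < c" "i = cs ! a" "x = cs ! b"
        using i cs by (metis in_set_conv_nth)
      have "(c - a + b + a) mod c = b" using ab by simp
      then have "x = (p ^^ (c - a + b)) i" using step[of a "c - a + b"] ab by simp
      then show "x \<in> range (\<lambda>j. (p ^^ j) i)" by blast
    qed
  qed
qed

lemma card_support: "permutation p \<Longrightarrow> card (set (support p i)) = least_power p i"
  using distinct_card[OF cycle_of_permutation, of p i] by simp

lemma least_power_support:
  assumes "permutation p" "j \<in> set (support p i)"
  shows "least_power p j = least_power p i"
proof -
  have "inj (p ^^ m)" for m
    using assms(1) by (simp add: bij_is_inj inj_fn permutation_bijective)
  obtain m where j: "j = (p ^^ m) i" using assms(2) by auto
  have "(p ^^ d) j = (p ^^ m) ((p ^^ d) i)" for d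
    by (metis j add.commute comp_apply funpow_add)
  then have "(p ^^ d) j = j \<longleftrightarrow> (p ^^ d) i = i" for d
    using \<open>inj (p ^^ m)\<close> by (simp add: j inj_eq)
  then show ?thesis by (simp add: least_power_def)
qed

text \<open>
  Let \<open>p ^^ m\<close> be a \<open>c\<close>-cycle with moved points \<open>C\<close>. As \<open>p\<close> commutes with \<open>p ^^ m\<close>, it maps \<open>C\<close> into
  itself, so the \<open>p\<close>-orbit of a point of \<open>C\<close> lies in \<open>C\<close>; it contains the \<open>p ^^ m\<close>-orbit, which is all
  of \<open>C\<close>. Hence \<open>C\<close> is a cycle of \<open>p\<close> of length \<open>c\<close>, and all points outside are fixed by \<open>p ^^ m\<close>.
  Conversely, if \<open>c\<close> is prime and does not divide \<open>m\<close>, then the \<open>m\<close>-th power of the only cycle of length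
  \<open>c\<close> is again a cycle of length \<open>c\<close>.
\<close>

lemma power_is_cycle_iff:
  assumes p: "p permutes A" and "finite A" and c: "prime c"
  shows "is_cycle c (p ^^ m) \<longleftrightarrow> \<not> c dvd m \<and> card {i \<in> A. least_power p i = c} = c \<and>
    (\<forall>i\<in>A. least_power p i \<noteq> c \<longrightarrow> least_power p i dvd m)"
proof
  have perm: "permutation p" using assms permutation_permutes by blast
  have c2: "c \<ge> 2" using c by (simp add: prime_ge_2_nat)
  {
    assume "is_cycle c (p ^^ m)"
    then obtain C where C: "finite C" "card C = c" "\<And>i. (p ^^ m) i \<noteq> i \<longleftrightarrow> i \<in> C"
      and orbit: "\<And>i. i \<in> C \<Longrightarrow> C \<subseteq> range (\<lambda>j. ((p ^^ m) ^^ j) i)"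
      using is_cycleE c2 by blast
    have "C \<subseteq> A" using C(3) permutes_not_in[OF permutes_funpow[OF p]] by blast
    have inC: "least_power p i = c" if "i \<in> C" for i
    proof -
      have "(p ^^ j) i \<in> C" for j
      proof -
        have "(p ^^ m) ((p ^^ j) i) = (p ^^ j) ((p ^^ m) i)"
          by (metis add.commute comp_apply funpow_add)
        moreover have "inj (p ^^ j)" using perm by (simp add: bij_is_inj inj_fn permutation_bijective)
        ultimately show ?thesis using C(3) that by (metis injD)
      qed
      then have "set (support p i) \<subseteq> C" by auto
      moreover have "C \<subseteq> set (support p i)"
        using orbit[OF that] unfolding support_set[OF perm] by (auto simp: funpow_mult)
      ultimately show ?thesis using card_support[OF perm, of i] C(2) by simp
    qed
    have "C \<noteq> {}" using C c2 by auto
    then have "\<not> c dvd m" using inC C(3) least_power_dvd[OF perm] by blast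
    moreover have "least_power p i dvd m" if "i \<notin> C" for i
      using that C(3) least_power_dvd[OF perm] by blast
    moreover from calculation have "{i \<in> A. least_power p i = c} = C"
      using inC \<open>C \<subseteq> A\<close> by auto
    ultimately show "\<not> c dvd m \<and> card {i \<in> A. least_power p i = c} = c \<and>
        (\<forall>i\<in>A. least_power p i \<noteq> c \<longrightarrow> least_power p i dvd m)"
      using C(2) inC by (metis dvd_refl)
  }
  {
    assume R: "\<not> c dvd m \<and> card {i \<in> A. least_power p i = c} = c \<and>
        (\<forall>i\<in>A. least_power p i \<noteq> c \<longrightarrow> least_power p i dvd m)"
    define C where "C = {i \<in> A. least_power p i = c}"
    have "C \<noteq> {}" using R c2 C_def by (metis card.empty not_numeral_le_zero)
    then obtain i where i: "i \<in> A" "least_power p i = c" by (auto simp: C_def)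
    define q where "q = p ^^ m"
    have q: "permutation q" by (simp add: q_def permutation_funpow perm)
    have fixed: "q j = j" if "j \<notin> C" for j
    proof (cases "j \<in> A")
      case True
      then show ?thesis using that R by (simp add: C_def q_def flip: least_power_dvd[OF perm])
    next
      case False
      then show ?thesis using permutes_not_in[OF permutes_funpow[OF p]] by (simp add: q_def)
    qed
    have "least_power q i dvd d \<longleftrightarrow> c dvd d" for d
    proof -
      have "least_power q i dvd d \<longleftrightarrow> c dvd m * d"
        unfolding least_power_dvd[OF q] i(2)[symmetric] least_power_dvd[OF perm]
        by (simp add: q_def funpow_mult)
      then show ?thesis using R c by (simp add: prime_dvd_mult_iff)
    qed
    then have lq: "least_power q i = c" by (meson dvd_antisym dvd_refl)
    have "set (support q i) \<subseteq> C"
    proof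
      fix j assume "j \<in> set (support q i)"
      then obtain d where j: "j = (p ^^ (m * d)) i" by (auto simp: q_def funpow_mult)
      then have "j \<in> set (support p i)" unfolding support_set[OF perm] by blast
      moreover have "j \<in> A" using i(1) unfolding j
        by (simp only: permutes_in_image[OF permutes_funpow[OF p]])
      ultimately show "j \<in> C" using i least_power_support[OF perm, of j i] by (auto simp: C_def)
    qed
    moreover have "card (set (support q i)) = card C" using R trans[OF card_support[OF q] lq]
      by (simp only: C_def)
    moreover have "finite C" using assms(2) by (simp add: C_def)
    ultimately have sup: "set (support q i) = C" by (metis card_subset_eq)
    have "q = cycle_of_list (support q i)"
    proof
      fix j show "q j = cycle_of_list (support q i) j"
        using cycle_restrict[OF q, of j i] id_outside_supp[of j "support q i"] fixed[of j] sup
        by (cases "j \<in> C") auto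
    qed
    then show "is_cycle c (p ^^ m)"
      unfolding is_cycle_def q_def[symmetric] using cycle_of_permutation[OF q, of i] lq
      by (intro exI[of _ "support q i"] conjI) (assumption, simp)
  }
qed

lemma not_is_cycle_id: "c \<ge> 2 \<Longrightarrow> \<not> is_cycle c id"
proof
  assume c: "c \<ge> 2" and id: "is_cycle c id"
  show False
  proof (rule is_cycleE[OF id c])
    fix C assume "card C = c" "\<And>i. id i \<noteq> i \<longleftrightarrow> i \<in> C"
    then have "C = {}" "card C = c" by auto
    then show False using c by simp
  qed
qed

section \<open>Total correctness with a clock\<close>

text \<open>
  The clock \<open>t\<close> is part of the assertions. As time only accumulates, an invariant can charge
  amortised costs to any quantity that it mentions, such as the number of marked points.
\<close>

definition wp :: "nat \<Rightarrow> nat \<Rightarrow> com \<Rightarrow> (state \<Rightarrow> nat \<Rightarrow> bool) \<Rightarrow> state \<Rightarrow> nat \<Rightarrow> bool" where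
  "wp W M c Q \<sigma> t \<longleftrightarrow> (\<exists>d \<tau>. exec W M c \<sigma> d \<tau> \<and> Q \<tau> (t + d))"

primrec written_regs :: "com \<Rightarrow> reg set" where
  "written_regs Skip = {}"
| "written_regs (x ::= e) = {x}"
| "written_regs (A\<lbrakk>i\<rbrakk> ::= e) = {}"
| "written_regs (c1;; c2) = written_regs c1 \<union> written_regs c2"
| "written_regs (IF b THEN c1 ELSE c2) = written_regs c1 \<union> written_regs c2"
| "written_regs (WHILE b DO c) = written_regs c"

primrec written_arrs :: "com \<Rightarrow> arr set" where
  "written_arrs Skip = {}"
| "written_arrs (x ::= e) = {}"
| "written_arrs (A\<lbrakk>i\<rbrakk> ::= e) = {A}"
| "written_arrs (c1;; c2) = written_arrs c1 \<union> written_arrs c2"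
| "written_arrs (IF b THEN c1 ELSE c2) = written_arrs c1 \<union> written_arrs c2"
| "written_arrs (WHILE b DO c) = written_arrs c"

lemma written_for_loop [simp]:
  "written_regs (FOR x FROM lo BELOW hi DO c) = insert x (written_regs c)"
  "written_arrs (FOR x FROM lo BELOW hi DO c) = written_arrs c"
  by (auto simp: for_loop_def)

text \<open>
  What a program cannot change by its syntax. The rules for loops below supply these facts for each
  iteration, which keeps them out of the invariants.
\<close>

definition frame :: "com \<Rightarrow> state \<Rightarrow> state \<Rightarrow> bool" where
  "frame c \<sigma> \<tau> \<longleftrightarrow> (\<forall>x. x \<notin> written_regs c \<longrightarrow> regs \<tau> x = regs \<sigma> x) \<and>
    (\<forall>A. A \<notin> written_arrs c \<longrightarrow> mem \<tau> A = mem \<sigma> A)"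

lemma frame_refl: "frame c \<sigma> \<sigma>"
  by (simp add: frame_def)

lemma frame_trans: "frame c \<sigma>1 \<sigma>2 \<Longrightarrow> frame c \<sigma>2 \<sigma>3 \<Longrightarrow> frame c \<sigma>1 \<sigma>3"
  by (simp add: frame_def)

lemma exec_frame: "exec W M c \<sigma> t \<tau> \<Longrightarrow> frame c \<sigma> \<tau>"
  by (induction rule: exec.induct) (auto simp: frame_def)

lemma wp_conseq:
  assumes "wp W M c P \<sigma> t" "\<And>\<tau> t'. P \<tau> t' \<Longrightarrow> frame c \<sigma> \<tau> \<Longrightarrow> Q \<tau> t'"
  shows "wp W M c Q \<sigma> t"
  using assms exec_frame unfolding wp_def by blast

lemma wp_skip: "Q \<sigma> (t + 1) \<Longrightarrow> wp W M Skip Q \<sigma> t"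
  unfolding wp_def by (blast intro: exec.Skip)

lemma wp_assign:
  "safe W M e \<sigma> \<Longrightarrow> Q (\<sigma>\<lparr>regs := (regs \<sigma>)(x := val e \<sigma>)\<rparr>) (t + (cost e + 1)) \<Longrightarrow> wp W M (x ::= e) Q \<sigma> t"
  unfolding wp_def by (blast intro: exec.Assign)

lemma wp_store:
  "\<lbrakk>safe W M i \<sigma>; val i \<sigma> < M; safe W M e \<sigma>;
    Q (\<sigma>\<lparr>mem := (mem \<sigma>)(A := (mem \<sigma> A)(val i \<sigma> := val e \<sigma>))\<rparr>) (t + (cost i + cost e + 1))\<rbrakk>
    \<Longrightarrow> wp W M (A\<lbrakk>i\<rbrakk> ::= e) Q \<sigma> t"
  unfolding wp_def by (blast intro: exec.Store)

lemma wp_seq: "wp W M c1 (wp W M c2 Q) \<sigma> t \<Longrightarrow> wp W M (c1;; c2) Q \<sigma> t"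
  unfolding wp_def by (metis exec.Seq add.assoc)

lemma wp_if:
  assumes "safe W M b \<sigma>"
    and "val b \<sigma> \<noteq> 0 \<Longrightarrow> wp W M c1 Q \<sigma> (t + (cost b + 1))"
    and "val b \<sigma> = 0 \<Longrightarrow> wp W M c2 Q \<sigma> (t + (cost b + 1))"
  shows "wp W M (IF b THEN c1 ELSE c2) Q \<sigma> t"
proof (cases "val b \<sigma> = 0")
  case True
  then obtain d \<tau> where "exec W M c2 \<sigma> d \<tau>" "Q \<tau> (t + (cost b + 1) + d)"
    using assms(3) by (auto simp: wp_def)
  then show ?thesis
    unfolding wp_def using exec.IfFalse[OF assms(1) True] by (metis ab_semigroup_add_class.add_ac)
next
  case False
  then obtain d \<tau> where "exec W M c1 \<sigma> d \<tau>" "Q \<tau> (t + (cost b + 1) + d)"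
    using assms(2) by (auto simp: wp_def)
  then show ?thesis
    unfolding wp_def using exec.IfTrue[OF assms(1) False] by (metis ab_semigroup_add_class.add_ac)
qed

text \<open>
  The variant \<open>m\<close> is an argument of the invariant and need not be a function of the state. It can thus
  depend on data that the program does not store, such as the index of the current word.
\<close>

lemma wp_while_variant:
  fixes I :: "nat \<Rightarrow> state \<Rightarrow> nat \<Rightarrow> bool"
  assumes "I m \<sigma> t"
    and safe: "\<And>m \<tau> t'. I m \<tau> t' \<Longrightarrow> frame c \<sigma> \<tau> \<Longrightarrow> safe W M b \<tau>"
    and exit: "\<And>m \<tau> t'. I m \<tau> t' \<Longrightarrow> frame c \<sigma> \<tau> \<Longrightarrow> val b \<tau> = 0 \<Longrightarrow> Q \<tau> (t' + (cost b + 1))"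
    and step: "\<And>m \<tau> t'. I m \<tau> t' \<Longrightarrow> frame c \<sigma> \<tau> \<Longrightarrow> val b \<tau> \<noteq> 0 \<Longrightarrow>
      wp W M c (\<lambda>\<tau>' t''. \<exists>m'<m. I m' \<tau>' t'') \<tau> (t' + (cost b + 1))"
  shows "wp W M (WHILE b DO c) Q \<sigma> t"
proof -
  have "wp W M (WHILE b DO c) Q \<tau> t'" if "I m \<tau> t'" "frame c \<sigma> \<tau>" for m \<tau> t'
    using that
  proof (induction m arbitrary: \<tau> t' rule: less_induct)
    case (less m)
    show ?case
    proof (cases "val b \<tau> = 0")
      case True
      then show ?thesis
        using exec.WhileFalse[OF safe[OF less(2,3)] True, of c] exit[OF less(2,3) True] unfolding wp_def
          by blast
    next
      case False
      then obtain d \<tau>' m' where d: "exec W M c \<tau> d \<tau>'" "I m' \<tau>' (t' + (cost b + 1) + d)" "m' < m"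
        using step[OF less(2,3) False] by (auto simp: wp_def)
      then have "wp W M (WHILE b DO c) Q \<tau>' (t' + (cost b + 1) + d)"
        using less(1) less(3) exec_frame frame_trans by blast
      then obtain d' \<tau>'' where "exec W M (WHILE b DO c) \<tau>' d' \<tau>''" "Q \<tau>'' (t' + (cost b + 1) + d + d')"
        by (auto simp: wp_def)
      moreover from this have "exec W M (WHILE b DO c) \<tau> (cost b + d + d' + 1) \<tau>''"
        using exec.WhileTrue[OF safe[OF less(2,3)] False d(1)] by blast
      ultimately show ?thesis unfolding wp_def
        by (intro exI[of _ "cost b + d + d' + 1"]) (auto simp: ac_simps)
    qed
  qed
  then show ?thesis using assms(1) frame_refl by blast
qed

lemma wp_while:
  fixes f :: "state \<Rightarrow> nat"
  assumes "I \<sigma> t"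
    and step: "\<And>\<tau> t'. I \<tau> t' \<Longrightarrow> frame c \<sigma> \<tau> \<Longrightarrow> safe W M b \<tau> \<and>
      (if val b \<tau> = 0 then Q \<tau> (t' + (cost b + 1))
       else wp W M c (\<lambda>\<tau>' t''. I \<tau>' t'' \<and> f \<tau>' < f \<tau>) \<tau> (t' + (cost b + 1)))"
  shows "wp W M (WHILE b DO c) Q \<sigma> t"
proof (rule wp_while_variant[where I = "\<lambda>m \<tau> t'. I \<tau> t' \<and> m = f \<tau>" and m = "f \<sigma>"])
  fix m \<tau> t'
  assume I: "I \<tau> t' \<and> m = f \<tau>" and fr: "frame c \<sigma> \<tau>"
  note st = step[OF conjunct1[OF I] fr]
  show "safe W M b \<tau>" using st by blast
  show "Q \<tau> (t' + (cost b + 1))" if "val b \<tau> = 0" using st that by simp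
  show "wp W M c (\<lambda>\<tau>' t''. \<exists>m'<m. I \<tau>' t'' \<and> m' = f \<tau>') \<tau> (t' + (cost b + 1))" if "val b \<tau> \<noteq> 0"
    by (rule wp_conseq[where P = "\<lambda>\<tau>' t''. I \<tau>' t'' \<and> f \<tau>' < f \<tau>"]) (use st that I in simp_all)
qed (use assms(1) in simp)

text \<open>
  The constant 4 is the cost of the increment, and \<open>cost hi + 3\<close> that of the test.
\<close>

lemma wp_for:
  assumes lo: "safe W M lo \<sigma>" and start: "I (val lo \<sigma>) (\<sigma>\<lparr>regs := (regs \<sigma>)(x := val lo \<sigma>)\<rparr>) (t + (cost lo
    + 1))"
    and le: "val lo \<sigma> \<le> H" and "H < W" "1 < W"
    and hi: "\<And>\<tau>. frame (x ::= lo;; c) \<sigma> \<tau> \<Longrightarrow> safe W M hi \<tau> \<and> val hi \<tau> = H"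
    and step: "\<And>i \<tau> t'. \<lbrakk>i < H; val lo \<sigma> \<le> i; I i \<tau> t'; regs \<tau> x = i; frame (x ::= lo;; c) \<sigma> \<tau>\<rbrakk> \<Longrightarrow>
      wp W M c (\<lambda>\<tau>' t''. regs \<tau>' x = i \<and> I (Suc i) (\<tau>'\<lparr>regs := (regs \<tau>')(x := Suc i)\<rparr>) (t'' + 4))
        \<tau> (t' + (cost hi + 3))"
    and exit: "\<And>\<tau> t'. \<lbrakk>I H \<tau> t'; regs \<tau> x = H; frame (x ::= lo;; c) \<sigma> \<tau>\<rbrakk> \<Longrightarrow> Q \<tau> (t' + (cost hi + 3))"
  shows "wp W M (FOR x FROM lo BELOW hi DO c) Q \<sigma> t"
proof -
  let ?\<sigma> = "\<sigma>\<lparr>regs := (regs \<sigma>)(x := val lo \<sigma>)\<rparr>"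
  have fr: "frame (x ::= lo;; c) \<sigma> \<tau>" if "frame (c;; x ::= Reg x \<^bold>+ Lit 1) ?\<sigma> \<tau>" for \<tau>
    using that by (auto simp: frame_def)
  have W: "i < W" if "i \<le> H" for i using that \<open>H < W\<close> by simp
  show ?thesis
    unfolding for_loop_def
    apply (rule wp_seq, rule wp_assign[OF lo])
    apply (rule wp_while[where I = "\<lambda>\<tau> t'. regs \<tau> x \<le> H \<and> val lo \<sigma> \<le> regs \<tau> x \<and> I (regs \<tau> x) \<tau> t'"
          and f = "\<lambda>\<tau>. H - regs \<tau> x"])
     apply (simp add: le start[simplified])
    subgoal premises prems for \<tau> t'
    proof -
      let ?i = "regs \<tau> x"
      note I = prems(1) and fr = fr[OF prems(2)]
      have hi': "safe W M hi \<tau>" "val hi \<tau> = H" using hi[OF fr] by auto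
      have body: "wp W M (c;; x ::= Reg x \<^bold>+ Lit 1) (\<lambda>\<tau>' t''. (regs \<tau>' x \<le> H \<and> val lo \<sigma> \<le> regs \<tau>' x \<and>
          I (regs \<tau>' x) \<tau>' t'') \<and> H - regs \<tau>' x < H - ?i) \<tau> (t' + (cost hi + 3))"
        if "?i < H"
        apply (rule wp_seq)
        apply (rule wp_conseq)
         apply (rule step[OF that, of \<tau> t'])
        using I fr that W[of "Suc ?i"] W[of ?i] \<open>1 < W\<close>
            apply (auto intro!: wp_assign simp: numeral_eq_Suc)
        done
      show ?thesis
        using exit[of \<tau> t'] I fr hi' body W[of 1] W[of ?i] \<open>1 < W\<close> \<open>H < W\<close>
        by (auto simp: numeral_3_eq_3)
    qed
    done
qed

section \<open>Inverses, powers and products of the generators\<close>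

text \<open>
  Word size and memory that suffice for the routines common to both programs. Products such as a
  least common multiple of two numbers up to \<open>n\<close> must fit into a machine word.
\<close>

locale step1_machine =
  fixes n k W M :: nat and s :: "(nat \<Rightarrow> nat) list"
  assumes length_s: "length s = k" and k_ge_2: "k \<ge> 2" and n_ge_2: "n \<ge> 2"
    and perms: "\<forall>p\<in>set s. p permutes {1..n}"
    and gens_fit: "2 * k * Suc n \<le> M" and fits: "M \<le> W" and squares_fit: "Suc n * Suc n < W"
begin

lemma width_fits: "4 * Suc n \<le> M"
proof -
  have "4 * Suc n \<le> 2 * k * Suc n" using k_ge_2 by (intro mult_le_mono1) simp
  then show ?thesis using gens_fit by linarith
qed

lemma letters_fit: "2 * k * 3 \<le> M"
proof -
  have "2 * k * 3 \<le> 2 * k * Suc n" using n_ge_2 by (intro mult_le_mono2) simp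
  then show ?thesis using gens_fit by linarith
qed

text \<open>
  The first \<open>K\<close> letters have their permutations in the array. The case \<open>K = k\<close> is the input, and \<open>K = 2 * k\<close>
  is what the searches need.
\<close>

definition gen_rows :: "nat \<Rightarrow> (nat \<Rightarrow> nat) \<Rightarrow> bool" where
  "gen_rows K A \<longleftrightarrow> (\<forall>a<K. \<forall>i\<le>n. A (a * Suc n + i) = (signed_gens s ! a) i)"

lemma row_less: "a < r \<Longrightarrow> i \<le> n \<Longrightarrow> a * Suc n + i < r * Suc n"
proof -
  assume "a < r" "i \<le> n"
  then have "Suc a * Suc n \<le> r * Suc n" by (intro mult_le_mono1) simp
  then show ?thesis using \<open>i \<le> n\<close> by simp
qed

lemma row_eq_iff:
  assumes "i \<le> n" "j \<le> n"
  shows "a * Suc n + i = b * Suc n + j \<longleftrightarrow> a = b \<and> i = j"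
  using row_less[of a b i] row_less[of b a j] assms by (cases a b rule: linorder_cases) auto

lemma gen_index_fits: "a < 2 * k \<Longrightarrow> i \<le> n \<Longrightarrow> a * Suc n + i < M"
  using row_less[of a "2 * k" i] gens_fit by linarith

lemma generator_permutes: "a < 2 * k \<Longrightarrow> signed_gens s ! a permutes {1..n}"
  using signed_gens_permutes[OF perms, of a] length_s by simp

lemma permutes_le:
  assumes "p permutes {1..n}" "i \<le> n"
  shows "p i \<le> n"
  using permutes_in_image[OF assms(1), of i] permutes_not_in[OF assms(1), of i] assms(2)
  by (cases "i = 0") auto

lemmas generator_le = permutes_le[OF generator_permutes]

definition inputs :: "state \<Rightarrow> bool" where
  "inputs \<sigma> \<longleftrightarrow> regs \<sigma> Deg = n \<and> regs \<sigma> NGen = k"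

lemma small_values:
  "n < W" "Suc n < W" "Suc n \<le> M" "n < M" "k < W" "2 * k < W" "0 < W" "Suc 0 < W" "2 < W" "3 < W"
  "0 < M" "Suc 0 < M"
  using width_fits letters_fit fits n_ge_2 k_ge_2 by auto

lemma le_fits: "i \<le> n \<Longrightarrow> i < M" "i \<le> n \<Longrightarrow> i < W"
  using small_values by auto

text \<open>
  Array addresses have the form \<open>a * Suc n + i\<close>. The simplifier keeps these products, so that the facts
  about row indices apply to them.
\<close>

context
  notes [simp del] = mult_Suc_right and [simp] = small_values mult_Suc_right[of "numeral _"]
    mult_Suc_right[of _ 0]
begin

lemma index_parts_fit:
  assumes "a < 2 * k" "i \<le> n"
  shows "a * Suc n + i < W" "a * Suc n < W" "i < W" "a < W"
  using gen_index_fits[OF assms] fits assms small_values(6) by (auto intro: less_trans)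

text \<open>
  Row \<open>k + a\<close> is completed in round \<open>a\<close>, which turns \<open>gen_rows\<close> of \<open>k + a\<close> into that of the successor; so
  \<open>gen_rows\<close> is itself the loop invariant.
\<close>

lemma wp_compute_inverses:
  assumes "inputs \<sigma>" "gen_rows k (mem \<sigma> Gen)"
  shows "wp W M compute_inverses (\<lambda>\<sigma>' t'. gen_rows (2 * k) (mem \<sigma>' Gen) \<and> t' \<le> t + 60 * k * Suc n) \<sigma> t"
proof -
  have regs: "regs \<sigma> Deg = n" "regs \<sigma> NGen = k" using assms(1) by (auto simp: inputs_def)
  show ?thesis
    unfolding compute_inverses_def
    apply (rule wp_for[where H = k and I = "\<lambda>a \<tau> t'. gen_rows (k + a) (mem \<tau> Gen) \<and> t'
      \<le> t + 3 + a * (20 + 30 * Suc n)"])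
    subgoal by (use assms in \<open>auto simp: regs frame_def\<close>)
    subgoal by (use assms in \<open>auto simp: regs frame_def\<close>)
    subgoal by (use assms in \<open>auto simp: regs frame_def\<close>)
    subgoal by (use assms in \<open>auto simp: regs frame_def\<close>)
    subgoal by (use assms in \<open>auto simp: regs frame_def\<close>)
    subgoal by (use assms in \<open>auto simp: regs frame_def\<close>)
    subgoal premises prems for a \<tau> t'
    proof -
      have a: "a < k" "k + a < 2 * k" "a < 2 * k" using prems by auto
      have sg: "signed_gens s ! (k + a) = inv (s ! a)" "signed_gens s ! a = s ! a"
        using a length_s by (auto simp: signed_gens_def nth_append)
      have p: "s ! a permutes {1..n}" using generator_permutes[of a] a sg by auto
      note p_le = permutes_le[OF p]
      have reg: "regs \<tau> Deg = n" "regs \<tau> NGen = k" "regs \<tau> Ltr = a" using prems regs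
        by (auto simp: frame_def)
      show ?thesis
        apply (rule wp_for[where H = "Suc n" and I = "\<lambda>i \<tau>' t''.
            gen_rows (k + a) (mem \<tau>' Gen) \<and> (\<forall>j<i. mem \<tau>' Gen ((k + a) * Suc n + (s ! a) j) = j) \<and>
            t'' \<le> t' + 10 + 30 * i"])
              subgoal by (use prems in \<open>auto simp: reg frame_def\<close>)
              subgoal by (use prems in \<open>auto simp: reg frame_def\<close>)
              subgoal by (use prems in \<open>auto simp: reg frame_def\<close>)
              subgoal by (use prems in \<open>auto simp: reg frame_def\<close>)
              subgoal by (use prems in \<open>auto simp: reg frame_def\<close>)
              subgoal by (use prems in \<open>auto simp: reg frame_def\<close>)
        subgoal premises prems2 for i \<tau>' t''
        proof -
          have i: "i \<le> n" using prems2 by simp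
          have reg': "regs \<tau>' Deg = n" "regs \<tau>' NGen = k" "regs \<tau>' Ltr = a" "regs \<tau>' Pos = i"
            using prems2 reg by (auto simp: frame_def)
          have val: "mem \<tau>' Gen (a * Suc n + i) = (s ! a) i"
            using prems2 a i by (auto simp: gen_rows_def sg[symmetric])
          have inj: "(s ! a) j = (s ! a) i \<longleftrightarrow> j = i" for j
            using permutes_inj[OF p] by (auto simp: inj_def)
          show ?thesis
            apply (rule wp_store)
            using prems2 a i p_le[OF i] index_parts_fit[OF a(2) p_le[OF i]] index_parts_fit[OF a(3) i]
              gen_index_fits[OF a(2) p_le[OF i]] gen_index_fits[OF a(3) i]
            by (auto simp: reg' val frame_def gen_rows_def row_eq_iff p_le inj less_Suc_eq)
        qed
        subgoal premises prems2 for \<tau>' t''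
        proof -
          have "mem \<tau>' Gen ((k + a) * Suc n + j) = inv (s ! a) j" if "j \<le> n" for j
          proof -
            have "inv (s ! a) j < Suc n" using permutes_le[OF permutes_inv[OF p] that] by simp
            then have "mem \<tau>' Gen ((k + a) * Suc n + (s ! a) (inv (s ! a) j)) = inv (s ! a) j"
              using prems2 by blast
            then show ?thesis by (simp add: permutes_inverses(1)[OF p])
          qed
          then have "gen_rows (k + Suc a) (mem \<tau>' Gen)"
            using prems2 by (auto simp: gen_rows_def less_Suc_eq sg)
          then show ?thesis using prems2 prems reg
            by (auto simp: frame_def algebra_simps mult_Suc mult_Suc_right)
        qed
        done
    qed
    subgoal using k_ge_2 by (auto simp: algebra_simps mult_Suc_right mult_2_right)
    done
qed


definition prod_row :: "state \<Rightarrow> (nat \<Rightarrow> nat) \<Rightarrow> bool" where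
  "prod_row \<sigma> p \<longleftrightarrow> regs \<sigma> Base + n < M \<and> (\<forall>i\<le>n. mem \<sigma> Prod (regs \<sigma> Base + i) = p i)"

lemma wp_compute_mu:
  assumes "inputs \<sigma>" "prod_row \<sigma> p" and p: "p permutes {1..n}" and "regs \<sigma> Pow \<le> n"
  shows "wp W M compute_mu (\<lambda>\<sigma>' t'. (\<forall>i\<in>{1..n}. mem \<sigma>' Mu i = (p ^^ regs \<sigma> Pow) i) \<and>
    t' \<le> t + 60 * (Suc n * Suc n)) \<sigma> t"
proof -
  define m where "m = regs \<sigma> Pow"
  have reg: "regs \<sigma> Deg = n" "regs \<sigma> NGen = k" "regs \<sigma> Pow = m" "m \<le> n" "m < W"
    using assms(1,4) le_fits by (auto simp: inputs_def m_def)
  define b where "b = regs \<sigma> Base"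
  have b: "regs \<sigma> Base = b" "b + n < M" "b < W" "\<And>i. i \<le> n \<Longrightarrow> mem \<sigma> Prod (b + i) = p i"
    using assms(2) fits by (auto simp: b_def prod_row_def)
  have pow_le: "(p ^^ j) i \<le> n" if "i \<le> n" for i j
    using permutes_le[OF permutes_funpow[OF p] that] .
  show ?thesis
    unfolding compute_mu_def
    apply (rule wp_for[where H = "Suc n" and I = "\<lambda>i \<tau> t'.
        (\<forall>j\<in>{1..<i}. mem \<tau> Mu j = (p ^^ m) j) \<and> t' \<le> t + 3 + i * (40 + 20 * m)"])
    subgoal by auto
    subgoal by auto
    subgoal by auto
    subgoal by auto
    subgoal by auto
    subgoal by (auto simp: reg frame_def)
    subgoal premises prems for i \<tau> t'
    proof -
      have i: "i \<le> n" "0 < i" using prems by auto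
      have reg1: "regs \<tau> Deg = n" "regs \<tau> NGen = k" "regs \<tau> Pow = m" "regs \<tau> Base = b" "regs \<tau> Pos = i"
        "mem \<tau> Prod = mem \<sigma> Prod"
        using prems by (auto simp: frame_def reg b)
      show ?thesis
        apply (rule wp_seq, rule wp_assign)
        subgoal using i by (auto simp: reg1 intro: le_less_trans)
        apply (rule wp_seq)
        apply (rule wp_for[where H = m and I = "\<lambda>j \<tau>' t''. regs \<tau>' Pt = (p ^^ j) i \<and> t''
          \<le> t' + 10 + 20 * j"])
        subgoal by auto
        subgoal by (auto simp: reg1)
        subgoal by auto
        subgoal using reg by auto
        subgoal by auto
        subgoal using reg by (auto simp: frame_def reg1)
        subgoal premises prems2 for j \<tau>' t''
        proof -
          have "regs \<tau>' Base = b" "mem \<tau>' Prod = mem \<sigma> Prod" "regs \<tau>' Pt = (p ^^ j) i"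
            using prems2 by (auto simp: frame_def reg1)
          then show ?thesis
            apply (intro wp_assign)
            using pow_le[OF i(1), of j] pow_le[OF i(1), of "Suc j"] b fits prems2 by auto
        qed
        subgoal premises prems2 for \<tau>' t''
        proof -
          have fr: "regs \<tau>' Pos = i" "mem \<tau>' Mu = mem \<tau> Mu"
            using prems2 by (auto simp: frame_def reg1)
          have "i < M" "i < W" using i le_fits by auto
          then show ?thesis
            apply (intro wp_store)
            using prems2 prems le_fits(2)[OF pow_le[OF i(1), of m]] by (auto simp: fr)
        qed
        done
    qed
    subgoal premises prems for \<tau> t'
    proof -
      have "Suc n * (40 + 20 * m) \<le> Suc n * (40 * Suc n)" using reg(4) by (intro mult_le_mono2) simp
      moreover have "Suc n \<le> Suc n * Suc n" by simp
      ultimately show ?thesis using prems reg by (auto simp: algebra_simps mult_Suc_right)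
    qed
    done
qed

definition word_stored :: "state \<Rightarrow> nat list \<Rightarrow> bool" where
  "word_stored \<sigma> w \<longleftrightarrow> regs \<sigma> WLen = length w \<and> length w < M \<and> set w \<subseteq> {..<2 * k} \<and>
    (\<forall>j<length w. mem \<sigma> Word j = rev w ! j)"

text \<open>
  The letters are stored last letter first and applied in this order, so after \<open>j\<close> rounds the point has
  been mapped by the product of the last \<open>j\<close> letters of the word.
\<close>

lemma wp_compute_product:
  assumes "inputs \<sigma>" "gen_rows (2 * k) (mem \<sigma> Gen)" "word_stored \<sigma> w"
  shows "wp W M compute_product (\<lambda>\<sigma>' t'. (\<forall>i\<le>n. mem \<sigma>' Prod i = word_prod s w i) \<and>
    t' \<le> t + 60 * (Suc n * Suc (length w))) \<sigma> t"
proof -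
  define r where "r = rev w"
  have w: "w = rev r" by (simp add: r_def)
  have reg: "regs \<sigma> Deg = n" "regs \<sigma> NGen = k" "regs \<sigma> WLen = length r" "length r < W"
    using assms(1,3) fits by (auto simp: inputs_def word_stored_def r_def)
  have r: "mem \<sigma> Word j = r ! j" "r ! j < 2 * k" "j < M" "j < W" if "j < length r" for j
    using assms(3) that fits nth_mem[OF that] by (auto simp: word_stored_def r_def)
  have gen: "mem \<sigma> Gen (a * Suc n + i) = (signed_gens s ! a) i" if "a < 2 * k" "i \<le> n" for a i
    using assms(2) that by (auto simp: gen_rows_def)
  have prod_le: "word_prod s (rev (take j r)) i \<le> n" if "i \<le> n" for i j
  proof (rule permutes_le[OF word_prod_permutes[OF perms] that])
    show "set (rev (take j r)) \<subseteq> {..<2 * length s}"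
      using assms(3) set_take_subset[of j r] by (auto simp: word_stored_def r_def length_s)
  qed
  show ?thesis
    unfolding compute_product_def
    apply (rule wp_for[where H = "Suc n" and I = "\<lambda>i \<tau> t'.
        (\<forall>j<i. mem \<tau> Prod j = word_prod s w j) \<and> t' \<le> t + 3 + i * (40 + 30 * length w)"])
    subgoal by auto
    subgoal by auto
    subgoal by auto
    subgoal by auto
    subgoal by auto
    subgoal by (auto simp: reg frame_def)
    subgoal premises prems for i \<tau> t'
    proof -
      have i: "i \<le> n" "i < W" "i < M" using prems le_fits by auto
      have reg1: "regs \<tau> Deg = n" "regs \<tau> NGen = k" "regs \<tau> WLen = length r" "regs \<tau> Pos = i"
        "mem \<tau> Gen = mem \<sigma> Gen" "mem \<tau> Word = mem \<sigma> Word"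
        using prems by (auto simp: frame_def reg)
      show ?thesis
        apply (rule wp_seq, rule wp_assign)
        subgoal using i by (auto simp: reg1)
        apply (rule wp_seq)
        apply (rule wp_for[where H = "length r" and I = "\<lambda>j \<tau>' t''.
            regs \<tau>' Pt = word_prod s (rev (take j r)) i \<and> t'' \<le> t' + 10 + 30 * j"])
        subgoal by auto
        subgoal by (auto simp: reg1 word_prod_def)
        subgoal by auto
        subgoal using reg by auto
        subgoal by auto
        subgoal using reg by (auto simp: frame_def reg1)
        subgoal premises prems2 for j \<tau>' t''
        proof -
          let ?v = "word_prod s (rev (take j r)) i"
          have j: "j < length r" using prems2 by simp
          have v: "?v \<le> n" using prod_le[OF i(1)] .
          have reg2: "regs \<tau>' Deg = n" "regs \<tau>' Idx = j" "mem \<tau>' Gen = mem \<sigma> Gen" "mem \<tau>' Word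
            = mem \<sigma> Word"
            "regs \<tau>' Pt = ?v"
            using prems2 by (auto simp: frame_def reg1)
          have "word_prod s (rev (take (Suc j) r)) i = (signed_gens s ! (r ! j)) ?v"
            using j by (simp add: take_Suc_conv_app_nth word_prod_def)
          then show ?thesis
            apply (intro wp_assign)
            using prems2 generator_le[OF r(2)[OF j] v] index_parts_fit[OF r(2)[OF j] v]
              gen_index_fits[OF r(2)[OF j] v] le_fits(2)[OF generator_le[OF r(2)[OF j] v]]
            by (auto simp: reg2 r j gen v)
        qed
        subgoal premises prems2 for \<tau>' t''
        proof -
          have fr: "regs \<tau>' Pos = i" "mem \<tau>' Prod = mem \<tau> Prod"
            using prems2 by (auto simp: frame_def reg1)
          show ?thesis
            apply (intro wp_store)
            using prems2 prems le_fits(2)[OF prod_le[OF i(1), of "length r"]] i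
            by (auto simp: fr w less_Suc_eq)
        qed
        done
    qed
    subgoal by (auto simp: reg algebra_simps mult_Suc_right)
    done
qed


section \<open>The parity of a generator\<close>

text \<open>
  Composing with the transposition of \<open>i\<close> and \<open>q i\<close> makes \<open>q i\<close> a fixed point and creates no new moved
  point.
\<close>

lemma sort_step:
  assumes q: "q permutes {1..n}" and i: "q i \<noteq> i"
  defines "q' \<equiv> q \<circ> Transposition.transpose i (q i)"
  shows "q' permutes {1..n}" "evenperm q' \<longleftrightarrow> \<not> evenperm q" "q' = q(i := q (q i), q i := q i)"
    "card {j. q' j \<noteq> j} < card {j. q j \<noteq> j}"
proof -
  have mem: "i \<in> {1..n}" "q i \<in> {1..n}"
    using i permutes_not_in[OF q, of i] permutes_in_image[OF q, of i] by auto
  have inj: "q x = q y \<longleftrightarrow> x = y" for x y using permutes_inj[OF q] by (auto simp: inj_def)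
  show "q' permutes {1..n}"
    unfolding q'_def using mem by (intro permutes_compose[OF _ q] permutes_swap_id)
  have perm: "permutation q" using q permutation_permutes by blast
  show "evenperm q' \<longleftrightarrow> \<not> evenperm q"
    unfolding q'_def evenperm_comp[OF perm permutation_swap_id] evenperm_swap using i by auto
  show q': "q' = q(i := q (q i), q i := q i)"
    unfolding q'_def by (rule ext) (simp add: Transposition.transpose_def)
  have "{j. q j \<noteq> j} \<subseteq> {1..n}" using permutes_not_in[OF q] by blast
  then have "finite {j. q j \<noteq> j}" by (rule finite_subset) simp
  moreover have "{j. q' j \<noteq> j} \<subseteq> {j. q j \<noteq> j} - {q i}" using i by (auto simp: q')
  moreover have "q i \<in> {j. q j \<noteq> j}" using i by (simp add: inj)
  ultimately show "card {j. q' j \<noteq> j} < card {j. q j \<noteq> j}"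
    by (metis card_Diff1_less card_mono finite_Diff le_less_trans)
qed

text \<open>
  The array holds a permutation \<open>q\<close> that differs from \<open>p\<close> by transpositions, counted modulo 2 in \<open>Par\<close>,
  and is sorted below \<open>i\<close>. Here \<open>d\<close> is the time spent on transpositions: each of them settles a point
  and pays 40 units.
\<close>

definition parity_inv :: "(nat \<Rightarrow> nat) \<Rightarrow> nat \<Rightarrow> state \<Rightarrow> nat \<Rightarrow> (nat \<Rightarrow> nat) \<Rightarrow> bool" where
  "parity_inv p i \<tau> d q \<longleftrightarrow> q permutes {1..n} \<and> (\<forall>j\<le>n. mem \<tau> Mark j = q j) \<and> (\<forall>j<i. q j = j) \<and>
    (regs \<tau> Par = (if evenperm q = evenperm p then 0 else 1)) \<and> d + 40 * card {j. q j \<noteq> j} \<le> 40 * n"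

lemma wp_sort_cycle:
  assumes i: "i \<le> n" and "regs \<sigma> Pos = i" and "parity_inv p i \<sigma> d q"
  shows "wp W M (WHILE \<^bold>\<not> (Cell Mark (Reg Pos) \<^bold>= Reg Pos) DO (
           Pt ::= Cell Mark (Reg Pos);;
           Mark\<lbrakk>Reg Pos\<rbrakk> ::= Cell Mark (Reg Pt);;
           Mark\<lbrakk>Reg Pt\<rbrakk> ::= Reg Pt;;
           Par ::= Lit 1 \<^bold>- Reg Par))
     (\<lambda>\<tau> t'. \<exists>q' d'. parity_inv p (Suc i) \<tau> d' q' \<and> t' + d \<le> t + d' + 10) \<sigma> t"
proof -
  have fitsi: "i < M" "i < W" using i le_fits by auto
  define unsettled where "unsettled \<tau> = card {j. (if j \<in> {1..n} then mem \<tau> Mark j else j) \<noteq> j}"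
    for \<tau> :: state
  show ?thesis
    apply (rule wp_while[where I = "\<lambda>\<tau> t'. \<exists>q' d'. parity_inv p i \<tau> d' q' \<and> t' + d \<le> t + d'"
          and f = unsettled])
    subgoal using assms by auto
    subgoal premises prems for \<tau> t'
    proof -
      obtain q' d' where q': "parity_inv p i \<tau> d' q'" and t': "t' + d \<le> t + d'" using prems(1) by blast
      then have q: "q' permutes {1..n}" and mark: "\<And>j. j \<le> n \<Longrightarrow> mem \<tau> Mark j = q' j"
        and below: "\<And>j. j < i \<Longrightarrow> q' j = j"
          and par: "regs \<tau> Par = (if evenperm q' = evenperm p then 0 else 1)"
        and d': "d' + 40 * card {j. q' j \<noteq> j} \<le> 40 * n"
        by (auto simp: parity_inv_def)
      note le = permutes_le[OF q]
      have pos: "regs \<tau> Pos = i" using prems(2) assms(2) by (auto simp: frame_def)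
      have qi: "q' i \<le> n" "q' i < W" "q' i < M" "q' (q' i) \<le> n" "q' (q' i) < W"
        using le[OF i] le[OF le[OF i]] le_fits by auto
      have inj: "q' x = q' y \<longleftrightarrow> x = y" for x y using permutes_inj[OF q] by (auto simp: inj_def)
      have total: "(\<lambda>j. if j \<in> {1..n} then A j else j) = q''"
        if "q'' permutes {1..n}" "\<And>j. j \<le> n \<Longrightarrow> A j = q'' j" for A q''
        using permutes_not_in[OF that(1)] that(2) by (intro ext) auto
      show ?thesis
      proof (cases "q' i = i")
        case True
        then have "parity_inv p (Suc i) \<tau> d' q'" using q' by (auto simp: parity_inv_def less_Suc_eq)
        then have "\<exists>q' d'. parity_inv p (Suc i) \<tau> d' q' \<and> t' + 7 + d \<le> t + d' + 10"
          using t' by (intro exI[of _ q'] exI[of _ d']) simp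
        then show ?thesis using True fitsi i by (simp add: pos mark)
      next
        case False
        note st = sort_step[OF q False]
        define q2 where "q2 = q' \<circ> Transposition.transpose i (q' i)"
        have q2: "q2 = q'(i := q' (q' i), q' i := q' i)" using st(3) by (simp add: q2_def)
        \<comment> \<open>points below \<open>i\<close> are fixed, so the transposition does not disturb them\<close>
        have i_le: "i \<le> q' i"
        proof (rule ccontr)
          assume "\<not> i \<le> q' i"
          then have "q' (q' i) = q' i" using below by simp
          then show False using False by (simp add: inj)
        qed
        have "safe W M (\<^bold>\<not> (Cell Mark (Reg Pos) \<^bold>= Reg Pos)) \<tau>"
          using fitsi qi i by (auto simp: pos mark)
        moreover have "wp W M (
           Pt ::= Cell Mark (Reg Pos);;
           Mark\<lbrakk>Reg Pos\<rbrakk> ::= Cell Mark (Reg Pt);;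
           Mark\<lbrakk>Reg Pt\<rbrakk> ::= Reg Pt;;
           Par ::= Lit 1 \<^bold>- Reg Par)
           (\<lambda>\<tau>' t''. (\<exists>q' d'. parity_inv p i \<tau>' d' q' \<and> t'' + d \<le> t + d') \<and>
             unsettled \<tau>' < unsettled \<tau>) \<tau> (t' + 7)"
        proof -
          define \<tau>' where "\<tau>' = \<tau>\<lparr>regs := (regs \<tau>)(Pt := q' i, Par := 1 - regs \<tau> Par),
              mem := (mem \<tau>)(Mark := (mem \<tau> Mark)(i := q' (q' i), q' i := q' i))\<rparr>"
          have marks: "mem \<tau>' Mark j = q2 j" if "j \<le> n" for j
            using that by (auto simp: \<tau>'_def q2 mark)
          have inv: "parity_inv p i \<tau>' (d' + 40) q2"
            unfolding parity_inv_def
          proof (intro conjI)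
            show "q2 permutes {1..n}" using st(1) by (simp add: q2_def)
            show "regs \<tau>' Par = (if evenperm q2 = evenperm p then 0 else 1)"
              using st(2) par by (auto simp: \<tau>'_def q2_def)
            show "d' + 40 + 40 * card {j. q2 j \<noteq> j} \<le> 40 * n" using st(4) d' by (simp add: q2_def)
            show "\<forall>j<i. q2 j = j" using below i_le by (auto simp: q2)
          qed (use marks in auto)
          have smaller: "unsettled \<tau>' < unsettled \<tau>"
            unfolding unsettled_def
            using total[OF st(1), of "mem \<tau>' Mark"] total[OF q, of "mem \<tau> Mark"] marks mark st(4)
            by (simp add: q2_def fun_eq_iff)
          have continue: "\<exists>q' d'. parity_inv p i \<tau>' d' q' \<and> t'' + d \<le> t + d'" if "t'' \<le> t' + 40" for t''
            using inv t' that by (intro exI[of _ q2] exI[of _ "d' + 40"]) simp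
          have "wp W M (
             Pt ::= Cell Mark (Reg Pos);;
             Mark\<lbrakk>Reg Pos\<rbrakk> ::= Cell Mark (Reg Pt);;
             Mark\<lbrakk>Reg Pt\<rbrakk> ::= Reg Pt;;
             Par ::= Lit 1 \<^bold>- Reg Par) (\<lambda>\<rho> t''. \<rho> = \<tau>' \<and> t'' \<le> t' + 40) \<tau> (t' + 7)"
            apply (intro wp_seq wp_assign wp_store)
            using qi fitsi by (simp_all add: pos mark i par \<tau>'_def)
          then show ?thesis by (rule wp_conseq) (use smaller continue in simp)
        qed
        ultimately show ?thesis using False i by (simp add: pos mark numeral_eq_Suc)
      qed
    qed
    done
qed


text \<open>
  Sorting ends with the identity, so \<open>Par\<close> tells the parity of the generator.
\<close>

lemma wp_compute_target_length:
  assumes "inputs \<sigma>" "gen_rows (2 * k) (mem \<sigma> Gen)"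
  shows "wp W M compute_target_length (\<lambda>\<sigma>' t'. regs \<sigma>' Cyc = target_length s \<and>
    t' \<le> t + 200 * (k * Suc n)) \<sigma> t"
proof -
  have reg: "regs \<sigma> Deg = n" "regs \<sigma> NGen = k" using assms(1) by (auto simp: inputs_def)
  have gen: "mem \<sigma> Gen (a * Suc n + i) = (s ! a) i" if "a < k" "i \<le> n" for a i
    using assms(2) that by (auto simp: gen_rows_def signed_gens_def nth_append length_s)
  have len3: "Suc (Suc (Suc 0)) < W" using small_values(10) by (simp add: numeral_3_eq_3)
  show ?thesis
    unfolding compute_target_length_def
    apply (rule wp_seq, rule wp_assign)
    subgoal by simp
    apply (rule wp_for[where H = k and I = "\<lambda>a \<tau> t'.
        regs \<tau> Cyc = (if \<forall>b<a. evenperm (s ! b) then 3 else 2) \<and> t' \<le> t + 10 + a * (120 * Suc n)"])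
    apply (simp_all)[5]
    subgoal by (simp add: frame_def reg)
    subgoal premises prems for a \<tau> t'
    proof -
      have a: "a < k" "a < 2 * k" using prems by auto
      have "a < W" using a(1) small_values(5) by (rule less_trans)
      define p where "p = s ! a"
      have p: "p permutes {1..n}" using perms a length_s by (simp add: p_def)
      have p_le: "p j \<le> n" "p j < W" "p j < M" if "j \<le> n" for j
        using permutes_le[OF p that] le_fits by auto
      have reg1: "regs \<tau> Deg = n" "regs \<tau> NGen = k" "regs \<tau> Ltr = a" "mem \<tau> Gen = mem \<sigma> Gen"
        using prems by (auto simp: frame_def reg)
      have id: "q = id" if "q permutes {1..n}" "\<forall>j<Suc n. q j = j" for q
      proof
        show "q j = id j" for j using that permutes_not_in[OF that(1), of j] by (cases "j \<le> n") auto
      qed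
      have moved: "card {j. p j \<noteq> j} \<le> n"
      proof -
        have "{j. p j \<noteq> j} \<subseteq> {1..n}" using permutes_not_in[OF p] by blast
        from card_mono[OF _ this] show ?thesis by simp
      qed
      show ?thesis
        apply (rule wp_seq, rule wp_assign)
        subgoal by simp
        apply (rule wp_seq)
        apply (rule wp_for[where H = "Suc n" and I = "\<lambda>i \<tau>' t''.
            (\<forall>j<i. mem \<tau>' Mark j = p j) \<and> t'' \<le> t' + 20 + 25 * i"])
        apply (simp_all)[5]
        subgoal by (simp add: frame_def reg1)
        subgoal premises prems2 for i \<tau>' t''
        proof -
          have i: "i \<le> n" using prems2 by simp
          have reg2: "regs \<tau>' Deg = n" "regs \<tau>' Ltr = a" "mem \<tau>' Gen = mem \<sigma> Gen" "regs \<tau>' Pos = i"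
            using prems2 by (auto simp: frame_def reg1)
          show ?thesis
            apply (rule wp_store)
            using le_fits[OF i] index_parts_fit[OF a(2) i] gen_index_fits[OF a(2) i] p_le[OF i]
              prems2(3) a i
            by (auto simp: reg2 gen p_def[symmetric] less_Suc_eq)
        qed
        subgoal premises prems2 for \<tau>' t''
        proof -
          have reg2: "regs \<tau>' Deg = n" "regs \<tau>' Par = 0"
            using prems2 by (auto simp: frame_def reg1)
          have start: "parity_inv p 0 \<tau>' 0 p"
            using prems2(1) p moved reg2 by (auto simp: parity_inv_def)
          show ?thesis
            apply (rule wp_seq)
            apply (rule wp_for[where H = "Suc n" and I = "\<lambda>i \<rho> t3.
                \<exists>q d. parity_inv p i \<rho> d q \<and> t3 \<le> t'' + 10 + d + 25 * i"])
            subgoal by simp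
            subgoal using start prems2(1)
              by (intro exI[of _ p] exI[of _ 0]) (simp add: parity_inv_def)
            apply (simp_all)[3]
            subgoal by (simp add: frame_def reg2)
            subgoal premises prems3 for i \<rho> t3
            proof -
              obtain q d where qd: "parity_inv p i \<rho> d q" "t3 \<le> t'' + 10 + d + 25 * i" using prems3(3)
                by blast
              have i: "i \<le> n" using prems3 by simp
              show ?thesis
                apply (rule wp_conseq[OF wp_sort_cycle[OF i prems3(4) qd(1)]])
                subgoal premises prems4 for \<rho>' t4
                proof -
                  obtain q' d' where "parity_inv p (Suc i) \<rho>' d' q'" "t4 + d \<le> t3 + d' + 16"
                    using prems4(1) by auto
                  moreover have "regs \<rho>' Pos = i" using prems4(2) prems3(4) by (simp add: frame_def)
                  ultimately show ?thesis using qd(2)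
                    by (intro conjI exI[of _ q'] exI[of _ d']) (auto simp: parity_inv_def)
                qed
                done
            qed
            subgoal premises prems3 for \<rho> t3
            proof -
              obtain q d where qd: "parity_inv p (Suc n) \<rho> d q" "t3 \<le> t'' + 10 + d + 25 * Suc n"
                using prems3(1) by blast
              then have "q = id" by (intro id) (auto simp: parity_inv_def)
              then have par: "regs \<rho> Par = (if evenperm p then 0 else 1)" "d \<le> 40 * n"
                using qd(1) by (auto simp: parity_inv_def)
              have reg3: "regs \<rho> Ltr = a" "regs \<rho> Cyc = regs \<tau> Cyc"
                using prems3(3) prems2(3) reg1 by (auto simp: frame_def)
              show ?thesis
                apply (rule wp_if)
                subgoal using par by auto
                subgoal
                  apply (rule wp_assign)
                  using par prems(3) prems2(1) qd(2) n_ge_2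
                    by (auto simp: reg3 p_def less_Suc_eq split: if_splits)
                subgoal
                  apply (rule wp_skip)
                  using par prems(3) prems2(1) qd(2) n_ge_2
                    by (auto simp: reg3 p_def less_Suc_eq split: if_splits)
                done
            qed
            done
        qed
        done
    qed
    subgoal premises prems for \<tau> t'
    proof -
      have "target_length s = (if \<forall>b<k. evenperm (s ! b) then 3 else 2)"
        by (simp add: target_length_def all_set_conv_all_nth length_s)
      moreover have "1 \<le> k * n" using k_ge_2 n_ge_2 by simp
      ultimately show ?thesis using prems k_ge_2 reg by (auto simp: algebra_simps mult_Suc_right)
    qed
    done
qed

section \<open>Finding a power that is a cycle\<close>

definition marked :: "(nat \<Rightarrow> nat) \<Rightarrow> nat set" where
  "marked A = {j \<in> {1..n}. A j \<noteq> 0}"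

lemma marked_subset: "marked A \<subseteq> {1..n}" "finite (marked A)" "card (marked A) \<le> n"
proof -
  show "marked A \<subseteq> {1..n}" by (auto simp: marked_def)
  then show "finite (marked A)" "card (marked A) \<le> n"
    using finite_subset card_mono[of "{1..n}" "marked A"] by auto
qed

lemma support_subset:
  assumes "p permutes {1..n}" "i \<in> {1..n}"
  shows "set (support p i) \<subseteq> {1..n}"
  using permutes_in_image[OF permutes_funpow[OF assms(1)]] assms(2) by auto

lemma permutes_permutation: "p permutes {1..n} \<Longrightarrow> permutation p"
  using permutation_permutes by blast

lemma least_power_le_n:
  assumes "p permutes {1..n}" "i \<in> {1..n}"
  shows "least_power p i \<le> n"
  using card_mono[OF _ support_subset[OF assms]] card_support[OF permutes_permutation[OF assms(1)], of i]
    by simp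

text \<open>
  An orbit of finite order that enters a set closed under \<open>p\<close> also returns to its start there.
\<close>

lemma orbit_disjoint:
  assumes p: "p permutes {1..n}" and closed: "\<forall>j\<in>X. p j \<in> X" and "i \<notin> X"
  shows "(p ^^ d) i \<notin> X"
proof
  note perm = permutes_permutation[OF p]
  assume d: "(p ^^ d) i \<in> X"
  have "(p ^^ e) j \<in> X" if "j \<in> X" for e j
    using that closed by (induction e) auto
  then have iter: "(p ^^ (e + d)) i \<in> X" for e using d by (simp add: funpow_add)
  have "least_power p i * d - d + d = least_power p i * d"
    using least_power_of_permutation(2)[OF perm, of i] by (cases "least_power p i") auto
  with iter[of "least_power p i * d - d"] have "(p ^^ (least_power p i * d)) i \<in> X" by (simp only:)
  moreover have "(p ^^ (least_power p i * d)) i = i"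
    using least_power_dvd[OF perm, of i "least_power p i * d"] by simp
  ultimately show False using assms(3) by simp
qed

text \<open>
  If \<open>i\<close> is not yet marked, then its whole cycle is unmarked, because the marked set is closed under \<open>p\<close>.
  The trace therefore ends exactly when it returns to \<open>i\<close>.
\<close>

lemma wp_trace_cycle:
  assumes row: "prod_row \<sigma> p" and p: "p permutes {1..n}" and i: "i \<in> {1..n}"
    and start: "regs \<sigma> Pt = i" "regs \<sigma> Len = 0" "\<forall>j\<le>n. mem \<sigma> Mark j \<le> 1"
    and closed: "\<forall>j\<in>marked (mem \<sigma> Mark). p j \<in> marked (mem \<sigma> Mark)"
  shows "wp W M (WHILE \<^bold>\<not> Cell Mark (Reg Pt) DO (
         Mark\<lbrakk>Reg Pt\<rbrakk> ::= Lit 1;;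
         Pt ::= Cell Prod (Reg Base \<^bold>+ Reg Pt);;
         Len ::= Reg Len \<^bold>+ Lit 1))
     (\<lambda>\<tau> t'. (\<forall>j\<le>n. mem \<tau> Mark j \<le> 1) \<and>
        marked (mem \<tau> Mark) = marked (mem \<sigma> Mark) \<union> set (support p i) \<and>
        regs \<tau> Len = (if i \<in> marked (mem \<sigma> Mark) then 0 else least_power p i) \<and>
        t' \<le> t + 30 * regs \<tau> Len + 10) \<sigma> t"
proof -
  define X where "X = marked (mem \<sigma> Mark)"
  note perm = permutes_permutation[OF p]
  have lp: "0 < least_power p i" "least_power p i \<le> n"
    using least_power_of_permutation(2)[OF perm] least_power_le_n[OF p i] by auto
  define I where "I \<tau> t' \<longleftrightarrow> regs \<tau> Pt = (p ^^ regs \<tau> Len) i \<and> (\<forall>j\<le>n. mem \<tau> Mark j \<le> 1) \<and>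
    marked (mem \<tau> Mark) = X \<union> (\<lambda>d. (p ^^ d) i) ` {..<regs \<tau> Len} \<and>
    (i \<in> X \<longrightarrow> regs \<tau> Len = 0) \<and> regs \<tau> Len \<le> least_power p i \<and> t' \<le> t + 30 * regs \<tau> Len"
    for \<tau> :: state and t'
  have in_range: "(p ^^ d) i \<in> {1..n}" "(p ^^ d) i \<le> n" for d
    using permutes_in_image[OF permutes_funpow[OF p]] i by auto
  show ?thesis
  proof (rule wp_while[where I = I and f = "\<lambda>\<tau>. Suc n - regs \<tau> Len"])
    show "I \<sigma> t" using start lp by (simp add: I_def X_def)
    fix \<tau> t' assume inv: "I \<tau> t'" and fr: "frame (Mark\<lbrakk>Reg Pt\<rbrakk> ::= Lit 1;;
         Pt ::= Cell Prod (Reg Base \<^bold>+ Reg Pt);; Len ::= Reg Len \<^bold>+ Lit 1) \<sigma> \<tau>"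
    define L x where "L = regs \<tau> Len" and "x = (p ^^ L) i"
    have L: "regs \<tau> Len = L" "regs \<tau> Pt = x" "\<forall>j\<le>n. mem \<tau> Mark j \<le> 1"
      "marked (mem \<tau> Mark) = X \<union> (\<lambda>d. (p ^^ d) i) ` {..<L}"
      "i \<in> X \<longrightarrow> L = 0" "L \<le> least_power p i" "t' \<le> t + 30 * L"
      using inv by (auto simp: I_def L_def x_def)
    have x: "x \<in> {1..n}" "x \<le> n" "x < M" "x < W" "p x \<le> n" "p x < W"
      using in_range[of L] permutes_le[OF p, of x] le_fits unfolding x_def by auto
    define B where "B = regs \<sigma> Base"
    have B: "regs \<tau> Base = B" "B + x < M" "B + x < W" "B < W" "mem \<tau> Prod (B + x) = p x"
    proof -
      show "regs \<tau> Base = B" using fr by (simp add: frame_def B_def)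
      have Bn: "B + n < M" "mem \<sigma> Prod (B + x) = p x" using row x(2)
        by (simp_all add: prod_row_def B_def)
      then show "B + x < M" "B + x < W" "B < W" using x(2) fits by linarith+
      show "mem \<tau> Prod (B + x) = p x" using fr Bn(2) by (simp add: frame_def)
    qed
    have mark: "mem \<tau> Mark x = 0 \<longleftrightarrow> x \<notin> marked (mem \<tau> Mark)" using x by (simp add: marked_def)
    have mark_le: "mem \<tau> Mark x < W"     proof -
      have "mem \<tau> Mark x \<le> 1" using L(3) x(2) by blast
      then show ?thesis using small_values(8) by linarith
    qed
    let ?body = "Mark\<lbrakk>Reg Pt\<rbrakk> ::= Lit 1;; Pt ::= Cell Prod (Reg Base \<^bold>+ Reg Pt);;
      Len ::= Reg Len \<^bold>+ Lit 1"
    have exit: "(\<forall>j\<le>n. mem \<tau> Mark j \<le> 1) \<and>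
        marked (mem \<tau> Mark) = X \<union> set (support p i) \<and>
        regs \<tau> Len = (if i \<in> X then 0 else least_power p i) \<and> t' + 6 \<le> t + 30 * regs \<tau> Len + 10"
      if marked_x: "x \<in> marked (mem \<tau> Mark)"
    proof (cases "i \<in> X")
      case True
      then have "set (support p i) \<subseteq> X"
      proof -
        have "(p ^^ d) i \<in> X" for d using True closed by (induction d) (auto simp: X_def)
        then show ?thesis by auto
      qed
      then show ?thesis using True L by auto
    next
      case False
      then have "x \<notin> X" unfolding x_def using orbit_disjoint[OF p _ False] closed by (simp add: X_def)
      then obtain d where d: "d < L" "(p ^^ d) i = (p ^^ L) i" using marked_x L(4) by (auto simp: x_def)
      \<comment> \<open>a repetition of the orbit at distance \<open>L - d\<close>\<close>
      have "(p ^^ (L - d)) i = i"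
        using d permutes_inj[OF p] by (intro funpow_diff) auto
      then have "least_power p i \<le> L - d" using d by (intro least_power_le) auto
      then have "L = least_power p i" using L(6) by simp
      then show ?thesis using L False by (simp add: lessThan_atLeast0)
    qed
    have step: "wp W M ?body (\<lambda>\<tau>' t''. I \<tau>' t'' \<and> Suc n - regs \<tau>' Len < Suc n - regs \<tau> Len) \<tau> (t' + 5)"
      if "x \<notin> marked (mem \<tau> Mark)"
    proof -
      define \<tau>' where "\<tau>' = \<tau>\<lparr>regs := (regs \<tau>)(Pt := p x, Len := Suc L), mem := (mem \<tau>)(Mark := (mem \<tau>
        Mark)(x := 1))\<rparr>"
      have L_less: "L < least_power p i"
      proof (rule ccontr)
        assume "\<not> L < least_power p i"
        then have "L = least_power p i" using L(6) by simp
        then have "x = (p ^^ 0) i" "0 < L" using least_power_of_permutation(1)[OF perm, of i] lp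
          by (auto simp: x_def)
        then have "x \<in> marked (mem \<tau> Mark)" unfolding L(4) by blast
        then show False using that by simp
      qed
      have "i \<notin> X" using that L(4,5) by (auto simp: x_def)
      have "marked (mem \<tau>' Mark) = insert x (marked (mem \<tau> Mark))"
        using x(1) by (auto simp: marked_def \<tau>'_def)
      also have "\<dots> = X \<union> (\<lambda>d. (p ^^ d) i) ` {..<Suc L}" unfolding L(4) lessThan_Suc by (simp add: x_def)
      finally have "I \<tau>' t''" if "t'' \<le> t' + 30" for t''
        using L \<open>i \<notin> X\<close> L_less that by (auto simp: I_def \<tau>'_def x_def)
      moreover have "Suc n - regs \<tau>' Len < Suc n - regs \<tau> Len" using L_less lp(2) by (simp add: \<tau>'_def L)
      ultimately have post: "I \<tau>' t'' \<and> Suc n - regs \<tau>' Len < Suc n - regs \<tau> Len" if "t'' \<le> t' + 30"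
        for t''
        using that by simp
      have "L < n" using L_less lp(2) by simp
      then have "L < W" "Suc L < W" using le_fits by auto
      then have "wp W M ?body (\<lambda>\<rho> t''. \<rho> = \<tau>' \<and> t'' \<le> t' + 30) \<tau> (t' + 5)"
        apply (intro wp_seq wp_assign wp_store)
        using x B by (simp_all add: \<tau>'_def L)
      then show ?thesis by (rule wp_conseq) (use post in simp)
    qed
    show "safe W M (\<^bold>\<not> Cell Mark (Reg Pt)) \<tau> \<and>
      (if val (\<^bold>\<not> Cell Mark (Reg Pt)) \<tau> = 0 then
         ((\<forall>j\<le>n. mem \<tau> Mark j \<le> 1) \<and>
        marked (mem \<tau> Mark) = marked (mem \<sigma> Mark) \<union> set (support p i) \<and>
        regs \<tau> Len = (if i \<in> marked (mem \<sigma> Mark) then 0 else least_power p i) \<and>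
        t' + (cost (\<^bold>\<not> Cell Mark (Reg Pt)) + 1) \<le> t + 30 * regs \<tau> Len + 10)
       else wp W M ?body (\<lambda>\<tau>' t''. I \<tau>' t'' \<and> Suc n - regs \<tau>' Len < Suc n - regs \<tau> Len) \<tau>
         (t' + (cost (\<^bold>\<not> Cell Mark (Reg Pt)) + 1)))"
    proof (cases "x \<in> marked (mem \<tau> Mark)")
      case True
      then show ?thesis using exit[OF True] x mark_le mark by (simp add: L(2) X_def)
    next
      case False
      then show ?thesis using step[OF False] x mark_le mark by (simp add: L(2) numeral_eq_Suc)
    qed
  qed
qed

text \<open>
  The second argument decreases in each round, which bounds the number of rounds by its initial value.
\<close>

lemma wp_gcd:
  assumes "regs \<sigma> GcdA = a" "regs \<sigma> GcdB = b" "0 < a" "a < W" "b < W"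
  shows "wp W M (WHILE Lit 0 \<^bold>< Reg GcdB DO (
           Tmp ::= Reg GcdA MOD Reg GcdB;;
           GcdA ::= Reg GcdB;;
           GcdB ::= Reg Tmp))
     (\<lambda>\<tau> t'. regs \<tau> GcdA = gcd a b \<and> t' \<le> t + 20 * b + 10) \<sigma> t"
  apply (rule wp_while[where f = "\<lambda>\<tau>. regs \<tau> GcdB" and I = "\<lambda>\<tau> t'. regs \<tau> GcdA < W \<and> regs \<tau> GcdB < W \<and>
      gcd (regs \<tau> GcdA) (regs \<tau> GcdB) = gcd a b \<and> t' + 20 * regs \<tau> GcdB \<le> t + 20 * b"])
  subgoal using assms by simp
  subgoal premises prems for \<tau> t'
  proof -
    have "wp W M (Tmp ::= Reg GcdA MOD Reg GcdB;; GcdA ::= Reg GcdB;; GcdB ::= Reg Tmp)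
      (\<lambda>\<tau>' t''. (regs \<tau>' GcdA < W \<and> regs \<tau>' GcdB < W \<and>
      gcd (regs \<tau>' GcdA) (regs \<tau>' GcdB) = gcd a b \<and> t'' + 20 * regs \<tau>' GcdB \<le> t + 20 * b) \<and>
      regs \<tau>' GcdB < regs \<tau> GcdB) \<tau> (Suc (Suc (Suc (Suc t'))))" if "0 < regs \<tau> GcdB"
    proof -
      have "regs \<tau> GcdA mod regs \<tau> GcdB < regs \<tau> GcdB" using that by simp
      moreover from this have "regs \<tau> GcdA mod regs \<tau> GcdB < W" using prems by linarith
      moreover have "gcd (regs \<tau> GcdB) (regs \<tau> GcdA mod regs \<tau> GcdB) = gcd a b"
        using prems by (simp add: gcd_red_nat[symmetric])
      ultimately show ?thesis
        apply (intro wp_seq wp_assign)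
        using prems by (auto simp: numeral_eq_Suc)
    qed
    then show ?thesis using prems by auto
  qed
  done

text \<open>
  The bookkeeping of the cycle search, where \<open>X\<close> is the set of marked points. Multiplying the count \<open>cnt\<close> of
  cycles of length \<open>c\<close> by \<open>c\<close> avoids talking about a set of cycles. The number \<open>l\<close> divides every
  common multiple of the other cycle lengths in \<open>X\<close>, and is a common multiple itself as long as it is at
  most \<open>n\<close>. Once \<open>l\<close> exceeds \<open>n\<close> it is no longer updated, but the least common multiple is then too large
  anyway.
\<close>

definition cycle_data :: "(nat \<Rightarrow> nat) \<Rightarrow> nat \<Rightarrow> nat set \<Rightarrow> nat \<Rightarrow> nat \<Rightarrow> bool" where
  "cycle_data p c X cnt l \<longleftrightarrow> (\<forall>j\<in>X. p j \<in> X) \<and> cnt * c = card {j \<in> X. least_power p j = c} \<and>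
    0 < l \<and> l < Suc n * Suc n \<and>
    (l \<le> n \<longrightarrow> (\<forall>j\<in>X. least_power p j \<noteq> c \<longrightarrow> least_power p j dvd l)) \<and>
    (\<forall>d. (\<forall>j\<in>X. least_power p j \<noteq> c \<longrightarrow> least_power p j dvd d) \<longrightarrow> l dvd d)"

lemma cycle_data_empty: "cycle_data p c {} 0 1"
  using n_ge_2 by (simp add: cycle_data_def)

lemma cycle_data_count_le:
  assumes "cycle_data p c X cnt l" "X \<subseteq> {1..n}" "0 < c"
  shows "cnt \<le> n"
proof -
  have "cnt * 1 \<le> cnt * c" using assms(3) by (intro mult_le_mono2) simp
  also have "\<dots> \<le> card {1..n}"
  proof -
    have "cnt * c = card {j \<in> X. least_power p j = c}" using assms(1) by (simp add: cycle_data_def)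
    moreover have "{j \<in> X. least_power p j = c} \<subseteq> {1..n}" using assms(2) by blast
    ultimately show ?thesis by (simp only: card_mono finite_atLeastAtMost)
  qed
  finally show ?thesis by simp
qed

lemma cycle_data_add_cycle:
  assumes data: "cycle_data p c X cnt l" and X: "X \<subseteq> {1..n}" and p: "p permutes {1..n}"
    and i: "i \<in> {1..n}" "i \<notin> X"
  defines "Y \<equiv> X \<union> set (support p i)"
  shows "card Y = card X + least_power p i"
    and "least_power p i = c \<Longrightarrow> cycle_data p c Y (Suc cnt) l"
    and "least_power p i \<noteq> c \<Longrightarrow> l \<le> n \<Longrightarrow> cycle_data p c Y cnt (lcm l (least_power p i))"
    and "least_power p i \<noteq> c \<Longrightarrow> \<not> l \<le> n \<Longrightarrow> cycle_data p c Y cnt l"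
proof -
  note perm = permutes_permutation[OF p]
  define S where "S = set (support p i)"
  have closed: "\<forall>j\<in>X. p j \<in> X" using data by (simp add: cycle_data_def)
  have disj: "X \<inter> S = {}" using orbit_disjoint[OF p closed i(2)] by (auto simp: S_def)
  have fin: "finite X" "finite S" using X finite_subset by (auto simp: S_def)
  have lp: "least_power p j = least_power p i" if "j \<in> S" for j
    using that least_power_support[OF perm, of j i] by (simp only: S_def)
  have "i \<in> S" unfolding S_def support_set[OF perm] by (metis funpow_0 rangeI)
  have Y: "Y = X \<union> S" by (simp only: Y_def S_def)
  have cS: "card S = least_power p i" unfolding S_def by (rule card_support[OF perm])
  show "card Y = card X + least_power p i"
    unfolding Y using card_Un_disjoint[OF fin disj] cS by simp
  have "p j \<in> S" if j: "j \<in> S" for j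
  proof -
    obtain d where "j = (p ^^ d) i" using j unfolding S_def support_set[OF perm] by blast
    then have "p j = (p ^^ Suc d) i" by simp
    then show ?thesis unfolding S_def support_set[OF perm] by blast
  qed
  then have closedY: "\<forall>j\<in>Y. p j \<in> Y" using closed by (auto simp: Y)
  have countY: "card {j \<in> Y. least_power p j = c} =
      card {j \<in> X. least_power p j = c} + (if least_power p i = c then c else 0)"
  proof -
    have "{j \<in> Y. least_power p j = c} = {j \<in> X. least_power p j = c} \<union> (if least_power p i
      = c then S else {})"
      using lp by (auto simp: Y)
    moreover have "card ({j \<in> X. least_power p j = c} \<union> S) = card {j \<in> X. least_power p j = c} + card S"
      using fin disj by (intro card_Un_disjoint) auto
    ultimately show ?thesis using cS by simp
  qed
  have lens: "(\<forall>j\<in>Y. least_power p j \<noteq> c \<longrightarrow> least_power p j dvd d) \<longleftrightarrow>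
      (\<forall>j\<in>X. least_power p j \<noteq> c \<longrightarrow> least_power p j dvd d) \<and> (least_power p i \<noteq> c
        \<longrightarrow> least_power p i dvd d)" for d
    unfolding Y ball_Un using lp \<open>i \<in> S\<close> by metis
  show "least_power p i = c \<Longrightarrow> cycle_data p c Y (Suc cnt) l"
    using data unfolding cycle_data_def lens countY by (auto simp: closedY)
  show "least_power p i \<noteq> c \<Longrightarrow> \<not> l \<le> n \<Longrightarrow> cycle_data p c Y cnt l"
    using data unfolding cycle_data_def lens countY by (auto simp: closedY)
  show "cycle_data p c Y cnt (lcm l (least_power p i))" if "least_power p i \<noteq> c" "l \<le> n"
  proof -
    have pos: "0 < least_power p i" "least_power p i \<le> n"
      using least_power_of_permutation(2)[OF perm] least_power_le_n[OF p i(1)] by auto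
    have "lcm l (least_power p i) \<le> l * least_power p i"
      using data pos by (intro dvd_imp_le) (auto simp: cycle_data_def)
    also have "\<dots> \<le> n * n" using that pos by (intro mult_le_mono)
    also have "\<dots> < Suc n * Suc n" by (simp add: mult_Suc_right)
    finally have "lcm l (least_power p i) < Suc n * Suc n" .
    moreover have "0 < lcm l (least_power p i)" using data pos by (simp add: cycle_data_def lcm_pos_nat)
    ultimately show ?thesis
      using data that unfolding cycle_data_def lens countY by (auto simp: closedY)
  qed
qed

text \<open>
  The specification of the exponent \<open>m\<close>, with 0 in the role of failure.
\<close>

definition power_found :: "nat \<Rightarrow> (nat \<Rightarrow> nat) \<Rightarrow> nat \<Rightarrow> bool" where
  "power_found c p m \<longleftrightarrow> (if m = 0 then \<forall>j\<in>{1..n}. \<not> is_cycle c (p ^^ j) else m \<in> {1..n}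
    \<and> is_cycle c (p ^^ m))"

text \<open>
  If any exponent \<open>m\<close> works, then \<open>l\<close> divides \<open>m\<close> and hence satisfies the same conditions.
\<close>

lemma cycle_data_power_found:
  assumes "cycle_data p c {1..n} cnt l" "p permutes {1..n}" "prime c"
  shows "power_found c p (if cnt = 1 \<and> l \<le> n \<and> 0 < l mod c then l else 0)"
proof (cases "cnt = 1 \<and> l \<le> n \<and> 0 < l mod c")
  case True
  then have "\<not> c dvd l" by (simp add: mod_greater_zero_iff_not_dvd)
  then have "is_cycle c (p ^^ l)"
    using True assms(1) unfolding power_is_cycle_iff[OF assms(2) finite_atLeastAtMost assms(3)]
      cycle_data_def by auto
  then show ?thesis using True assms(1) by (auto simp: power_found_def cycle_data_def)
next
  case False
  have "\<not> is_cycle c (p ^^ m)" if "m \<in> {1..n}" for m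
  proof
    assume "is_cycle c (p ^^ m)"
    then have m: "\<not> c dvd m" "card {i \<in> {1..n}. least_power p i = c} = c"
        "\<forall>i\<in>{1..n}. least_power p i \<noteq> c \<longrightarrow> least_power p i dvd m"
      unfolding power_is_cycle_iff[OF assms(2) finite_atLeastAtMost assms(3)] by auto
    have "l dvd m" using assms(1) m(3) unfolding cycle_data_def by blast
    then have "l \<le> n" "\<not> c dvd l" using that m(1) dvd_imp_le[of l m] dvd_trans[of c l m] by auto
    moreover have "cnt * c = 1 * c" using assms(1) m(2) unfolding cycle_data_def by simp
    then have "cnt = 1" using prime_gt_0_nat[OF assms(3)] by (simp only: mult_cancel2) auto
    ultimately show False using False by (simp add: mod_greater_zero_iff_not_dvd)
  qed
  then show ?thesis unfolding power_found_def if_not_P[OF False] by simp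
qed

text \<open>
  The time bound is amortised over the marked points: tracing a cycle and computing the gcd with
  its length \<open>l\<close> take \<open>O(l)\<close> steps, charged to the \<open>l\<close> points that get marked, at 60 units each.
\<close>

lemma wp_find_power:
  assumes "inputs \<sigma>" "prod_row \<sigma> p" and p: "p permutes {1..n}"
    and c: "prime (regs \<sigma> Cyc)" "regs \<sigma> Cyc < W"
  shows "wp W M find_power (\<lambda>\<sigma>' t'. power_found (regs \<sigma> Cyc) p (regs \<sigma>' Pow) \<and> t' \<le> t + 300 * Suc n) \<sigma> t"
proof -
  define cy where "cy = regs \<sigma> Cyc"
  have cy: "prime cy" "0 < cy" "cy < W" using c prime_gt_0_nat by (auto simp: cy_def)
  have reg: "regs \<sigma> Deg = n" "regs \<sigma> NGen = k" "regs \<sigma> Cyc = cy" using assms(1)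
    by (auto simp: inputs_def cy_def)
  show ?thesis
    unfolding find_power_def cy_def[symmetric]
    apply (rule wp_seq)
    apply (rule wp_for[where H = "Suc n" and I = "\<lambda>i \<tau> t'. (\<forall>j<i. mem \<tau> Mark j = 0) \<and> t'
      \<le> t + 3 + 20 * i"])
    apply (simp_all)[5]
    subgoal by (simp add: frame_def reg)
    subgoal premises prems for i \<tau> t'
    proof -
      have i: "i \<le> n" using prems by simp
      show ?thesis
        apply (rule wp_store)
        using prems le_fits[OF i] by (auto simp: less_Suc_eq)
    qed
    subgoal premises prems for \<tau> t'
    proof -
      have reg1: "regs \<tau> Deg = n" "regs \<tau> Cyc = cy" "regs \<tau> Base = regs \<sigma> Base" "mem \<tau> Prod = mem \<sigma> Prod"
        using prems by (auto simp: frame_def reg)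
      have row1: "prod_row \<tau> p" using assms(2) by (simp add: prod_row_def reg1)
      have nothing_marked: "marked (mem \<tau> Mark) = {}" using prems(1) by (auto simp: marked_def)
      have t': "t' \<le> t + 3 + 20 * Suc n" using prems by simp
      show ?thesis
        apply (rule wp_seq, rule wp_assign)
        subgoal by simp
        apply (rule wp_seq, rule wp_assign)
        subgoal by simp
        apply (rule wp_seq)
        apply (rule wp_for[where H = "Suc n" and I = "\<lambda>i \<rho> t''.
            cycle_data p cy (marked (mem \<rho> Mark)) (regs \<rho> Cnt) (regs \<rho> Lcm) \<and>
            (\<forall>j\<le>n. mem \<rho> Mark j \<le> 1) \<and> {1..<i} \<subseteq> marked (mem \<rho> Mark) \<and>
            t'' \<le> t' + 20 + 100 * i + 60 * card (marked (mem \<rho> Mark))"])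
        subgoal by simp
        subgoal using prems(1) by (simp add: nothing_marked cycle_data_empty[simplified])
        apply (simp_all)[3]
        subgoal by (simp add: frame_def reg1)
        subgoal premises prems2 for i \<rho> t''
        proof -
          define X where "X = marked (mem \<rho> Mark)"
          define cnt where "cnt = regs \<rho> Cnt"
          define l where "l = regs \<rho> Lcm"
          have i: "i \<in> {1..n}" "i \<le> n" using prems2 by auto
          have data: "cycle_data p cy X cnt l" and marks: "\<forall>j\<le>n. mem \<rho> Mark j \<le> 1"
            and sub: "{1..<i} \<subseteq> X" and t'': "t'' \<le> t' + 20 + 100 * i + 60 * card X"
            using prems2(3) by (auto simp: X_def cnt_def l_def)
          have X: "X \<subseteq> {1..n}" using marked_subset by (simp add: X_def)
          have reg2: "regs \<rho> Pos = i" "regs \<rho> Deg = n" "regs \<rho> Cyc = cy" "regs \<rho> Base = regs \<sigma> Base"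
              "mem \<rho> Prod = mem \<sigma> Prod"
            using prems2(4,5) reg1 by (auto simp: frame_def)
          define \<rho>1 where "\<rho>1 = \<rho>\<lparr>regs := (regs \<rho>)(Len := 0, Pt := i)\<rparr>"
          have row2: "prod_row \<rho>1 p" using assms(2) by (simp add: prod_row_def \<rho>1_def reg2)
          have closed: "\<forall>j\<in>X. p j \<in> X" using data by (simp add: cycle_data_def)
          note perm = permutes_permutation[OF p]
          have lp: "0 < least_power p i" "least_power p i \<le> n"
            using least_power_of_permutation(2)[OF perm] least_power_le_n[OF p i(1)] by auto
          have lW: "l < W" "0 < l" using data squares_fit by (auto simp: cycle_data_def)
          have cnt: "cnt \<le> n" "cnt < W" using cycle_data_count_le[OF data X cy(2)] le_fits by auto
          have mem\<rho>1: "mem \<rho>1 = mem \<rho>" by (simp add: \<rho>1_def)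
          define I where "I \<tau>' t3 \<longleftrightarrow> cycle_data p cy (marked (mem \<tau>' Mark)) (regs \<tau>' Cnt) (regs \<tau>' Lcm) \<and>
            (\<forall>j\<le>n. mem \<tau>' Mark j \<le> 1) \<and> {1..<Suc i} \<subseteq> marked (mem \<tau>' Mark) \<and>
            t3 + 4 \<le> t' + 20 + 100 * Suc i + 60 * card (marked (mem \<tau>' Mark))" for \<tau>' :: state and t3
          have rest: "wp W M (WHILE \<^bold>\<not> Cell Mark (Reg Pt) DO (
              Mark\<lbrakk>Reg Pt\<rbrakk> ::= Lit 1;;
              Pt ::= Cell Prod (Reg Base \<^bold>+ Reg Pt);;
              Len ::= Reg Len \<^bold>+ Lit 1);;
            IF Reg Len \<^bold>= Reg Cyc THEN
              Cnt ::= Reg Cnt \<^bold>+ Lit 1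
            ELSE IF Lit 0 \<^bold>< Reg Len \<^bold>\<and> Reg Lcm \<^bold>< width THEN (
              GcdA ::= Reg Lcm;;
              GcdB ::= Reg Len;;
              WHILE Lit 0 \<^bold>< Reg GcdB DO (
                Tmp ::= Reg GcdA MOD Reg GcdB;;
                GcdA ::= Reg GcdB;;
                GcdB ::= Reg Tmp);;
              Lcm ::= Reg Lcm DIV Reg GcdA \<^bold>* Reg Len)
            ELSE Skip)
            (\<lambda>\<tau>' t3. regs \<tau>' Pos = i \<and> I \<tau>' t3) \<sigma>1 t1" if s1: "\<sigma>1 = \<rho>1" and t1: "t1 \<le> t'' + 10" for \<sigma>1 t1
            unfolding s1
            apply (rule wp_seq)
            apply (rule wp_conseq[OF wp_trace_cycle[OF row2 p i(1)]])
            subgoal by (simp add: \<rho>1_def)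
            subgoal by (simp add: \<rho>1_def)
            subgoal using marks by (simp add: \<rho>1_def)
            subgoal using closed by (simp add: mem\<rho>1 X_def)
            subgoal premises prems3 for \<tau>2 t2
            proof -
              define len where "len = regs \<tau>2 Len"
              define Y where "Y = X \<union> set (support p i)"
              have post: "\<forall>j\<le>n. mem \<tau>2 Mark j \<le> 1" "marked (mem \<tau>2 Mark) = Y"
                "len = (if i \<in> X then 0 else least_power p i)" "t2 \<le> t'' + 20 + 30 * len"
                using prems3(1) t1 by (simp_all add: mem\<rho>1 X_def Y_def len_def)
              have reg3: "regs \<tau>2 Pos = i" "regs \<tau>2 Deg = n" "regs \<tau>2 Cyc = cy" "regs \<tau>2 Cnt
                = cnt" "regs \<tau>2 Lcm = l"
                "regs \<tau>2 Len = len"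
                using prems3(2) reg2 by (auto simp: frame_def \<rho>1_def cnt_def l_def len_def)
              have len: "len < W" "len \<le> n" using post(3) lp le_fits by auto
              have iY: "{1..<Suc i} \<subseteq> Y"
              proof -
                have "i \<in> set (support p i)" unfolding support_set[OF perm] by (metis funpow_0 rangeI)
                then have "i \<in> Y" unfolding Y_def by blast
                moreover have "{1..<i} \<subseteq> Y" using sub unfolding Y_def by blast
                ultimately show ?thesis using i by (auto simp: less_Suc_eq)
              qed
              have cardY: "card Y = card X + len"
              proof (cases "i \<in> X")
                case True
                have "(p ^^ d) i \<in> X" for d using True closed by (induction d) auto
                then have "Y = X" by (auto simp: Y_def)
                then show ?thesis using True post(3) by simp
              next
                case False
                then show ?thesis using cycle_data_add_cycle(1)[OF data X p i(1) False] post(3)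
                  by (simp add: Y_def del: set_map)
              qed
              \<comment> \<open>of the 60 units for each newly marked point, tracing takes 30 and the gcd 20\<close>
              have t2: "t2 + 60 \<le> t' + 20 + 100 * Suc i + 60 * card X + 30 * len" using post(4) t''
                by simp
              have Y_same: "cycle_data p cy Y cnt l" if "len = 0"
              proof -
                have "i \<in> X" using that post(3) lp by (auto split: if_splits)
                have "(p ^^ d) i \<in> X" for d using \<open>i \<in> X\<close> closed by (induction d) auto
                then have "Y = X" by (auto simp: Y_def)
                then show ?thesis using data by simp
              qed
              have new: "i \<notin> X \<and> len = least_power p i" if "len \<noteq> 0" using that post(3)
                by (auto split: if_splits)
              note add = cycle_data_add_cycle[OF data X p i(1), folded Y_def]
              have len_cy: "cycle_data p cy Y (Suc cnt) l" if "len = cy" using add(2) new that cy by auto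
              show ?thesis
                apply (rule wp_if)
                subgoal using len cy by (simp add: reg3)
                subgoal premises if1
                proof -
                  have "len = cy" using if1 by (simp add: reg3 split: if_splits)
                  note d = len_cy[OF this]
                  have "Suc cnt < W"
                    using cycle_data_count_le[OF d _ cy(2)] marked_subset(1)[of "mem \<tau>2 Mark"] post(2)
                      le_fits by auto
                  then show ?thesis
                    apply (intro wp_assign)
                    using d post iY cardY t2 cnt by (auto simp: reg3 I_def)
                qed
                subgoal premises if1
                proof -
                  have ne: "len \<noteq> cy" using if1 by (simp add: reg3 split: if_splits)
                  show ?thesis
                    apply (rule wp_if)
                    subgoal using len lW by (simp add: reg3)
                    subgoal premises if2
                    proof -
                      have pos: "0 < len" and ln: "l \<le> n" using if2 by (auto simp: reg3 split: if_splits)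
                      have d: "cycle_data p cy Y cnt (lcm l len)" using add(3) new pos ne ln by auto
                      then have lcmW: "lcm l len < W" using squares_fit by (simp add: cycle_data_def)
                      have lcm: "l div gcd l len * len = lcm l len"
                        by (simp add: lcm_nat_def dvd_div_mult)
                      have divW: "l div gcd l len < W" using lW div_le_dividend le_less_trans by blast
                      have gW: "gcd l len < W" using gcd_le1_nat[of l len] lW by linarith
                      show ?thesis
                        apply (rule wp_seq, rule wp_assign)
                        subgoal using lW by (simp add: reg3)
                        apply (rule wp_seq, rule wp_assign)
                        subgoal using len by (simp add: reg3)
                        apply (rule wp_seq)
                        apply (rule wp_conseq[OF wp_gcd[where a = l and b = len]])
                        subgoal by (simp add: reg3)
                        subgoal by (simp add: reg3)
                        subgoal using lW by simp
                        subgoal using lW by simp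
                        subgoal using len by simp
                        subgoal premises prems4 for \<tau>3 t3
                        proof -
                          have reg4: "regs \<tau>3 Pos = i" "regs \<tau>3 Lcm = l" "regs \<tau>3 Len = len" "regs \<tau>3 Cnt
                            = cnt"
                            "regs \<tau>3 GcdA = gcd l len" "mem \<tau>3 = mem \<tau>2"
                            using prems4 reg3 by (auto simp: frame_def)
                          show ?thesis
                            apply (intro wp_assign)
                            subgoal using lW len divW gW lcmW lcm by (simp add: reg4)
                            subgoal using d lcm post iY cardY t2 prems4(1) pos by (simp add: reg4 I_def)
                            done
                        qed
                        done
                    qed
                    subgoal premises if2
                    proof -
                      have "cycle_data p cy Y cnt l"
                      proof (cases "len = 0")
                        case False
                        then have "\<not> l \<le> n" using if2 by (auto simp: reg3 split: if_splits)
                        then show ?thesis using add(4) new False ne by auto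
                      qed (use Y_same in simp)
                      then show ?thesis
                        apply (intro wp_skip)
                        using post iY cardY t2 by (simp add: reg3 I_def)
                    qed
                    done
                qed
                done
            qed
            done
          show ?thesis
            apply (rule wp_seq, rule wp_assign)
            subgoal by simp
            apply (rule wp_seq, rule wp_assign)
            subgoal using i le_fits by (simp add: reg2)
            apply (rule wp_conseq[OF rest])
            subgoal by (simp add: \<rho>1_def reg2)
            subgoal by simp
            subgoal by (simp add: I_def)
            done
        qed
        subgoal premises prems2 for \<rho> t''
        proof -
          define cnt where "cnt = regs \<rho> Cnt"
          define l where "l = regs \<rho> Lcm"
          have "marked (mem \<rho> Mark) = {1..n}"
            using prems2(1) marked_subset(1)[of "mem \<rho> Mark"] by (auto simp: less_Suc_eq_le)
          then have data: "cycle_data p cy {1..n} cnt l" and t'': "t'' \<le> t' + 20 + 100 * Suc n + 60 * n"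
            using prems2(1) by (auto simp: cnt_def l_def)
          have reg2: "regs \<rho> Deg = n" "regs \<rho> Cyc = cy" "regs \<rho> Cnt = cnt" "regs \<rho> Lcm = l"
            using prems2(3) reg1 by (auto simp: frame_def cnt_def l_def)
          have lW: "l < W" "0 < l" using data squares_fit by (auto simp: cycle_data_def)
          have cnt: "cnt < W" using cycle_data_count_le[OF data _ cy(2)] le_fits by auto
          have mW: "l mod cy < W" using lW mod_less_eq_dividend le_less_trans by blast
          note found = cycle_data_power_found[OF data p cy(1)]
          show ?thesis
            apply (rule wp_if)
            subgoal using lW cnt mW cy by (simp add: reg2)
            subgoal
              apply (rule wp_assign)
              using lW found t' t'' n_ge_2 by (auto simp: reg2 less_Suc_eq_le split: if_splits)
            subgoal
              apply (rule wp_assign)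
              using lW found t' t'' n_ge_2 by (auto simp: reg2 less_Suc_eq_le split: if_splits)
            done
        qed
        done
    qed
    done
qed

section \<open>Stepping through the words\<close>

lemma letter_sums_fit: "a \<le> 2 * k \<Longrightarrow> a + k < W" "a \<le> 2 * k \<Longrightarrow> Suc a < W" "a \<le> 2 * k \<Longrightarrow> a < W"
  "0 < 2 * k"
  using letters_fit fits k_ge_2 by linarith+

lemma wp_check_reduced:
  assumes "inputs \<sigma>" "word_stored \<sigma> w" "w \<noteq> []"
  shows "wp W M check_reduced (\<lambda>\<sigma>' t'. regs \<sigma>' Par = (if freely_reduced k w then 1 else 0) \<and>
    t' \<le> t + 60 * Suc (length w)) \<sigma> t"
proof -
  define r where "r = rev w"
  have reg: "regs \<sigma> Deg = n" "regs \<sigma> NGen = k" "regs \<sigma> WLen = length r" "length r < W" "0 < length r"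
    using assms fits by (auto simp: inputs_def word_stored_def r_def)
  have r: "mem \<sigma> Word j = r ! j" "r ! j < 2 * k" "j < M" "j < W" if "j < length r" for j
    using assms(2) that fits nth_mem[OF that] by (auto simp: word_stored_def r_def)
  have w: "w = rev r" "length w = length r" "set r \<subseteq> {..<2 * k}" using assms(2)
    by (auto simp: r_def word_stored_def)
  show ?thesis
    unfolding check_reduced_def
    apply (rule wp_seq, rule wp_assign)
    subgoal by simp
    apply (rule wp_for[where H = "length r" and I = "\<lambda>i \<tau> t'.
        regs \<tau> Par = (if \<forall>j. Suc j < i \<longrightarrow> r ! Suc j \<noteq> inv_letter k (r ! j) then 1 else 0) \<and> t'
          \<le> t + 10 + 40 * i"])
    apply (simp_all)[2]
    subgoal using reg(5) by (simp add: Suc_le_eq del: length_greater_0_conv)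
    subgoal using reg by simp
    subgoal by simp
    subgoal using reg by (simp add: frame_def)
    subgoal premises prems for i \<tau> t'
    proof -
      obtain i' where i: "i = Suc i'" using prems(2) by (cases i) auto
      have i': "i' < length r" "Suc i' < length r" using prems(1) i by auto
      have reg1: "regs \<tau> NGen = k" "regs \<tau> Idx = Suc i'" "mem \<tau> Word = mem \<sigma> Word"
        using prems(4,5) reg i by (auto simp: frame_def)
      have par: "regs \<tau> Par = (if \<forall>j. Suc j < Suc i' \<longrightarrow> r ! Suc j \<noteq> inv_letter k (r ! j) then 1 else 0)"
        using prems(3) by (simp only: i)
      have t': "t' \<le> t + 10 + 40 * Suc i'" using prems(3) i by simp
      have le: "r ! i' \<le> 2 * k" "r ! Suc i' \<le> 2 * k" using r(2)[OF i'(1)] r(2)[OF i'(2)] by auto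
      have "inv_letter k (r ! i') < W"
        using inv_letter_less[of k "r ! i'"] k_ge_2 letter_sums_fit(3)[of "inv_letter k (r ! i')"]
          by simp
      then have modW: "(r ! i' + k) mod (2 * k) < W" by (simp only: inv_letter_def)
      have all: "(\<forall>j. Suc j < Suc (Suc i') \<longrightarrow> r ! Suc j \<noteq> inv_letter k (r ! j)) \<longleftrightarrow>
        (\<forall>j. Suc j < Suc i' \<longrightarrow> r ! Suc j \<noteq> inv_letter k (r ! j)) \<and> r ! Suc i' \<noteq> inv_letter k (r ! i')"
        by (auto simp: less_Suc_eq)
      have idx: "i = regs \<tau> Idx" using i reg1 by simp
      show ?thesis
        apply (rule wp_if)
        subgoal using i' r[OF i'(1)] r[OF i'(2)] modW letter_sums_fit(1)[OF le(1)]
            letter_sums_fit(3)[OF le(1)] letter_sums_fit(3)[OF le(2)] by (simp add: reg1)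
        subgoal premises if1
        proof -
          have "r ! Suc i' = inv_letter k (r ! i')"
            using if1 r[OF i'(1)] r[OF i'(2)] by (simp add: reg1 inv_letter_def split: if_splits)
          then have "\<not> (\<forall>j. Suc j < Suc i \<longrightarrow> r ! Suc j \<noteq> inv_letter k (r ! j))" using all i by blast
          then show ?thesis
            apply (intro wp_assign)
            using t' by (simp_all add: reg1 i del: all_simps)
        qed
        subgoal premises if1
        proof -
          have "r ! Suc i' \<noteq> inv_letter k (r ! i')"
            using if1 r[OF i'(1)] r[OF i'(2)] by (simp add: reg1 inv_letter_def split: if_splits)
          then have "regs \<tau> Par = (if \<forall>j. Suc j < Suc i
            \<longrightarrow> r ! Suc j \<noteq> inv_letter k (r ! j) then 1 else 0)"
            using all i par by simp
          then show ?thesis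
            apply (intro wp_skip)
            using t' by (simp add: reg1 i del: all_simps)
        qed
        done
    qed
    subgoal premises prems for \<tau> t'
    proof -
      have "regs \<tau> Par = (if freely_reduced k w then 1 else 0)"
        using prems(1) unfolding w(1) freely_reduced_rev[OF w(3)] by simp
      then show ?thesis using prems(1) reg by (simp add: w(2))
    qed
    done
qed

text \<open>
  During the carry the digits below the current position \<open>x\<close> are already 0, so incrementing the whole word
  means \<open>x\<close> zeros followed by the increment of the rest.
\<close>

lemma wp_next_word:
  assumes "inputs \<sigma>" "word_stored \<sigma> w" and small: "\<forall>j. mem \<sigma> Word j < 2 * k" and "Suc (length w) < M"
  shows "wp W M next_word (\<lambda>\<sigma>' t'. word_stored \<sigma>' (rev (bump (2 * k) (rev w)))
    \<and> (\<forall>j. mem \<sigma>' Word j < 2 * k) \<and>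
    t' \<le> t + 60 * Suc (length w)) \<sigma> t"
proof -
  define r where "r = rev w"
  have reg: "regs \<sigma> Deg = n" "regs \<sigma> NGen = k" "regs \<sigma> WLen
    = length r" "Suc (length r) < M" "Suc (length r) < W"
    using assms fits by (auto simp: inputs_def word_stored_def r_def)
  have r: "mem \<sigma> Word j = r ! j" "r ! j < 2 * k" if "j < length r" for j
    using assms(2) that nth_mem[OF that] by (auto simp: word_stored_def r_def)
  define I where "I m \<tau> t' \<longleftrightarrow> (\<exists>x. regs \<tau> Idx = x \<and> x \<le> length r \<and> m = length r - x \<and>
      bump (2 * k) r = replicate x 0 @ bump (2 * k) (drop x r) \<and> (\<forall>j<x. mem \<tau> Word j = 0) \<and>
      (\<forall>j\<ge>x. mem \<tau> Word j = mem \<sigma> Word j) \<and> t' \<le> t + 10 + 30 * x)" for m :: nat and \<tau> :: state and t'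
  show ?thesis
    unfolding next_word_def
    apply (rule wp_seq, rule wp_assign)
    subgoal by simp
    apply (rule wp_seq)
    apply (rule wp_while_variant[where I = I and m = "length r"])
    subgoal by (simp add: I_def)
    subgoal premises prems for m \<tau> t'
    proof -
      obtain x where x: "regs \<tau> Idx = x" "x \<le> length r" "mem \<tau> Word x = mem \<sigma> Word x"
        using prems(1) unfolding I_def by blast
      have reg1: "regs \<tau> NGen = k" "regs \<tau> WLen = length r" using prems(2) reg by (auto simp: frame_def)
      have "mem \<sigma> Word x \<le> 2 * k" using small by (simp add: less_imp_le)
      then show ?thesis using x reg letter_sums_fit(2,3)[of "mem \<sigma> Word x"] by (simp add: reg1)
    qed
    subgoal premises prems for m \<tau> t'
    proof -
      obtain x where x: "regs \<tau> Idx = x" "x \<le> length r"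
          "bump (2 * k) r = replicate x 0 @ bump (2 * k) (drop x r)" "\<forall>j<x. mem \<tau> Word j = 0"
          "\<forall>j\<ge>x. mem \<tau> Word j = mem \<sigma> Word j" "t' \<le> t + 10 + 30 * x"
        using prems(1) unfolding I_def by blast
      have reg1: "regs \<tau> NGen = k" "regs \<tau> WLen = length r" using prems(2) reg by (auto simp: frame_def)
      have xM: "x < M" "x < W" using x(2) reg by auto
      have cell: "mem \<tau> Word j < 2 * k" for j
        using x(4,5) small k_ge_2 by (cases "j < x") auto
      define r' where "r' = bump (2 * k) r"
      show ?thesis
        apply (rule wp_if)
        subgoal using xM reg by (simp add: x(1) reg1)
        subgoal premises if1
        proof -
          have xl: "x = length r" using if1 by (simp add: x(1) reg1 split: if_splits)
          then have r': "r' = replicate x 0 @ [0]" using x(3) by (simp add: r'_def)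
          define \<tau>' where "\<tau>' = \<tau>\<lparr>regs := (regs \<tau>)(WLen := Suc x), mem := (mem \<tau>)(Word := (mem \<tau> Word)(x
            := 0))\<rparr>"
          have post: "word_stored \<tau>' (rev r')" "\<forall>j. mem \<tau>' Word j < 2 * k"
          proof -
            have "mem \<tau>' Word j = r' ! j" if "j < length r'" for j
              using that x(4) by (auto simp: \<tau>'_def r' nth_append less_Suc_eq)
            then show "word_stored \<tau>' (rev r')"
              using reg xl k_ge_2 by (auto simp: word_stored_def \<tau>'_def r')
            show "\<forall>j. mem \<tau>' Word j < 2 * k"
              using cell k_ge_2 by (simp add: \<tau>'_def)
          qed
          have "wp W M (Word\<lbrakk>Reg Idx\<rbrakk> ::= Lit 0;; WLen ::= Reg WLen \<^bold>+ Lit 1)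
              (\<lambda>\<rho> t''. \<rho> = \<tau>' \<and> t'' \<le> T + 20) \<tau> T" for T
            apply (intro wp_seq wp_store wp_assign)
            using xM reg xl by (simp_all add: x(1) reg1 \<tau>'_def)
          then show ?thesis
            by (rule wp_conseq) (use post x(2,6) in \<open>simp add: r'_def r_def\<close>)
        qed
        subgoal premises if1
        proof -
          have xl: "x < length r" using if1 x(2) by (simp add: x(1) reg1 split: if_splits)
          have here: "mem \<tau> Word x = r ! x" "r ! x < 2 * k" using x(5) r[OF xl] by auto
          have ne: "Suc (r ! x) \<noteq> 2 * k"
            using prems(3) xl here by (simp add: x(1) reg1 split: if_splits)
          then have r': "r' = replicate x 0 @ Suc (r ! x) # drop (Suc x) r"
            using x(3) by (simp add: r'_def Cons_nth_drop_Suc[OF xl, symmetric])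
          define \<tau>' where "\<tau>' = \<tau>\<lparr>mem := (mem \<tau>)(Word := (mem \<tau> Word)(x := Suc (r ! x)))\<rparr>"
          have len: "length r' = length r" using xl by (simp add: r')
          have mem': "mem \<tau>' Word j = r' ! j" if "j < length r" for j
          proof -
            consider "j < x" | "j = x" | "x < j" by linarith
            then show ?thesis
            proof cases
              case 3
              then have "r' ! j = (Suc (r ! x) # drop (Suc x) r) ! (j - x)" by (simp add: r' nth_append)
              also have "\<dots> = r ! j" using 3 that
                by (cases "j - x") (auto simp: nth_Cons intro!: arg_cong[of _ _ "nth r"])
              finally show ?thesis using 3 x(5) r(1)[OF that] by (simp add: \<tau>'_def)
            qed (use x(4) in \<open>simp_all add: \<tau>'_def r' nth_append\<close>)
          qed
          have small': "\<forall>j. mem \<tau>' Word j < 2 * k" using cell ne here by (simp add: \<tau>'_def)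
          have "set r' \<subseteq> {..<2 * k}"
          proof
            fix a assume "a \<in> set r'"
            then obtain j where "j < length r" "a = r' ! j" using len by (metis in_set_conv_nth)
            then show "a \<in> {..<2 * k}" using mem' small' by (metis lessThan_iff)
          qed
          then have post: "word_stored \<tau>' (rev r')"
            using reg mem' by (simp add: word_stored_def len) (simp add: \<tau>'_def reg1)
          have sucW: "Suc (r ! x) < W" "r ! x < W" using letter_sums_fit(2,3)[of "r ! x"] here by auto
          have "wp W M (Word\<lbrakk>Reg Idx\<rbrakk> ::= Cell Word (Reg Idx) \<^bold>+ Lit 1)
              (\<lambda>\<rho> t''. \<rho> = \<tau>' \<and> t'' \<le> T + 20) \<tau> T" for T
            apply (intro wp_store)
            using xM xl sucW by (simp_all add: x(1) reg1 \<tau>'_def here)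
          then show ?thesis
            by (rule wp_conseq) (use post small' x(2,6) in \<open>simp add: r'_def r_def\<close>)
        qed
        done
    qed
    subgoal premises prems for m \<tau> t'
    proof -
      obtain x where x: "regs \<tau> Idx = x" "x \<le> length r" "m = length r - x"
          "bump (2 * k) r = replicate x 0 @ bump (2 * k) (drop x r)" "\<forall>j<x. mem \<tau> Word j = 0"
          "\<forall>j\<ge>x. mem \<tau> Word j = mem \<sigma> Word j" "t' \<le> t + 10 + 30 * x"
        using prems(1) unfolding I_def by blast
      have reg1: "regs \<tau> NGen = k" "regs \<tau> WLen = length r" using prems(2) reg by (auto simp: frame_def)
      have xl: "x < length r" using prems(3) x(2) by (simp add: x(1) reg1 split: if_splits)
      have here: "mem \<tau> Word x = r ! x" using x(6) r[OF xl] by auto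
      have max: "Suc (r ! x) = 2 * k"
        using prems(3) xl here by (simp add: x(1) reg1 split: if_splits)
      define \<tau>' where "\<tau>' = \<tau>\<lparr>regs := (regs \<tau>)(Idx := Suc x), mem := (mem \<tau>)(Word := (mem \<tau> Word)(x :=
        0))\<rparr>"
      have "I (length r - Suc x) \<tau>' t''" if "t'' \<le> t' + 30" for t''
        unfolding I_def
      proof (intro exI[of _ "Suc x"] conjI)
        show "bump (2 * k) r = replicate (Suc x) 0 @ bump (2 * k) (drop (Suc x) r)"
          using x(4) max by (simp add: Cons_nth_drop_Suc[OF xl, symmetric] replicate_append_same)
      qed (use xl x that in \<open>auto simp: \<tau>'_def less_Suc_eq\<close>)
      moreover have "length r - Suc x < m" using x(3) xl by simp
      ultimately have post: "\<exists>m'<m. I m' \<tau>' t''" if "t'' \<le> t' + 30" for t'' using that by blast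
      have "wp W M (Word\<lbrakk>Reg Idx\<rbrakk> ::= Lit 0;; Idx ::= Reg Idx \<^bold>+ Lit 1)
          (\<lambda>\<rho> t''. \<rho> = \<tau>' \<and> t'' \<le> T + 15) \<tau> T" for T
        apply (intro wp_seq wp_store wp_assign)
        using xl reg by (simp_all add: x(1) reg1 \<tau>'_def)
      then show ?thesis
        by (rule wp_conseq) (use post in simp)
    qed
    done
qed

end

end

section \<open>The search that recomputes all products\<close>

text \<open>
  The search stops at word \<open>j\<close>, provided that it gets there.
\<close>

definition hits :: "nat \<Rightarrow> (nat \<Rightarrow> nat) list \<Rightarrow> nat \<Rightarrow> bool" where
  "hits n s j \<longleftrightarrow> freely_reduced (length s) (bfs_word (2 * length s) j) \<and>
    (\<exists>m\<in>{1..n}. is_cycle (target_length s) (word_prod s (bfs_word (2 * length s) j) ^^ m))"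

text \<open>
  An input on which the conjecture's event occurs: \<open>r\<close> is the index of the selected word, and \<open>l\<close> bounds
  the length of all words that are inspected.
\<close>

locale step1_search = step1_machine +
  fixes r l :: nat
  assumes hit: "hits n s r" and first_hit: "\<And>j. j < r \<Longrightarrow> \<not> hits n s j" and r_le: "r \<le> n\<^sup>2"
    and word_length: "\<And>j. j \<le> r \<Longrightarrow> length (bfs_word (2 * k) j) \<le> l" and l_fits: "Suc l < M"
begin

context
  notes [simp del] = mult_Suc_right and [simp] = small_values mult_Suc_right[of "numeral _"]
    mult_Suc_right[of _ 0]
begin

abbreviation vertex :: "nat \<Rightarrow> nat list" where "vertex \<equiv> bfs_word (2 * k)"

lemma letters_pos: "0 < 2 * k" using k_ge_2 by simp

lemma vertex_prod_permutes: "word_prod s (vertex j) permutes {1..n}"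
  using word_prod_permutes[OF perms, of "vertex j"] bfs_word_letters[OF letters_pos] length_s by simp

lemma hits_iff:
  "hits n s j \<longleftrightarrow> freely_reduced k (vertex j) \<and>
    (\<exists>m\<in>{1..n}. is_cycle (target_length s) (word_prod s (vertex j) ^^ m))"
  by (simp add: hits_def length_s)

lemma power_found_iff:
  assumes "power_found (target_length s) (word_prod s (vertex j)) m" "freely_reduced k (vertex j)"
  shows "m \<noteq> 0 \<longleftrightarrow> hits n s j"
  using assms by (auto simp: power_found_def hits_iff split: if_splits)

lemma target_length_prime: "prime (target_length s)" "target_length s < W" "target_length s \<ge> 2"
proof -
  have "\<not> m dvd 3" if "m \<in> {2..<3}" for m :: nat
  proof -
    from that have "m = 2" by auto
    then show ?thesis by presburger
  qed
  then have "prime (3 :: nat)" by (simp add: prime_nat_iff')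
  then show "prime (target_length s)" by (simp add: target_length_def)
  show "target_length s < W" "target_length s \<ge> 2" by (simp_all add: target_length_def)
qed

text \<open>
  The empty word is no hit, as powers of the identity are not cycles.
\<close>

lemma r_pos: "0 < r"
proof (rule ccontr)
  assume "\<not> 0 < r"
  then have "\<exists>m\<in>{1..n}. is_cycle (target_length s) (id ^^ m)" using hit
    by (simp add: hits_iff word_prod_def)
  then show False using not_is_cycle_id[OF target_length_prime(3)] by auto
qed

text \<open>
  The state after the preparations that both programs share.
\<close>

definition ready :: "state \<Rightarrow> bool" where
  "ready \<sigma> \<longleftrightarrow> inputs \<sigma> \<and> gen_rows (2 * k) (mem \<sigma> Gen) \<and> regs \<sigma> Cyc = target_length s"

definition finished :: "state \<Rightarrow> bool" where
  "finished \<sigma> \<longleftrightarrow> output_word \<sigma> = vertex r \<and> regs \<sigma> Pow \<in> {1..n} \<and>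
    is_cycle (target_length s) (word_prod s (vertex r) ^^ regs \<sigma> Pow) \<and>
    (\<forall>i\<in>{1..n}. mem \<sigma> Mu i = (word_prod s (vertex r) ^^ regs \<sigma> Pow) i)"

lemma wp_setup:
  assumes "inputs \<sigma>" "gen_rows k (mem \<sigma> Gen)"
    and rest: "\<And>\<tau> t'. \<lbrakk>ready \<tau>; t' \<le> t + 300 * (k * Suc n); \<And>A. A \<noteq> Gen \<Longrightarrow> A \<noteq> Mark \<Longrightarrow> mem \<tau> A = mem \<sigma> A\<rbrakk>
      \<Longrightarrow> wp W M c Q \<tau> t'"
  shows "wp W M (compute_inverses;; compute_target_length;; c) Q \<sigma> t"
  apply (rule wp_seq)
  apply (rule wp_conseq[OF wp_compute_inverses[OF assms(1,2)]])
  subgoal premises prems for \<tau> t'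
  proof -
    have inp: "inputs \<tau>" "gen_rows (2 * k) (mem \<tau> Gen)" "\<And>A. A \<noteq> Gen \<Longrightarrow> mem \<tau> A = mem \<sigma> A"
      using prems assms(1) by (auto simp: frame_def compute_inverses_def inputs_def)
    show ?thesis
      apply (rule wp_seq)
      apply (rule wp_conseq[OF wp_compute_target_length[OF inp(1,2)]])
      apply (rule rest)
      using prems(1) inp by (auto simp: ready_def frame_def compute_target_length_def inputs_def)
  qed
  done

lemma input_state_ok: "inputs (input_state n s)" "gen_rows k (mem (input_state n s) Gen)"
  "regs (input_state n s) x = (if x = Deg then n else if x = NGen then k else 0)"
  "A \<noteq> Gen \<Longrightarrow> mem (input_state n s) A = (\<lambda>_. 0)"
proof -
  have "(a * Suc n + i) div Suc n = a" "(a * Suc n + i) mod Suc n = i" if "i \<le> n" for a i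
    using that by (simp_all add: div_mult_self3 less_Suc_eq_le)
  moreover have "a * Suc n + i < k * Suc n" if "a < k" "i \<le> n" for a i using row_less that by blast
  ultimately show "gen_rows k (mem (input_state n s) Gen)"
    by (auto simp: gen_rows_def input_state_def length_s signed_gens_def nth_append)
qed (auto simp: inputs_def input_state_def length_s)

text \<open>
  The invariant says that the array holds word \<open>j\<close> and that the exponent is 0 while \<open>j\<close> has
  not reached the first hit \<open>r\<close>. The loop stops as soon as it has.
\<close>

lemma wp_recomputing_loop:
  assumes "ready \<sigma>" "regs \<sigma> WLen = 0" "regs \<sigma> Base = 0" "regs \<sigma> Pow = 0" "\<forall>j. mem \<sigma> Word j = 0"
  shows "wp W M (WHILE \<^bold>\<not> Reg Pow DO (
       next_word;;
       check_reduced;;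
       IF Reg Par THEN (compute_product;; find_power) ELSE Skip))
     (\<lambda>\<tau> t'. ready \<tau> \<and> word_stored \<tau> (vertex r) \<and> prod_row \<tau> (word_prod s (vertex r)) \<and>
       power_found (target_length s) (word_prod s (vertex r)) (regs \<tau> Pow) \<and> regs \<tau> Pow \<noteq> 0 \<and>
       t' \<le> t + 10 + 700 * (Suc n * Suc l) * r) \<sigma> t"
proof -
  define I where "I m \<tau> t' \<longleftrightarrow> (\<exists>j. j \<le> r \<and> m = r - j \<and> word_stored \<tau> (vertex j)
    \<and> (\<forall>i. mem \<tau> Word i < 2 * k) \<and>
    t' \<le> t + 700 * (Suc n * Suc l) * j \<and>
    (if regs \<tau> Pow = 0 then j < r else j = r \<and> prod_row \<tau> (word_prod s (vertex r)) \<and>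
       power_found (target_length s) (word_prod s (vertex r)) (regs \<tau> Pow)))"
         for m :: nat and \<tau> :: state and t'
  let ?body = "next_word;; check_reduced;; IF Reg Par THEN (compute_product;; find_power) ELSE Skip"
  have keep: "ready \<tau> \<and> regs \<tau> Base = 0" if "frame ?body \<sigma> \<tau>" for \<tau>
    using that assms(1,3) by (auto simp: ready_def inputs_def frame_def next_word_def check_reduced_def
        compute_product_def find_power_def)
  have pow_small: "regs \<tau> Pow < W" if "I m \<tau> t'" for m \<tau> t'
    using that le_fits(2) by (auto simp: I_def power_found_def split: if_splits)
  show ?thesis
  proof (rule wp_while_variant[where I = I and m = r])
    show "I r \<sigma> t"
      unfolding I_def using assms r_pos letters_pos l_fits
        by (intro exI[of _ 0]) (simp add: word_stored_def)
    show "safe W M (\<^bold>\<not> Reg Pow) \<tau>" if "I m \<tau> t'" for m \<tau> t' using pow_small[OF that] by simp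
    show "ready \<tau> \<and> word_stored \<tau> (vertex r) \<and> prod_row \<tau> (word_prod s (vertex r)) \<and>
       power_found (target_length s) (word_prod s (vertex r)) (regs \<tau> Pow) \<and> regs \<tau> Pow \<noteq> 0 \<and>
       t' + (cost (\<^bold>\<not> Reg Pow) + 1) \<le> t + 10 + 700 * (Suc n * Suc l) * r"
      if "I m \<tau> t'" "frame ?body \<sigma> \<tau>" "val (\<^bold>\<not> Reg Pow) \<tau> = 0" for m \<tau> t'
    proof -
      have "regs \<tau> Pow \<noteq> 0" using that(3) by (simp split: if_splits)
      then show ?thesis using that(1) keep[OF that(2)] by (auto simp: I_def)
    qed
    show "wp W M ?body (\<lambda>\<tau>' t''. \<exists>m'<m. I m' \<tau>' t'') \<tau> (t' + (cost (\<^bold>\<not> Reg Pow) + 1))"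
      if inv: "I m \<tau> t'" and fr: "frame ?body \<sigma> \<tau>" and cond: "val (\<^bold>\<not> Reg Pow) \<tau> \<noteq> 0" for m \<tau> t'
    proof -
      have pow0: "regs \<tau> Pow = 0" using cond by (simp split: if_splits)
      then obtain j where j: "j < r" "m = r - j" "word_stored \<tau> (vertex j)" "\<forall>i. mem \<tau> Word i < 2 * k"
          "t' \<le> t + 700 * (Suc n * Suc l) * j"
        using inv by (auto simp: I_def)
      have inp: "inputs \<tau>" "gen_rows (2 * k) (mem \<tau> Gen)" "regs \<tau> Cyc = target_length s" "regs \<tau> Base
        = 0"
        using keep[OF fr] by (auto simp: ready_def)
      have lens: "length (vertex j) \<le> l" "length (vertex (Suc j)) \<le> l"
        using word_length[of j] word_length[of "Suc j"] j(1) by (simp_all del: bfs_word.simps)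
      have successor: "rev (bump (2 * k) (rev (vertex j))) = vertex (Suc j)"
        using bfs_word_Suc_eq_bump[OF letters_pos] by simp
      have le_nl: "Suc l \<le> Suc n * Suc l" "Suc n \<le> Suc n * Suc l"
        using mult_le_mono2[of 1 "Suc l" "Suc n"] by simp_all
      \<comment> \<open>one word costs at most 700 * (Suc n * Suc l) units\<close>
      have continue: "\<exists>m'<m. I m' \<rho> t''"
        if "word_stored \<rho> (vertex (Suc j))" "\<forall>i. mem \<rho> Word i < 2 * k" "t'' \<le> t' + 700 * (Suc n * Suc l)"
          "if hits n s (Suc j) then prod_row \<rho> (word_prod s (vertex (Suc j))) \<and>
             power_found (target_length s) (word_prod s (vertex (Suc j))) (regs \<rho> Pow) \<and> regs \<rho> Pow \<noteq> 0
           else regs \<rho> Pow = 0" for \<rho> t''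
      proof (intro exI[of _ "r - Suc j"] conjI)
        show "r - Suc j < m" using j by simp
        have "t'' \<le> t + 700 * (Suc n * Suc l) * Suc j" using that(3) j(5) by (simp add: mult_Suc_right)
        moreover have "Suc j = r" if "hits n s (Suc j)" using that first_hit[of "Suc j"] j(1)
          by (meson Suc_leI le_neq_implies_less)
        moreover have "Suc j < r" if "\<not> hits n s (Suc j)" using that hit j(1)
          by (metis Suc_leI le_neq_implies_less)
        ultimately show "I (r - Suc j) \<rho> t''"
          unfolding I_def using that j(1)
            by (intro exI[of _ "Suc j"]) (auto simp del: bfs_word.simps split: if_splits)
      qed
      show ?thesis
        apply (rule wp_seq)
        apply (rule wp_conseq[OF wp_next_word[OF inp(1) j(3,4)]])
        subgoal using lens l_fits by simp
        subgoal premises prems1 for \<tau>1 t1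
        proof -
          have w1: "word_stored \<tau>1 (vertex (Suc j))" "\<forall>i. mem \<tau>1 Word i < 2 * k" "t1
            \<le> t' + 10 + 60 * Suc l"
            using prems1(1) lens unfolding successor by auto
          have inp1: "inputs \<tau>1" "gen_rows (2 * k) (mem \<tau>1 Gen)" "regs \<tau>1 Cyc
            = target_length s" "regs \<tau>1 Base = 0"
              "regs \<tau>1 Pow = 0"
            using prems1(2) inp pow0 by (auto simp: frame_def next_word_def inputs_def)
          show ?thesis
            apply (rule wp_seq)
            apply (rule wp_conseq[OF wp_check_reduced[OF inp1(1) w1(1)]])
            subgoal by simp
            subgoal premises prems2 for \<tau>2 t2
            proof -
              have par: "regs \<tau>2 Par = (if freely_reduced k (vertex (Suc j)) then 1 else 0)" and
                  t2: "t2 \<le> t' + 10 + 120 * Suc l"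
                using prems2(1) w1(3) lens by auto
              have fr2: "mem \<tau>2 = mem \<tau>1" "regs \<tau>2 WLen = regs \<tau>1 WLen" "regs \<tau>2 Base = 0" "regs \<tau>2 Pow
                = 0"
                  "inputs \<tau>2" "gen_rows (2 * k) (mem \<tau>2 Gen)" "regs \<tau>2 Cyc = target_length s"
                using prems2(2) inp1 by (auto simp: frame_def check_reduced_def inputs_def)
              have w2: "word_stored \<tau>2 (vertex (Suc j))" "\<forall>i. mem \<tau>2 Word i < 2 * k"
                using w1 fr2 by (auto simp: word_stored_def simp del: bfs_word.simps)
              show ?thesis
                apply (rule wp_if)
                subgoal using par by (simp split: if_splits)
                subgoal premises if1
                proof -
                  have red: "freely_reduced k (vertex (Suc j))" using if1 par
                    by (simp split: if_splits del: bfs_word.simps)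
                  show ?thesis
                    apply (rule wp_seq)
                    apply (rule wp_conseq[OF wp_compute_product[OF fr2(5,6) w2(1)]])
                    subgoal premises prems3 for \<tau>3 t3
                    proof -
                      have prod: "\<forall>i\<le>n. mem \<tau>3 Prod i = word_prod s (vertex (Suc j)) i"
                        using prems3(1) by blast
                      have t3: "t3 \<le> t' + 12 + 120 * Suc l + 60 * (Suc n * Suc l)"
                      proof -
                        have "Suc n * Suc (length (vertex (Suc j))) \<le> Suc n * Suc l"
                          using lens by (intro mult_le_mono2) (simp del: bfs_word.simps)
                        then show ?thesis using prems3(1) t2 by (simp del: bfs_word.simps)
                      qed
                      have fr3: "regs \<tau>3 Base = 0" "inputs \<tau>3" "regs \<tau>3 Cyc = target_length s"
                          "mem \<tau>3 Word = mem \<tau>2 Word" "regs \<tau>3 WLen = regs \<tau>2 WLen"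
                        using prems3(2) fr2 by (auto simp: frame_def compute_product_def inputs_def)
                      have row3: "prod_row \<tau>3 (word_prod s (vertex (Suc j)))"
                        using prod fr3(1) by (simp add: prod_row_def del: bfs_word.simps)
                      show ?thesis
                        apply (rule wp_conseq[OF wp_find_power[OF fr3(2) row3 vertex_prod_permutes]])
                        subgoal using target_length_prime fr3 by simp
                        subgoal using target_length_prime fr3 by simp
                        subgoal premises prems4 for \<tau>4 t4
                        proof -
                          have found: "power_found (target_length s) (word_prod s (vertex (Suc j))) (regs
                            \<tau>4 Pow)"
                            using prems4(1) fr3(3) by simp
                          have fr4: "mem \<tau>4 Word = mem \<tau>3 Word" "regs \<tau>4 WLen = regs \<tau>3 WLen"
                              "mem \<tau>4 Prod = mem \<tau>3 Prod" "regs \<tau>4 Base = regs \<tau>3 Base"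
                            using prems4(2) by (auto simp: frame_def find_power_def)
                          have t4: "t4 \<le> t' + 700 * (Suc n * Suc l)"
                            using prems4(1) t3 le_nl by simp
                          show ?thesis
                            apply (rule continue)
                            subgoal using w2(1) fr4 fr3
                              by (simp add: word_stored_def del: bfs_word.simps)
                            subgoal using w2(2) fr4 fr3 by simp
                            subgoal by (rule t4)
                            subgoal using power_found_iff[OF found red] found row3 fr4
                              by (auto simp: prod_row_def simp del: bfs_word.simps)
                            done
                        qed
                        done
                    qed
                    done
                qed
                subgoal premises if1
                proof -
                  have "\<not> hits n s (Suc j)" using if1 par
                    by (simp add: hits_iff split: if_splits del: bfs_word.simps)
                  moreover have "t2 + 2 + 1 \<le> t' + 700 * (Suc n * Suc l)" using t2 le_nl by simp
                  ultimately show ?thesis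
                    apply (intro wp_skip continue)
                    using w2 fr2 by (simp_all del: bfs_word.simps)
                qed
                done
            qed
            done
        qed
        done
    qed
  qed
qed

lemma wp_recomputing_step1:
  "wp W M recomputing_step1 (\<lambda>\<tau> t'. finished \<tau> \<and>
     t' \<le> 300 * (k * Suc n) + 60 * (Suc n * Suc n) + 700 * (Suc n * Suc l) * r + 50) (input_state n s) 0"
  unfolding recomputing_step1_def
  apply (rule wp_setup[OF input_state_ok(1,2)])
  subgoal premises prems for \<tau> t
    apply (rule wp_seq, rule wp_assign)
    subgoal by simp
    apply (rule wp_seq, rule wp_assign)
    subgoal by simp
    apply (rule wp_seq, rule wp_assign)
    subgoal by simp
    apply (rule wp_seq)
    apply (rule wp_conseq[OF wp_recomputing_loop])
    subgoal using prems(1) by (simp add: ready_def inputs_def)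
    apply (simp_all)[3]
    subgoal using prems(3)[of Word] input_state_ok(4)[of Word] by simp
    subgoal premises prems2 for \<tau>1 t1
    proof -
      have p1: "ready \<tau>1" "word_stored \<tau>1 (vertex r)" "prod_row \<tau>1 (word_prod s (vertex r))"
        "power_found (target_length s) (word_prod s (vertex r)) (regs \<tau>1 Pow)" "regs \<tau>1 Pow \<noteq> 0"
        and t1: "t1 \<le> t + 6 + 10 + 700 * (Suc n * Suc l) * r"
        using prems2(1) by auto
      have pw: "regs \<tau>1 Pow \<in> {1..n}" "is_cycle (target_length s) (word_prod s (vertex r) ^^ regs \<tau>1
        Pow)"
        using p1(4,5) by (auto simp: power_found_def)
      have inp: "inputs \<tau>1" using p1(1) by (simp add: ready_def)
      show ?thesis
        apply (rule wp_conseq[OF wp_compute_mu[OF inp p1(3) vertex_prod_permutes]])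
        subgoal using pw by simp
        subgoal premises prems3 for \<tau>2 t2
        proof -
          have fr: "regs \<tau>2 Pow = regs \<tau>1 Pow" "regs \<tau>2 WLen = regs \<tau>1 WLen" "mem \<tau>2 Word = mem \<tau>1 Word"
            using prems3(2) by (auto simp: frame_def compute_mu_def)
          have "output_word \<tau>2 = vertex r"
          proof -
            have "map (mem \<tau>1 Word) [0..<regs \<tau>1 WLen] = rev (vertex r)"
              using p1(2) by (intro nth_equalityI) (auto simp: word_stored_def)
            then show ?thesis by (simp add: output_word_def fr)
          qed
          then show ?thesis using prems3(1) pw t1 prems(2) by (simp add: finished_def fr)
        qed
        done
    qed
    done
  done

end

end

section \<open>The search that stores all products\<close>

text \<open>
  The indices of the freely reduced words, in order, up to \<open>J\<close>. This is the queue of the storing program when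
  all words up to index \<open>J\<close> have been considered: row \<open>q\<close> belongs to the word with the \<open>q\<close>-th of
  these indices.
\<close>

definition reduced_indices :: "nat \<Rightarrow> nat \<Rightarrow> nat list" where
  "reduced_indices k J = filter (\<lambda>i. freely_reduced k (bfs_word (2 * k) i)) [0..<Suc J]"

lemma reduced_indices_Suc:
  "reduced_indices k (Suc J) =
    reduced_indices k J @ (if freely_reduced k (bfs_word (2 * k) (Suc J)) then [Suc J] else [])"
  by (simp add: reduced_indices_def del: bfs_word.simps)

lemma set_reduced_indices: "i \<in> set (reduced_indices k J) \<longleftrightarrow> freely_reduced k (bfs_word (2 * k) i) \<and> i
  \<le> J"
  by (auto simp: reduced_indices_def simp del: bfs_word.simps upt_Suc)

lemma length_reduced_indices: "length (reduced_indices k J) \<le> Suc J"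
  unfolding reduced_indices_def by (rule order_trans[OF length_filter_le]) simp

lemma reduced_indices_less_iff:
  assumes "x < length (reduced_indices k J)" "y < length (reduced_indices k J)"
  shows "reduced_indices k J ! x < reduced_indices k J ! y \<longleftrightarrow> x < y"
proof -
  have "sorted_wrt (<) (reduced_indices k J)"
    unfolding reduced_indices_def by (intro sorted_wrt_filter sorted_wrt_upt)
  then have "x < y \<Longrightarrow> reduced_indices k J ! x < reduced_indices k J ! y"
    and "y < x \<Longrightarrow> reduced_indices k J ! y < reduced_indices k J ! x"
    using assms by (auto simp: sorted_wrt_iff_nth_less)
  then show ?thesis by (metis less_irrefl linorder_neqE_nat not_less_iff_gr_or_eq)
qed

lemma reduced_indices_0: "reduced_indices k 0 = [0]"
  by (simp add: reduced_indices_def freely_reduced_def)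

lemma reduced_indices_nth_0: "reduced_indices k J ! 0 = 0"
proof -
  have "[0..<Suc J] = 0 # [1..<Suc J]" by (simp add: upt_rec del: upt_Suc)
  then show ?thesis by (simp add: reduced_indices_def freely_reduced_def del: upt_Suc)
qed

text \<open>
  The head of the queue moves from \<open>u\<close> to the next reduced index \<open>v\<close> when all children of \<open>u\<close> have been
  considered. The queue is never exhausted since \<open>u\<close> has a reduced child. The words skipped between the
  last child of \<open>u\<close> and the first child of \<open>v\<close> have parents strictly between \<open>u\<close> and \<open>v\<close>; those are not
  reduced, and neither are their children.
\<close>

lemma reduced_indices_next:
  assumes k: "k \<ge> 2" and h: "h < length (reduced_indices k J)" "reduced_indices k J ! h = u"
    and J: "J = u * (2 * k) + 2 * k"
  shows "Suc h < length (reduced_indices k J)"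
    and "J \<le> (reduced_indices k J ! Suc h) * (2 * k)"
    and "reduced_indices k ((reduced_indices k J ! Suc h) * (2 * k)) = reduced_indices k J"
proof -
  let ?b = "2 * k" and ?w = "bfs_word (2 * k)"
  let ?R = "reduced_indices k J"
  have b: "0 < ?b" using k by simp
  have parent: "(u * ?b + a) div ?b = u" if "a < ?b" for u a :: nat
    using that by (simp add: div_add1_eq)
  have u: "freely_reduced k (?w u)" using h set_reduced_indices nth_mem by metis
  \<comment> \<open>one of the letters 0 and 1 differs from the inverse of the last letter\<close>
  obtain a where a: "a < 2" "?w u \<noteq> [] \<longrightarrow> a \<noteq> inv_letter k (last (?w u))"
  proof (cases "inv_letter k (last (?w u)) = 0")
    case True
    then show ?thesis by (intro that[of 1]) simp_all
  next
    case False
    then show ?thesis by (intro that[of 0]) simp_all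
  qed
  have "?w (Suc (u * ?b + a)) = ?w u @ [a]"
    using parent[of a u] a(1) k by simp
  then have "Suc (u * ?b + a) \<in> set ?R"
    using u a k by (simp add: set_reduced_indices freely_reduced_snoc J del: bfs_word.simps)
  then obtain h' where h': "h' < length ?R" "?R ! h' = Suc (u * ?b + a)" by (metis in_set_conv_nth)
  \<comment> \<open>children come after their parents in the list, hence in the queue\<close>
  have "u < Suc (u * ?b + a)" using b mult_le_mono2[of 1 ?b u] by linarith
  then have "h < h'" using reduced_indices_less_iff[OF h(1) h'(1)] h(2) h'(2) by simp
  then show Suc_h: "Suc h < length ?R" using h'(1) by simp
  define v where "v = ?R ! Suc h"
  have "u < v" using reduced_indices_less_iff[OF h(1) Suc_h] h(2) by (simp add: v_def)
  have "Suc u * ?b \<le> v * ?b" using \<open>u < v\<close> by (intro mult_le_mono1) simp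
  then show le: "J \<le> (?R ! Suc h) * ?b" by (simp add: J v_def)
  have "v \<le> J" using nth_mem[OF Suc_h] set_reduced_indices v_def by metis
  \<comment> \<open>a reduced word in the gap would have a reduced parent strictly between the two heads\<close>
  have gap: "\<not> freely_reduced k (?w i)" if i: "J < i" "i \<le> v * ?b" for i
  proof
    assume red: "freely_reduced k (?w i)"
    obtain i' where i': "i = Suc i'" using i by (cases i) auto
    define q where "q = i' div ?b"
    have "Suc u * ?b \<le> i'" using i i' J by simp
    then have "Suc u \<le> q" unfolding q_def using b
      by (simp add: less_eq_div_iff_mult_less_eq del: mult_Suc)
    have "i' < v * ?b" using i i' by simp
    then have "q < v" unfolding q_def using b by (simp add: div_less_iff_less_mult)
    have "freely_reduced k (?w q)" using red by (simp add: i' q_def freely_reduced_snoc)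
    then have "q \<in> set ?R" using \<open>q < v\<close> \<open>v \<le> J\<close> by (simp add: set_reduced_indices)
    then obtain x where x: "x < length ?R" "?R ! x = q" by (metis in_set_conv_nth)
    have "h < x" using reduced_indices_less_iff[OF h(1) x(1)] h(2) x(2) \<open>Suc u \<le> q\<close> by simp
    moreover have "x < Suc h" using reduced_indices_less_iff[OF x(1) Suc_h] x(2) \<open>q < v\<close>
      by (simp add: v_def)
    ultimately show False by simp
  qed
  have "[0..<Suc (v * ?b)] = [0..<Suc J] @ [Suc J..<Suc (v * ?b)]"
    using upt_add_eq_append[of 0 "Suc J" "v * ?b - J"] le by (simp add: v_def del: upt_Suc)
  moreover have "filter (\<lambda>i. freely_reduced k (?w i)) [Suc J..<Suc (v * ?b)] = []"
    using gap by (auto simp: filter_empty_conv simp del: upt_Suc)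
  ultimately show "reduced_indices k ((?R ! Suc h) * ?b) = ?R"
    by (simp add: reduced_indices_def v_def del: upt_Suc)
qed

context step1_search
begin

context
  notes [simp del] = mult_Suc_right and [simp] = small_values mult_Suc_right[of "numeral _"]
    mult_Suc_right[of _ 0]
begin

text \<open>
  The rows and the tree of words, as far as the word with index \<open>J\<close>. The entry \<open>Last 0\<close> belongs to the empty
  word; the test for reducedness evaluates it before discarding it, so it has to stay a machine word.
\<close>

definition rows_ok :: "state \<Rightarrow> nat \<Rightarrow> bool" where
  "rows_ok \<tau> J \<longleftrightarrow> (let R = reduced_indices k J in
     Suc (regs \<tau> Num) = length R \<and> mem \<tau> Last 0 < 2 * k \<and>
     (\<forall>q<length R. \<forall>i\<le>n. mem \<tau> Prod (q * Suc n + i) = word_prod s (vertex (R ! q)) i) \<and>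
     (\<forall>q<length R. 0 < q \<longrightarrow> mem \<tau> Last q < 2 * k \<and> mem \<tau> Parent q < q \<and>
        vertex (R ! q) = vertex (R ! mem \<tau> Parent q) @ [mem \<tau> Last q]))"

lemma rows_ok_Suc:
  assumes rows: "rows_ok \<tau> J" and red: "freely_reduced k (vertex (Suc J))"
    and child: "vertex (Suc J) = vertex (reduced_indices k J ! h) @ [a]" "a < 2 * k"
      "h < length (reduced_indices k J)"
    and \<tau>': "regs \<tau>' Num = Suc (regs \<tau> Num)"
      "mem \<tau>' Last = (mem \<tau> Last)(Suc (regs \<tau> Num) := a)" "mem \<tau>' Parent
        = (mem \<tau> Parent)(Suc (regs \<tau> Num) := h)"
      "\<And>q i. q \<le> regs \<tau> Num \<Longrightarrow> i \<le> n \<Longrightarrow> mem \<tau>' Prod (q * Suc n + i) = mem \<tau> Prod (q * Suc n + i)"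
      "\<And>i. i \<le> n \<Longrightarrow> mem \<tau>' Prod (Suc (regs \<tau> Num) * Suc n + i) = word_prod s (vertex (Suc J)) i"
  shows "rows_ok \<tau>' (Suc J)"
proof -
  define R where "R = reduced_indices k J"
  define N where "N = regs \<tau> Num"
  have R: "length R = Suc N" "reduced_indices k (Suc J) = R @ [Suc J]"
    using rows red by (simp_all add: rows_ok_def Let_def R_def N_def reduced_indices_Suc del:
      bfs_word.simps)
  have old: "mem \<tau> Prod (q * Suc n + i) = word_prod s (vertex (R ! q)) i" if "q \<le> N" "i \<le> n" for q i
    using rows that R(1) by (simp add: rows_ok_def Let_def less_Suc_eq_le flip: R_def del:
      bfs_word.simps)
  have old_tree: "mem \<tau> Last q < 2 * k \<and> mem \<tau> Parent q < q \<and>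
        vertex (R ! q) = vertex (R ! mem \<tau> Parent q) @ [mem \<tau> Last q]" if "q \<le> N" "0 < q" for q
    using rows that R(1) by (simp add: rows_ok_def Let_def less_Suc_eq_le flip: R_def del:
      bfs_word.simps)
  have last0: "mem \<tau> Last 0 < 2 * k" using rows by (simp add: rows_ok_def Let_def)
  have h: "h < Suc N" "vertex (Suc J) = vertex (R ! h) @ [a]" using child R(1) by (simp_all add: R_def)
  show ?thesis
    unfolding rows_ok_def Let_def R(2)
  proof (intro conjI allI impI)
    fix q assume q: "q < length (R @ [Suc J])"
    show "mem \<tau>' Prod (q * Suc n + i) = word_prod s (vertex ((R @ [Suc J]) ! q)) i" if "i \<le> n" for i
    proof (cases "q \<le> N")
      case True
      then show ?thesis using old[OF True that] \<tau>'(4)[of q i] that R(1)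
        by (simp add: nth_append N_def del: bfs_word.simps)
    next
      case False
      then have "q = Suc N" using q R(1) by simp
      then show ?thesis using \<tau>'(5)[OF that] R(1)
        by (simp add: nth_append N_def del: bfs_word.simps mult_Suc)
    qed
    assume "0 < q"
    show "mem \<tau>' Last q < 2 * k" "mem \<tau>' Parent q < q"
      "vertex ((R @ [Suc J]) ! q) = vertex ((R @ [Suc J]) ! mem \<tau>' Parent q) @ [mem \<tau>' Last q]"
    proof (atomize (full), cases "q \<le> N")
      case True
      then show "mem \<tau>' Last q < 2 * k \<and> mem \<tau>' Parent q < q \<and>
          vertex ((R @ [Suc J]) ! q) = vertex ((R @ [Suc J]) ! mem \<tau>' Parent q) @ [mem \<tau>' Last q]"
        using old_tree[OF True \<open>0 < q\<close>] R(1)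
          by (simp add: \<tau>'(2,3) nth_append del: bfs_word.simps flip: N_def)
    next
      case False
      then have "q = Suc N" using q R(1) by simp
      then show "mem \<tau>' Last q < 2 * k \<and> mem \<tau>' Parent q < q \<and>
          vertex ((R @ [Suc J]) ! q) = vertex ((R @ [Suc J]) ! mem \<tau>' Parent q) @ [mem \<tau>' Last q]"
        using h child(2) R(1) by (simp add: \<tau>'(2,3) nth_append del: bfs_word.simps flip: N_def)
    qed
  qed (use R(1) \<tau>' last0 in \<open>simp_all add: N_def\<close>)
qed

end

end

locale step1_stored_search = step1_search +
  assumes rows_fit: "Suc (n\<^sup>2) * Suc n \<le> M"
begin

context
  notes [simp del] = mult_Suc_right and [simp] = small_values mult_Suc_right[of "numeral _"]
    mult_Suc_right[of _ 0]
begin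

lemma row_index_fits:
  assumes "q \<le> n\<^sup>2" "i \<le> n"
  shows "q * Suc n + i < M" "q * Suc n + i < W" "q * Suc n < W" "q < M" "q < W"
proof -
  have "q * Suc n + i < Suc (n\<^sup>2) * Suc n" using row_less[of q "Suc (n\<^sup>2)" i] assms by simp
  then show 1: "q * Suc n + i < M" using rows_fit by linarith
  have "q \<le> q * Suc n" by simp
  then show "q * Suc n + i < W" "q * Suc n < W" "q < M" "q < W" using 1 fits by linarith+
qed

text \<open>
  The part of the program that handles a new freely reduced word.
\<close>

definition append_row :: com where
  "append_row = (
           Num ::= Reg Num \<^bold>+ Lit 1;;
           Base ::= Reg Num \<^bold>* width;;
           FOR Pos FROM Lit 0 BELOW width DO
             Prod\<lbrakk>Reg Base \<^bold>+ Reg Pos\<rbrakk> ::=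
               Cell Prod (Reg Head \<^bold>* width \<^bold>+ Cell Gen (Reg Ltr \<^bold>* width \<^bold>+ Reg Pos));;
           Parent\<lbrakk>Reg Num\<rbrakk> ::= Reg Head;;
           Last\<lbrakk>Reg Num\<rbrakk> ::= Reg Ltr;;
           find_power)"

text \<open>
  The new row lies behind all rows in use, so copying into it leaves them intact; its contents are the
  product of row \<open>h\<close> with a letter.
\<close>

lemma wp_append_row:
  assumes "ready \<sigma>" and rows: "rows_ok \<sigma> J" and h: "regs \<sigma> Head = h" "h < length (reduced_indices k J)"
    and a: "regs \<sigma> Ltr = a" "a < 2 * k"
    and child: "vertex (Suc J) = vertex (reduced_indices k J ! h) @ [a]"
      and red: "freely_reduced k (vertex (Suc J))"
    and J: "Suc J \<le> n\<^sup>2"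
  shows "wp W M append_row (\<lambda>\<tau> t'. rows_ok \<tau> (Suc J) \<and> prod_row \<tau> (word_prod s (vertex (Suc J))) \<and>
     power_found (target_length s) (word_prod s (vertex (Suc J))) (regs \<tau> Pow) \<and> t'
       \<le> t + 400 * Suc n) \<sigma> t"
proof -
  define R where "R = reduced_indices k J"
  define N where "N = regs \<sigma> Num"
  define v where "v = word_prod s (vertex (Suc J))"
  have inp: "inputs \<sigma>" "gen_rows (2 * k) (mem \<sigma> Gen)" "regs \<sigma> Cyc = target_length s" "regs \<sigma> Deg
    = n" "regs \<sigma> NGen = k"
    using assms(1) by (auto simp: ready_def inputs_def)
  have R: "length R = Suc N" "length R \<le> Suc J" "h \<le> N"
    using rows h length_reduced_indices[of k J] by (auto simp: rows_ok_def Let_def R_def N_def)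
  have old: "mem \<sigma> Prod (q * Suc n + i) = word_prod s (vertex (R ! q)) i" if "q \<le> N" "i \<le> n" for q i
    using rows that R(1) by (simp add: rows_ok_def Let_def less_Suc_eq_le flip: R_def del:
      bfs_word.simps)
  have bounds: "N \<le> n\<^sup>2" "Suc N \<le> n\<^sup>2" "h \<le> n\<^sup>2" using R J by auto
  have g_le: "(signed_gens s ! a) i \<le> n" if "i \<le> n" for i using generator_le[OF a(2) that] .
  have gen: "mem \<sigma> Gen (a * Suc n + i) = (signed_gens s ! a) i" if "i \<le> n" for i
    using inp(2) a(2) that by (auto simp: gen_rows_def)
  have v: "word_prod s (vertex (R ! h)) ((signed_gens s ! a) i) = v i" for i
    unfolding v_def child R_def word_prod_snoc by simp
  have v_perm: "v permutes {1..n}" unfolding v_def by (rule vertex_prod_permutes)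
  note v_le = permutes_le[OF v_perm]
  note fit0 = row_index_fits[OF bounds(2), of 0]
  have aW: "a < W" using letter_sums_fit(3)[of a] a(2) by simp
  show ?thesis
    unfolding append_row_def v_def[symmetric]
    apply (rule wp_seq, rule wp_assign)
    subgoal using fit0 row_index_fits[OF bounds(1), of 0] by (simp flip: N_def)
    apply (rule wp_seq, rule wp_assign)
    subgoal using fit0 by (simp add: inp flip: N_def)
    apply (rule wp_seq)
    apply (rule wp_for[where H = "Suc n" and I = "\<lambda>i \<tau> t'.
        (\<forall>q\<le>N. \<forall>j\<le>n. mem \<tau> Prod (q * Suc n + j) = mem \<sigma> Prod (q * Suc n + j)) \<and>
        (\<forall>j<i. mem \<tau> Prod (Suc N * Suc n + j) = v j) \<and> t' \<le> t + 30 + 40 * i"])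
    apply (simp_all)[5]
    subgoal by (simp add: frame_def inp)
    subgoal premises prems for i \<tau> t'
    proof -
      have i: "i \<le> n" using prems(1) by simp
      have reg: "regs \<tau> Deg = n" "regs \<tau> Base = Suc N * Suc n" "regs \<tau> Head = h" "regs \<tau> Ltr
        = a" "regs \<tau> Pos = i"
        "mem \<tau> Gen = mem \<sigma> Gen"
        using prems(4,5) inp h a by (auto simp: frame_def N_def)
      let ?x = "(signed_gens s ! a) i"
      have src: "mem \<tau> Prod (h * Suc n + ?x) = v i"
        using prems(3) R(3) g_le[OF i] old[OF R(3) g_le[OF i]] v by simp
      define \<tau>' where "\<tau>' = \<tau>\<lparr>mem := (mem \<tau>)(Prod := (mem \<tau> Prod)(Suc N * Suc n + i := v i))\<rparr>"
      have post: "(\<forall>q\<le>N. \<forall>j\<le>n. mem \<tau>' Prod (q * Suc n + j) = mem \<sigma> Prod (q * Suc n + j)) \<and>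
        (\<forall>j<Suc i. mem \<tau>' Prod (Suc N * Suc n + j) = v j)"
      proof (intro conjI allI impI)
        fix q j assume qj: "q \<le> N" "j \<le> n"
        \<comment> \<open>distinct rows do not overlap\<close>
        then have "q * Suc n + j \<noteq> Suc N * Suc n + i" using row_eq_iff[of j i q "Suc N"] i by auto
        then show "mem \<tau>' Prod (q * Suc n + j) = mem \<sigma> Prod (q * Suc n + j)"
          using prems(3) qj by (simp add: \<tau>'_def del: mult_Suc)
      next
        fix j assume "j < Suc i"
        then show "mem \<tau>' Prod (Suc N * Suc n + j) = v j"
          using prems(3) by (simp add: \<tau>'_def less_Suc_eq del: mult_Suc) auto
      qed
      have "wp W M (Prod\<lbrakk>Reg Base \<^bold>+ Reg Pos\<rbrakk> ::=
               Cell Prod (Reg Head \<^bold>* width \<^bold>+ Cell Gen (Reg Ltr \<^bold>* width \<^bold>+ Reg Pos)))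
          (\<lambda>\<rho> t''. \<rho> = \<tau>' \<and> t'' \<le> T + 25) \<tau> T" for T
        apply (rule wp_store)
        using row_index_fits[OF bounds(2) i] row_index_fits[OF bounds(3) g_le[OF i]] index_parts_fit[OF
          a(2) i]
          gen_index_fits[OF a(2) i] le_fits[OF i] le_fits[OF g_le[OF i]] le_fits[OF v_le[OF i]]
        by (simp_all add: reg gen[OF i] src \<tau>'_def del: mult_Suc)
      then show ?thesis
      proof (rule wp_conseq)
        fix \<rho> t'' assume \<rho>: "\<rho> = \<tau>' \<and> t'' \<le> t' + (cost width + 3) + 25"
        have "regs \<rho> Pos = i" using \<rho> reg by (simp add: \<tau>'_def)
        then show "regs \<rho> Pos = i \<and> (\<forall>q\<le>N. \<forall>j\<le>n. mem (\<rho>\<lparr>regs := (regs \<rho>)(Pos := Suc i)\<rparr>) Prod (q * Suc n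
          + j) = mem \<sigma> Prod (q * Suc n + j)) \<and>
          (\<forall>j<Suc i. mem (\<rho>\<lparr>regs := (regs \<rho>)(Pos := Suc i)\<rparr>) Prod (Suc N * Suc n + j) = v j) \<and> t'' + 4
            \<le> t + 30 + 40 * Suc i"
          using post \<rho> prems(3) by (simp del: mult_Suc)
      qed
    qed
    subgoal premises prems for \<tau> t'
    proof -
      have reg: "regs \<tau> Deg = n" "regs \<tau> NGen = k" "regs \<tau> Cyc = target_length s" "regs \<tau> Base
        = Suc N * Suc n"
        "regs \<tau> Head = h" "regs \<tau> Ltr = a" "regs \<tau> Num = Suc N" "mem \<tau> Gen = mem \<sigma> Gen"
        "mem \<tau> Last = mem \<sigma> Last" "mem \<tau> Parent = mem \<sigma> Parent"
        using prems(2,3) inp h a by (auto simp: frame_def N_def)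
      define \<tau>' where "\<tau>' = \<tau>\<lparr>mem := (mem \<tau>)(Parent := (mem \<sigma> Parent)(Suc N := h), Last := (mem \<sigma>
        Last)(Suc N := a))\<rparr>"
      have rows': "rows_ok \<tau>' (Suc J)"
        apply (rule rows_ok_Suc[OF rows red child a(2) h(2)])
        using prems(1) reg by (simp_all add: \<tau>'_def v_def flip: N_def del: bfs_word.simps mult_Suc)
      have inp': "inputs \<tau>'" "regs \<tau>' Cyc = target_length s" by (simp_all add: \<tau>'_def inputs_def reg)
      have row': "prod_row \<tau>' v"
        using prems(1) reg row_index_fits[OF bounds(2), of n]
          by (simp add: prod_row_def \<tau>'_def del: mult_Suc)
      have "wp W M (Parent\<lbrakk>Reg Num\<rbrakk> ::= Reg Head;; (Last\<lbrakk>Reg Num\<rbrakk> ::= Reg Ltr;; find_power))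
        (\<lambda>\<rho> t''. power_found (target_length s) v (regs \<rho> Pow) \<and> frame find_power \<tau>' \<rho> \<and> t''
          \<le> T + 10 + 300 * Suc n) \<tau> T" for T
        apply (rule wp_seq, rule wp_store)
        subgoal using fit0 by (simp add: reg)
        subgoal using fit0 by (simp add: reg)
        subgoal using row_index_fits[OF bounds(3), of 0] by (simp add: reg)
        apply (rule wp_seq, rule wp_store)
        subgoal using fit0 by (simp add: reg)
        subgoal using fit0 by (simp add: reg)
        subgoal using aW by (simp add: reg)
        apply (rule wp_conseq[where P = "\<lambda>\<rho> t''. power_found (target_length s) v (regs \<rho> Pow)
          \<and> frame find_power \<tau>' \<rho> \<and> t'' \<le> T + 6 + 300 * Suc n"])
        subgoal premises goal
        proof -
          have eq: "\<tau>\<lparr>mem := (mem \<tau>)(Parent := (mem \<tau> Parent)(val (Reg Num) \<tau> := val (Reg Head) \<tau>))\<rparr>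
             \<lparr>mem := (mem (\<tau>\<lparr>mem := (mem \<tau>)(Parent := (mem \<tau> Parent)(val (Reg Num) \<tau> := val (Reg Head)
               \<tau>))\<rparr>))
               (Last := (mem (\<tau>\<lparr>mem := (mem \<tau>)(Parent := (mem \<tau> Parent)(val (Reg Num) \<tau> := val (Reg Head)
                 \<tau>))\<rparr>) Last)
                 (val (Reg Num) (\<tau>\<lparr>mem := (mem \<tau>)(Parent := (mem \<tau> Parent)(val (Reg Num) \<tau> := val (Reg
                   Head) \<tau>))\<rparr>) :=
                  val (Reg Ltr) (\<tau>\<lparr>mem := (mem \<tau>)(Parent := (mem \<tau> Parent)(val (Reg Num) \<tau> := val (Reg
                    Head) \<tau>))\<rparr>)))\<rparr> = \<tau>'"
            by (simp add: \<tau>'_def reg)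
          show ?thesis
            unfolding eq
            apply (rule wp_conseq[OF wp_find_power[OF inp'(1) row' v_perm]])
            using target_length_prime inp'(2) by simp_all
        qed
        subgoal by simp
        done
      then show ?thesis
      proof (rule wp_conseq)
        fix \<rho> t'' assume \<rho>: "power_found (target_length s) v (regs \<rho> Pow) \<and> frame find_power \<tau>' \<rho> \<and>
          t'' \<le> t' + (cost width + 3) + 10 + 300 * Suc n"
        then have fr: "regs \<rho> Num = regs \<tau>' Num" "regs \<rho> Base = regs \<tau>' Base" "mem \<rho> Prod = mem \<tau>' Prod"
          "mem \<rho> Last = mem \<tau>' Last" "mem \<rho> Parent = mem \<tau>' Parent"
          by (simp_all add: frame_def find_power_def)
        have "rows_ok \<rho> (Suc J)" using rows' by (simp add: rows_ok_def fr del: bfs_word.simps)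
        moreover have "prod_row \<rho> v" using row' by (simp add: prod_row_def fr)
        moreover have "t'' \<le> t + 400 * Suc n" using \<rho> prems(1) n_ge_2 by simp
        ultimately show "rows_ok \<rho> (Suc J) \<and> prod_row \<rho> v \<and> power_found (target_length s) v (regs \<rho> Pow)
          \<and> t'' \<le> t + 400 * Suc n"
          using \<rho> by blast
      qed
    qed
    done
qed

definition search_body :: com where
  "search_body = (IF Reg Ltr \<^bold>= num_letters THEN (
         Head ::= Reg Head \<^bold>+ Lit 1;;
         Ltr ::= Lit 0)
       ELSE (
         IF Reg Head \<^bold>= Lit 0 \<^bold>\<or>
            \<^bold>\<not> (Reg Ltr \<^bold>= (Cell Last (Reg Head) \<^bold>+ Reg NGen) MOD num_letters)
         THEN append_row ELSE Skip;;
         Ltr ::= Reg Ltr \<^bold>+ Lit 1))"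

text \<open>
  The head of the queue is the word with index \<open>u\<close>, and its first \<open>a\<close> children have been considered. Those
  end at index \<open>J = u * (2 * k) + a\<close>.
\<close>

definition search_inv :: "state \<Rightarrow> nat \<Rightarrow> nat \<Rightarrow> nat \<Rightarrow> bool" where
  "search_inv \<tau> u a h \<longleftrightarrow> (let J = u * (2 * k) + a in
     regs \<tau> Head = h \<and> regs \<tau> Ltr = a \<and> a \<le> 2 * k \<and>
     h < length (reduced_indices k J) \<and> reduced_indices k J ! h = u \<and> rows_ok \<tau> J \<and>
     (if regs \<tau> Pow = 0 then J < r
      else J = r \<and> prod_row \<tau> (word_prod s (vertex r)) \<and>
        power_found (target_length s) (word_prod s (vertex r)) (regs \<tau> Pow)))"

text \<open>
  The index \<open>J\<close> may jump ahead to just before the first child of the next head, without missing the hit: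
  no reduced word is skipped.
\<close>

lemma search_inv_advance_head:
  assumes inv: "search_inv \<tau> u (2 * k) h" and pow: "regs \<tau> Pow = 0"
    and \<tau>': "regs \<tau>' Head = Suc h" "regs \<tau>' Ltr = 0" "regs \<tau>' Pow = 0" "regs \<tau>' Num = regs \<tau> Num" "mem \<tau>'
      = mem \<tau>"
  shows "\<exists>u'. search_inv \<tau>' u' 0 (Suc h) \<and> u * (2 * k) + 2 * k \<le> u' * (2 * k)"
proof -
  let ?J = "u * (2 * k) + 2 * k"
  define u' where "u' = reduced_indices k ?J ! Suc h"
  have h: "h < length (reduced_indices k ?J)" "reduced_indices k ?J ! h = u" "rows_ok \<tau> ?J" "?J < r"
    using inv pow by (simp_all add: search_inv_def Let_def)
  note nh = reduced_indices_next[OF k_ge_2 h(1,2) refl, folded u'_def]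
  have "r \<notin> set (reduced_indices k ?J)" using h(4) by (simp add: set_reduced_indices)
  then have "r \<notin> set (reduced_indices k (u' * (2 * k)))" using nh(3) by simp
  then have "u' * (2 * k) < r" using hit by (simp add: set_reduced_indices hits_iff)
  moreover have "rows_ok \<tau>' (u' * (2 * k))" using h(3)
    by (simp add: rows_ok_def nh(3) \<tau>' del: bfs_word.simps)
  ultimately have "search_inv \<tau>' u' 0 (Suc h)"
    using nh(1) by (simp add: search_inv_def \<tau>' nh(3)) (simp add: u'_def)
  then show ?thesis using nh(2) by blast
qed

lemma search_inv_advance_letter:
  assumes inv: "search_inv \<tau> u a h" and pow: "regs \<tau> Pow = 0" and a: "a < 2 * k"
    and rows: "rows_ok \<tau>' (Suc (u * (2 * k) + a))"
    and found: "if freely_reduced k (vertex (Suc (u * (2 * k) + a)))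
      then prod_row \<tau>' (word_prod s (vertex (Suc (u * (2 * k) + a)))) \<and>
        power_found (target_length s) (word_prod s (vertex (Suc (u * (2 * k) + a)))) (regs \<tau>' Pow)
      else regs \<tau>' Pow = 0"
    and \<tau>': "regs \<tau>' Head = h" "regs \<tau>' Ltr = Suc a"
  shows "search_inv \<tau>' u (Suc a) h"
proof -
  define J where "J = u * (2 * k) + a"
  have h: "h < length (reduced_indices k J)" "reduced_indices k J ! h = u" "J < r"
    using inv pow by (simp_all add: search_inv_def Let_def J_def)
  have "h < length (reduced_indices k (Suc J))" "reduced_indices k (Suc J) ! h = u"
    using h(1,2) by (simp_all add: reduced_indices_Suc nth_append del: bfs_word.simps)
  moreover have "if regs \<tau>' Pow = 0 then Suc J < r
      else Suc J = r \<and> prod_row \<tau>' (word_prod s (vertex r)) \<and>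
        power_found (target_length s) (word_prod s (vertex r)) (regs \<tau>' Pow)"
  proof (cases "regs \<tau>' Pow = 0")
    case True
    then have "\<not> hits n s (Suc J)"
      using found power_found_iff[of "Suc J" "regs \<tau>' Pow"] unfolding J_def[symmetric]
      by (auto simp: hits_iff simp del: bfs_word.simps split: if_splits)
    then have "Suc J \<noteq> r" using hit by blast
    then show ?thesis using True h(3) by simp
  next
    case False
    then have red: "freely_reduced k (vertex (Suc J))" using found unfolding J_def[symmetric]
      by (simp split: if_splits del: bfs_word.simps)
    then have f: "prod_row \<tau>' (word_prod s (vertex (Suc J)))"
      "power_found (target_length s) (word_prod s (vertex (Suc J))) (regs \<tau>' Pow)"
      using found unfolding J_def[symmetric] by (simp_all del: bfs_word.simps)
    have "hits n s (Suc J)" using power_found_iff[OF f(2) red] False by blast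
    then have "Suc J = r" using first_hit[of "Suc J"] h(3) by (cases "Suc J < r") auto
    then show ?thesis using False f by (simp del: bfs_word.simps)
  qed
  ultimately show ?thesis
    using a rows unfolding search_inv_def Let_def by (simp add: \<tau>' del: bfs_word.simps flip: J_def)
qed

text \<open>
  Each round advances the head or considers one more word, so \<open>J + h\<close> increases, where \<open>h\<close> is the row of
  the head. As \<open>h \<le> J \<le> r\<close>, there are at most \<open>2 * r\<close> rounds.
\<close>

lemma wp_search_loop:
  assumes "ready \<sigma>" "search_inv \<sigma> 0 0 0"
  shows "wp W M (WHILE \<^bold>\<not> Reg Pow DO search_body)
     (\<lambda>\<tau> t'. ready \<tau> \<and> rows_ok \<tau> r \<and> prod_row \<tau> (word_prod s (vertex r)) \<and>
       power_found (target_length s) (word_prod s (vertex r)) (regs \<tau> Pow) \<and> regs \<tau> Pow \<noteq> 0 \<and>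
       t' \<le> t + 10 + 1000 * (Suc n * r)) \<sigma> t"
proof -
  define I where "I m \<tau> t' \<longleftrightarrow> (\<exists>u a h. search_inv \<tau> u a h \<and> m = 2 * r - (u * (2 * k) + a + h) \<and>
    t' \<le> t + 500 * (Suc n * (u * (2 * k) + a + h)))" for m :: nat and \<tau> :: state and t'
  have keep: "ready \<tau>" if "frame search_body \<sigma> \<tau>" for \<tau>
    using that assms(1) by (auto simp: ready_def inputs_def frame_def search_body_def append_row_def
      find_power_def)
  have inv_bounds: "u * (2 * k) + a \<le> r" "h \<le> u * (2 * k) + a" if "search_inv \<tau> u a h" for \<tau> u a h
    using that length_reduced_indices[of k "u * (2 * k) + a"]
    by (auto simp: search_inv_def Let_def split: if_splits)
  show ?thesis
  proof (rule wp_while_variant[where I = I and m = "2 * r"])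
    show "I (2 * r) \<sigma> t" unfolding I_def using assms(2) by (intro exI[of _ 0]) simp
    show "safe W M (\<^bold>\<not> Reg Pow) \<tau>" if "I m \<tau> t'" for m \<tau> t'
      using that le_fits(2) by (auto simp: I_def search_inv_def Let_def power_found_def split: if_splits)
    show "ready \<tau> \<and> rows_ok \<tau> r \<and> prod_row \<tau> (word_prod s (vertex r)) \<and>
       power_found (target_length s) (word_prod s (vertex r)) (regs \<tau> Pow) \<and> regs \<tau> Pow \<noteq> 0 \<and>
       t' + (cost (\<^bold>\<not> Reg Pow) + 1) \<le> t + 10 + 1000 * (Suc n * r)"
      if Im: "I m \<tau> t'" and fr: "frame search_body \<sigma> \<tau>" and cond: "val (\<^bold>\<not> Reg Pow) \<tau> = 0" for m \<tau> t'
    proof -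
      have pow: "regs \<tau> Pow \<noteq> 0" using cond by (simp split: if_splits)
      obtain u a h where inv: "search_inv \<tau> u a h"
        and t': "t' \<le> t + 500 * (Suc n * (u * (2 * k) + a + h))"
        using Im unfolding I_def by blast
      have "Suc n * (u * (2 * k) + a + h) \<le> Suc n * (2 * r)" using inv_bounds[OF inv]
        by (intro mult_le_mono2) linarith
      then have "t' + 4 \<le> t + 10 + 1000 * (Suc n * r)" using t' by simp
      then show ?thesis using inv pow keep[OF fr] by (auto simp: search_inv_def Let_def)
    qed
    show "wp W M search_body (\<lambda>\<tau>' t''. \<exists>m'<m. I m' \<tau>' t'') \<tau> (t' + (cost (\<^bold>\<not> Reg Pow) + 1))"
      if Im: "I m \<tau> t'" and fr: "frame search_body \<sigma> \<tau>" and cond: "val (\<^bold>\<not> Reg Pow) \<tau> \<noteq> 0" for m \<tau> t'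
    proof -
      have pow: "regs \<tau> Pow = 0" using cond by (simp split: if_splits)
      obtain u a h where inv: "search_inv \<tau> u a h" and m: "m = 2 * r - (u * (2 * k) + a + h)"
        and t': "t' \<le> t + 500 * (Suc n * (u * (2 * k) + a + h))"
        using Im unfolding I_def by blast
      define J where "J = u * (2 * k) + a"
      have reg: "regs \<tau> Head = h" "regs \<tau> Ltr = a" "a \<le> 2 * k" "h < length (reduced_indices k J)"
          "reduced_indices k J ! h = u" "rows_ok \<tau> J" "J < r"
        using inv pow by (auto simp: search_inv_def Let_def J_def)
      have rdy: "ready \<tau>" using keep[OF fr] .
      have NGen: "regs \<tau> NGen = k" using rdy by (simp add: ready_def inputs_def)
      have hJ: "h \<le> J" using inv_bounds[OF inv] by (simp add: J_def)
      have aW: "a < W" "Suc a < W" using letter_sums_fit(2,3)[of a] reg(3) by auto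
      have bounds: "h \<le> n\<^sup>2" "Suc h \<le> n\<^sup>2" "Suc J \<le> n\<^sup>2" using hJ reg(7) r_le by auto
      note h_fit = row_index_fits(4,5)[OF bounds(1), of 0, simplified] row_index_fits(5)[OF bounds(2), of
        0, simplified]
      \<comment> \<open>one round costs at most 500 * Suc n units\<close>
      have continue: "\<exists>m'<m. I m' \<rho> t''"
        if "search_inv \<rho> u' a' h'" "J + h < u' * (2 * k) + a' + h'" "t'' \<le> t' + 500 * Suc n"
          for \<rho> t'' u' a' h'
      proof (intro exI[of _ "2 * r - (u' * (2 * k) + a' + h')"] conjI)
        have "u' * (2 * k) + a' + h' \<le> 2 * r" using inv_bounds[OF that(1)] by linarith
        then show "2 * r - (u' * (2 * k) + a' + h') < m" using that(2) unfolding m J_def[symmetric]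
          by linarith
        have "Suc n * Suc (J + h) \<le> Suc n * (u' * (2 * k) + a' + h')" using that(2)
          by (intro mult_le_mono2) simp
        then have "t'' \<le> t + 500 * (Suc n * (u' * (2 * k) + a' + h'))"
          using t' that(3) unfolding J_def[symmetric] by (simp only: mult_Suc_right)
        then show "I (2 * r - (u' * (2 * k) + a' + h')) \<rho> t''" unfolding I_def using that(1) by blast
      qed
      have time: "30 \<le> 500 * Suc n" by simp
      show ?thesis
        unfolding search_body_def
        apply (rule wp_if)
        subgoal using aW NGen by (simp add: reg)
        subgoal premises if1
        proof -
          have a: "a = 2 * k" using if1 by (simp add: reg NGen split: if_splits)
          define \<tau>' where "\<tau>' = \<tau>\<lparr>regs := (regs \<tau>)(Head := Suc h, Ltr := 0)\<rparr>"
          obtain u' where u': "search_inv \<tau>' u' 0 (Suc h)" "J \<le> u' * (2 * k)"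
            using search_inv_advance_head[of \<tau> u h \<tau>'] inv pow a by (auto simp: \<tau>'_def J_def)
          have "wp W M (Head ::= Reg Head \<^bold>+ Lit 1;; Ltr ::= Lit 0)
             (\<lambda>\<rho> t''. \<rho> = \<tau>' \<and> t'' \<le> T + 10) \<tau> T" for T
            apply (intro wp_seq wp_assign)
            using h_fit by (simp_all add: reg \<tau>'_def)
          then show ?thesis
            by (rule wp_conseq) (rule continue[where u' = u' and a' = 0 and h' = "Suc h"], use u' in
              simp_all)
        qed
        subgoal premises if1
        proof -
          have "a \<noteq> 2 * k" using if1 by (simp add: reg NGen split: if_splits)
          then have a: "a < 2 * k" using reg(3) by linarith
          have child: "vertex (Suc J) = vertex (reduced_indices k J ! h) @ [a]"
            using a by (simp add: J_def reg(5)[unfolded J_def] div_add1_eq)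
          have "u \<in> set (reduced_indices k J)" using reg(4,5) nth_mem by metis
          then have red_u: "freely_reduced k (vertex u)" by (simp add: set_reduced_indices)
          have last: "mem \<tau> Last h < 2 * k" "h \<noteq> 0 \<Longrightarrow> vertex u \<noteq> [] \<and> last (vertex u) = mem \<tau> Last h"
            using reg(4-6) by (cases "h = 0"; auto simp: rows_ok_def Let_def simp del: bfs_word.simps)+
          \<comment> \<open>for \<open>h = 0\<close> the parent is the empty word, which every letter extends\<close>
          have red_iff: "freely_reduced k (vertex (Suc J)) \<longleftrightarrow> h = 0 \<or> a \<noteq> inv_letter k (mem \<tau> Last h)"
          proof (cases "h = 0")
            case True
            then have "u = 0" using reg(5) reduced_indices_nth_0 by simp
            then show ?thesis unfolding child reg(5) freely_reduced_snoc using True red_u by simp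
          next
            case False
            then show ?thesis unfolding child reg(5) freely_reduced_snoc using last(2) red_u by simp
          qed
          have lW: "mem \<tau> Last h < W" "mem \<tau> Last h + k < W" "inv_letter k (mem \<tau> Last h) < W"
            using last(1) letter_sums_fit(1,3)[of "mem \<tau> Last h"] letter_sums_fit(3)[of
              "inv_letter k (mem \<tau> Last h)"]
              inv_letter_less[of k "mem \<tau> Last h"] k_ge_2 by auto
          have fin: "wp W M (Ltr ::= Reg Ltr \<^bold>+ Lit 1) (\<lambda>\<tau>' t''. \<exists>m'<m. I m' \<tau>' t'') \<rho> T"
            if \<rho>: "regs \<rho> Head = h" "regs \<rho> Ltr = a" "rows_ok \<rho> (Suc J)" and T: "T
              \<le> t' + 40 + 400 * Suc n"
              and found: "if freely_reduced k (vertex (Suc J))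
                then prod_row \<rho> (word_prod s (vertex (Suc J))) \<and>
                  power_found (target_length s) (word_prod s (vertex (Suc J))) (regs \<rho> Pow)
                else regs \<rho> Pow = 0" for \<rho> T
          proof -
            define \<rho>' where "\<rho>' = \<rho>\<lparr>regs := (regs \<rho>)(Ltr := Suc a)\<rparr>"
            have "search_inv \<rho>' u (Suc a) h"
            proof (rule search_inv_advance_letter[OF inv pow a, folded J_def])
              show "rows_ok \<rho>' (Suc J)" using \<rho>(3) by (simp add: rows_ok_def \<rho>'_def del: bfs_word.simps)
              show "if freely_reduced k (vertex (Suc J)) then prod_row \<rho>' (word_prod s (vertex (Suc J)))
                \<and>
                  power_found (target_length s) (word_prod s (vertex (Suc J))) (regs \<rho>' Pow)
                else regs \<rho>' Pow = 0" using found
                  by (auto simp: prod_row_def \<rho>'_def simp del: bfs_word.simps split: if_splits)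
            qed (use \<rho> in \<open>simp_all add: \<rho>'_def\<close>)
            then have post: "\<exists>m'<m. I m' \<rho>' t''" if "t'' \<le> t' + 500 * Suc n" for t''
              using that by (intro continue[of \<rho>' u "Suc a" h]) (simp_all add: J_def)
            have "T + 4 \<le> t' + 500 * Suc n" using T n_ge_2 by simp
            note post = post[OF this]
            have "wp W M (Ltr ::= Reg Ltr \<^bold>+ Lit 1) (\<lambda>\<tau>' t''. \<tau>' = \<rho>' \<and> t'' = T + 4) \<rho> T"
              by (rule wp_assign) (use aW in \<open>simp_all add: \<rho> \<rho>'_def\<close>)
            then show ?thesis by (rule wp_conseq) (use post in simp)
          qed
          show ?thesis
            apply (rule wp_seq, rule wp_if)
            subgoal using h_fit aW lW by (simp add: reg NGen mod_inv_letter)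
            subgoal premises if2
            proof -
              have red: "freely_reduced k (vertex (Suc J))"
                using if2 unfolding red_iff by (simp add: reg NGen mod_inv_letter split: if_splits)
              show ?thesis
                apply (rule wp_conseq[OF wp_append_row[OF rdy reg(6) reg(1) reg(4) reg(2) a child red
                  bounds(3)]])
                apply (rule fin)
                using reg red by (simp_all add: frame_def append_row_def find_power_def del:
                  bfs_word.simps)
            qed
            subgoal premises if2
            proof -
              have red: "\<not> freely_reduced k (vertex (Suc J))"
                using if2 unfolding red_iff by (simp add: reg NGen mod_inv_letter split: if_splits)
              have "rows_ok \<tau> (Suc J)" using reg(6) red
                by (simp add: rows_ok_def reduced_indices_Suc del: bfs_word.simps)
              then show ?thesis
                apply (intro wp_skip fin)
                using reg red pow by (simp_all del: bfs_word.simps)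
            qed
            done
        qed
        done
    qed
  qed
qed

text \<open>
  Following the parents spells the word from its last letter to its first. The part read so far
  completes the word of the current row to the selected word.
\<close>

lemma wp_read_word:
  assumes rows: "rows_ok \<sigma> r" and start: "regs \<sigma> Head = regs \<sigma> Num" "regs \<sigma> WLen = 0"
  shows "wp W M (WHILE Reg Head DO (
       Word\<lbrakk>Reg WLen\<rbrakk> ::= Cell Last (Reg Head);;
       WLen ::= Reg WLen \<^bold>+ Lit 1;;
       Head ::= Cell Parent (Reg Head)))
     (\<lambda>\<tau> t'. output_word \<tau> = vertex r \<and> t' \<le> t + 10 + 40 * l) \<sigma> t"
proof -
  define R where "R = reduced_indices k r"
  define N where "N = regs \<sigma> Num"
  have R: "length R = Suc N" using rows by (simp add: rows_ok_def Let_def R_def N_def)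
  have tree: "mem \<sigma> Last q < 2 * k" "mem \<sigma> Parent q < q"
        "vertex (R ! q) = vertex (R ! mem \<sigma> Parent q) @ [mem \<sigma> Last q]" if "q \<le> N" "0 < q" for q
    using rows that R by (simp_all add: rows_ok_def Let_def less_Suc_eq_le flip: R_def del:
      bfs_word.simps)
  obtain r' where r': "r = Suc r'" using r_pos by (cases r) auto
  have "R = reduced_indices k r' @ [r]"
    using hit by (simp add: R_def r' reduced_indices_Suc hits_iff del: bfs_word.simps)
  then have RN: "R ! N = r" using R by (metis length_append_singleton nat.inject nth_append_length)
  have N: "N \<le> n\<^sup>2" using R length_reduced_indices[of k r] r_le by (simp add: R_def)
  define I where "I m \<tau> t' \<longleftrightarrow> regs \<tau> Head = m \<and> m \<le> N \<and> t' \<le> t + 40 * regs \<tau> WLen \<and>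
    vertex (R ! m) @ rev (map (mem \<tau> Word) [0..<regs \<tau> WLen]) = vertex r"
      for m :: nat and \<tau> :: state and t'
  let ?body = "Word\<lbrakk>Reg WLen\<rbrakk> ::= Cell Last (Reg Head);; WLen ::= Reg WLen \<^bold>+ Lit 1;;
    Head ::= Cell Parent (Reg Head)"
  have len: "length (vertex (R ! m)) + regs \<tau> WLen \<le> l" if "I m \<tau> t'" for m \<tau> t'
  proof -
    have "length (vertex (R ! m) @ rev (map (mem \<tau> Word) [0..<regs \<tau> WLen])) = length (vertex r)"
      using that by (simp only: I_def)
    then show ?thesis using word_length[of r] by simp
  qed
  show ?thesis
  proof (rule wp_while_variant[where I = I and m = N])
    show "I N \<sigma> t" by (simp add: I_def start N_def[symmetric] RN)
    show "safe W M (Reg Head) \<tau>" if "I m \<tau> t'" for m \<tau> t'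
      using that N row_index_fits(5)[of m 0] by (simp add: I_def)
    show "output_word \<tau> = vertex r \<and> t' + (cost (Reg Head) + 1) \<le> t + 10 + 40 * l"
      if "I m \<tau> t'" "val (Reg Head) \<tau> = 0" for m \<tau> t'
      using that len[OF that(1)] by (auto simp: I_def output_word_def R_def reduced_indices_nth_0)
    show "wp W M ?body (\<lambda>\<tau>' t''. \<exists>m'<m. I m' \<tau>' t'') \<tau> (t' + (cost (Reg Head) + 1))"
      if Im: "I m \<tau> t'" and fr: "frame ?body \<sigma> \<tau>" and cond: "val (Reg Head) \<tau> \<noteq> 0" for m \<tau> t'
    proof -
      have head: "regs \<tau> Head = m" "m \<le> N" "0 < m" and t': "t' \<le> t + 40 * regs \<tau> WLen"
        and word: "vertex (R ! m) @ rev (map (mem \<tau> Word) [0..<regs \<tau> WLen]) = vertex r"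
        using Im cond by (auto simp: I_def)
      define L where "L = regs \<tau> WLen"
      have mem: "mem \<tau> Last = mem \<sigma> Last" "mem \<tau> Parent = mem \<sigma> Parent" using fr
        by (auto simp: frame_def)
      note tr = tree[OF head(2,3)]
      define \<tau>' where "\<tau>' = \<tau>\<lparr>regs := (regs \<tau>)(WLen := Suc L, Head := mem \<sigma> Parent m),
        mem := (mem \<tau>)(Word := (mem \<tau> Word)(L := mem \<sigma> Last m))\<rparr>"
      have "I (mem \<sigma> Parent m) \<tau>' t''" if "t'' \<le> t' + 40" for t''
      proof -
        have "map (mem \<tau>' Word) [0..<L] = map (mem \<tau> Word) [0..<L]" by (simp add: \<tau>'_def)
        then have "vertex (R ! mem \<sigma> Parent m) @ rev (map (mem \<tau>' Word) [0..<regs \<tau>' WLen]) = vertex r"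
          using word tr(3) by (simp add: \<tau>'_def L_def del: bfs_word.simps)
        then show ?thesis using that t' tr(2) head by (simp add: I_def) (simp add: \<tau>'_def L_def)
      qed
      then have post: "\<exists>m'<m. I m' \<tau>' t''" if "t'' \<le> t' + 40" for t'' using that tr(2) by blast
      have "Suc L \<le> l" using len[OF Im] tr(3) by (simp add: L_def del: bfs_word.simps)
      then have LM: "L < M" "L < W" "Suc L < W" using l_fits fits by linarith+
      have m: "m < M" "m < W" "mem \<sigma> Parent m < W"
        using row_index_fits(4,5)[of m 0] row_index_fits(5)[of "mem \<sigma> Parent m" 0] head(2) N tr(2)
          by auto
      have "wp W M ?body (\<lambda>\<rho> t''. \<rho> = \<tau>' \<and> t'' \<le> T + 20) \<tau> T" for T
        apply (intro wp_seq wp_store wp_assign)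
        using LM m letter_sums_fit(3)[of "mem \<sigma> Last m"] tr(1) by (simp_all add: head mem \<tau>'_def L_def)
      then show ?thesis by (rule wp_conseq) (use post in simp)
    qed
  qed
qed

lemma wp_stored_step1:
  "wp W M stored_step1 (\<lambda>\<tau> t'. finished \<tau> \<and>
     t' \<le> 300 * (k * Suc n) + 60 * (Suc n * Suc n) + 30 * Suc n + 1000 * (Suc n * r) + 40 * l + 100)
       (input_state n s) 0"
  unfolding stored_step1_def append_row_def[symmetric] search_body_def[symmetric]
  apply (rule wp_setup[OF input_state_ok(1,2)])
  subgoal premises prems for \<tau> t
  proof -
    have reg: "regs \<tau> Deg = n" "regs \<tau> NGen = k" using prems(1) by (auto simp: ready_def inputs_def)
    show ?thesis
      apply (rule wp_seq)
      apply (rule wp_for[where H = "Suc n" and I = "\<lambda>i \<rho> t'. (\<forall>j<i. mem \<rho> Prod j = j) \<and> t'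
        \<le> t + 3 + 20 * i"])
      apply (simp_all)[5]
      subgoal by (simp add: frame_def reg)
      subgoal premises prems2 for i \<rho> t'
        apply (rule wp_store)
        using prems2 le_fits[of i] by (auto simp: less_Suc_eq)
      subgoal premises prems2 for \<rho> t'
      proof -
        have rdy: "ready \<rho>" using prems2(3) prems(1) by (auto simp: frame_def ready_def inputs_def)
        have last: "mem \<rho> Last 0 = 0" using prems2(3) prems(3)[of Last] input_state_ok(4)[of Last]
          by (simp add: frame_def)
        show ?thesis
          apply (rule wp_seq, rule wp_assign)
          subgoal by simp
          apply (rule wp_seq, rule wp_assign)
          subgoal by simp
          apply (rule wp_seq, rule wp_assign)
          subgoal by simp
          apply (rule wp_seq, rule wp_assign)
          subgoal by simp
          apply (rule wp_seq)
          apply (rule wp_conseq[OF wp_search_loop])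
          subgoal using rdy by (simp add: ready_def inputs_def)
          subgoal using last prems2(1) k_ge_2 r_pos
            by (simp add: search_inv_def rows_ok_def reduced_indices_0 word_prod_def)
          subgoal premises prems3 for \<tau>1 t1
          proof -
            have p1: "ready \<tau>1" "rows_ok \<tau>1 r" "prod_row \<tau>1 (word_prod s (vertex r))"
              "power_found (target_length s) (word_prod s (vertex r)) (regs \<tau>1 Pow)" "regs \<tau>1 Pow \<noteq> 0"
              and t1: "t1 \<le> t' + 30 + 1000 * (Suc n * r)"
              using prems3(1) by auto
            have pw: "regs \<tau>1 Pow \<in> {1..n}" "is_cycle (target_length s) (word_prod s (vertex r) ^^ regs
              \<tau>1 Pow)"
              using p1(4,5) by (auto simp: power_found_def)
            have inp: "inputs \<tau>1" using p1(1) by (simp add: ready_def)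
            have NW: "regs \<tau>1 Num < W"
              using p1(2) length_reduced_indices[of k r] r_le row_index_fits(5)[of "regs \<tau>1 Num" 0]
              by (simp add: rows_ok_def Let_def)
            show ?thesis
              apply (rule wp_seq)
              apply (rule wp_conseq[OF wp_compute_mu[OF inp p1(3) vertex_prod_permutes]])
              subgoal using pw by simp
              subgoal premises prems4 for \<tau>2 t2
              proof -
                have fr: "regs \<tau>2 Pow = regs \<tau>1 Pow" "regs \<tau>2 Num = regs \<tau>1 Num" "mem \<tau>2 Last
                  = mem \<tau>1 Last"
                    "mem \<tau>2 Parent = mem \<tau>1 Parent" "mem \<tau>2 Prod = mem \<tau>1 Prod"
                  using prems4(2) by (auto simp: frame_def compute_mu_def)
                show ?thesis
                  apply (rule wp_seq, rule wp_assign)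
                  subgoal using NW by (simp add: fr)
                  apply (rule wp_seq, rule wp_assign)
                  subgoal by simp
                  apply (rule wp_conseq[OF wp_read_word])
                  subgoal using p1(2) by (simp add: rows_ok_def fr del: bfs_word.simps)
                  apply (simp_all)[2]
                  subgoal premises prems5 for \<tau>3 t3
                  proof -
                    have "regs \<tau>3 Pow = regs \<tau>1 Pow" "mem \<tau>3 Mu = mem \<tau>2 Mu"
                      using prems5(2) fr by (auto simp: frame_def)
                    then show ?thesis
                      using prems5(1) prems4(1) pw t1 prems2(1) prems(2) by (simp add: finished_def)
                  qed
                  done
              qed
              done
          qed
          done
      qed
      done
  qed
  done

end

end

section \<open>From the conjecture to the complexity bounds\<close>

lemma length_concat_replicate: "length (concat (replicate m w)) = m * length w"
  by (induction m) simp_all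

context step1_search
begin

text \<open>
  The output expresses the cycle as the \<open>m\<close>-th power of a word of length at most \<open>l\<close>, where \<open>m \<le> n\<close>.
\<close>

lemma performs_step1_of_wp:
  assumes "wp W M prog (\<lambda>\<tau> t. finished \<tau> \<and> t \<le> B) (input_state n s) 0"
    and "real B \<le> T" "real (memory_size M) \<le> S" "real (n * l) \<le> L"
  shows "performs_step1 prog W T S L n s"
proof -
  obtain d \<tau> where exec: "exec W M prog (input_state n s) d \<tau>" and fin: "finished \<tau>" and d: "d \<le> B"
    using assms(1) by (auto simp: wp_def)
  define m where "m = regs \<tau> Pow"
  define u where "u = concat (replicate m (vertex r))"
  define \<mu> where "\<mu> = word_prod s (vertex r) ^^ m"
  have f: "output_word \<tau> = vertex r" "m \<in> {1..n}" "is_cycle (target_length s) \<mu>" "\<forall>i\<in>{1..n}. mem \<tau> Mu i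
    = \<mu> i"
    using fin by (auto simp: finished_def m_def \<mu>_def)
  have "step1_selects n s (bfs_word (2 * length s) r)"
  proof (rule step1_selectsI)
    show "\<not> is_cycle (target_length s) (word_prod s (bfs_word (2 * length s) i) ^^ m)"
      if "i < r" "freely_reduced (length s) (bfs_word (2 * length s) i)" "m \<in> {1..n}" for i m
      using first_hit[OF that(1)] that(2,3) by (auto simp: hits_def)
  qed (use hit r_pos length_s k_ge_2 in \<open>auto simp: hits_def\<close>)
  then have "step1_output n s \<tau> u \<mu>"
    using f by (auto simp: step1_output_def Let_def u_def \<mu>_def length_s simp flip: m_def)
  moreover have "set u \<subseteq> {..<2 * length s}"
  proof -
    have "set u \<subseteq> set (vertex r)" by (auto simp: u_def)
    also have "\<dots> \<subseteq> {..<2 * k}" by (rule bfs_word_letters[OF letters_pos])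
    finally show ?thesis by (simp add: length_s)
  qed
  moreover have "word_prod s u = \<mu>" by (simp add: u_def \<mu>_def word_prod_replicate)
  moreover have "length u \<le> n * l"
    unfolding u_def length_concat_replicate using f(2) word_length[of r] by (intro mult_le_mono) auto
  then have "real (length u) \<le> L" using assms(4) of_nat_mono order_trans by blast
  moreover have "real d \<le> T" using d assms(2) by linarith
  ultimately show ?thesis
    unfolding performs_step1_def using exec f(3) assms(3) by blast
qed

end

lemma almost_always_mono:
  assumes "almost_always k P"
    and "eventually (\<lambda>n. \<forall>s\<in>set_pmf (random_gens k n). P n s \<longrightarrow> Q n s) sequentially"
  shows "almost_always k Q"
  unfolding almost_always_def
proof (rule tendsto_sandwich)
  show "(\<lambda>n. measure_pmf.prob (random_gens k n) {s. P n s}) \<longlonglongrightarrow> 1"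
    using assms(1) by (simp add: almost_always_def)
  show "\<forall>\<^sub>F n in sequentially. measure_pmf.prob (random_gens k n) {s. P n s}
    \<le> measure_pmf.prob (random_gens k n) {s. Q n s}"
    using assms(2) by eventually_elim (intro measure_pmf.finite_measure_mono_AE, auto simp:
      AE_measure_pmf_iff)
qed auto

lemma set_pmf_random_gens:
  "s \<in> set_pmf (random_gens k n) \<longleftrightarrow> length s = k \<and> (\<forall>p\<in>set s. p permutes {1..n})"
proof -
  have "finite {p. p permutes {1..n}}" by (rule finite_permutations) simp
  moreover have "{p. p permutes {1..n}} \<noteq> {}" using permutes_id by blast
  ultimately have "set_pmf (pmf_of_set {p. p permutes {1..n}}) = {p. p permutes {1..n}}" by simp
  then show ?thesis by (auto simp: random_gens_def set_replicate_pmf in_lists_conv_set)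
qed

text \<open>
  The word provided by the conjecture need not be reduced; its reduced form occurs no later in the list.
\<close>

lemma first_hit_exists:
  assumes s: "\<forall>p\<in>set s. p permutes {1..n}" and k: "length s = k" "k > 0"
    and ex: "\<exists>w\<in>set (first_words k (n\<^sup>2)). \<exists>m\<le>n. is_cycle (target_length s) (word_prod s w ^^ m)"
  obtains r where "hits n s r" "\<And>j. j < r \<Longrightarrow> \<not> hits n s j" "r \<le> n\<^sup>2"
proof -
  obtain i m where i: "i \<le> n\<^sup>2" "m \<le> n" "is_cycle (target_length s) (word_prod s (bfs_word (2 * k) i) ^^
    m)"
    using ex unfolding first_words_eq[OF k(2)] by (auto simp: less_Suc_eq_le simp del: upt_Suc)
  have "m \<noteq> 0"
  proof
    assume "m = 0"
    moreover have "target_length s \<ge> 2" by (simp add: target_length_def)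
    ultimately show False using i(3) not_is_cycle_id[of "target_length s"] by (simp add: id_def)
  qed
  moreover obtain j where "j \<le> i" "freely_reduced k (bfs_word (2 * k) j)"
      "word_prod s (bfs_word (2 * k) j) = word_prod s (bfs_word (2 * k) i)"
    using freely_reduced_bfs_word_exists[OF s, of i] k by auto
  ultimately have j: "hits n s j" "j \<le> n\<^sup>2"
    using i unfolding hits_def k(1) by (auto intro!: bexI[of _ m])
  show thesis
  proof (rule that)
    show "hits n s (LEAST j. hits n s j)" using j(1) by (rule LeastI)
    show "\<not> hits n s j" if "j < (LEAST j. hits n s j)" for j using that by (rule not_less_Least)
    show "(LEAST j. hits n s j) \<le> n\<^sup>2" using Least_le[of "hits n s", OF j(1)] j(2) by linarith
  qed
qed

text \<open>
  The words up to index \<open>n\<^sup>2\<close> have length at most \<open>log 2 (2 * n)\<close>, because \<open>4 ^ length \<le> 3 * n\<^sup>2 + 1\<close>.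
\<close>

definition max_word_length :: "nat \<Rightarrow> nat" where
  "max_word_length n = nat \<lfloor>log 2 (real (2 * n))\<rfloor>"

lemma length_bfs_word_le:
  assumes "b \<ge> 4" "j \<le> n\<^sup>2" "n > 0"
  shows "length (bfs_word b j) \<le> max_word_length n"
proof -
  let ?d = "length (bfs_word b j)"
  \<comment> \<open>\<open>3 * n\<^sup>2 + 1 \<le> (2 * n)\<^sup>2\<close>, so square roots can be taken\<close>
  have "(2 ^ ?d)\<^sup>2 = (4 :: nat) ^ ?d" by (simp add: power_mult[symmetric] mult.commute power_mult)
  also have "\<dots> \<le> 3 * n\<^sup>2 + 1" using four_power_length_bfs_word[OF assms(1), of j] assms(2) by linarith
  also have "\<dots> \<le> (2 * n)\<^sup>2" using assms(3) by (simp add: power_mult_distrib)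
  finally have "2 ^ ?d \<le> 2 * n" by (simp only: power2_nat_le_eq_le)
  then have "real (2 ^ ?d) \<le> real (2 * n)" by (simp only: of_nat_le_iff)
  then have "log 2 (2 ^ ?d) \<le> log 2 (real (2 * n))" using assms(3) by (subst log_le_cancel_iff) auto
  then have "real ?d \<le> log 2 (real (2 * n))" by simp
  then show ?thesis unfolding max_word_length_def by (simp add: le_nat_iff le_floor_iff)
qed

lemma max_word_length_le:
  assumes "n \<ge> 2"
  shows "max_word_length n \<le> 2 * n" "real (max_word_length n) \<le> 1 + log 2 (real n)"
proof -
  have "log 2 (real (2 * n)) = 1 + log 2 (real n)" using assms by (simp add: log_mult)
  moreover have "0 \<le> log 2 (real n)" using assms by simp
  ultimately show le: "real (max_word_length n) \<le> 1 + log 2 (real n)"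
    unfolding max_word_length_def by linarith
  have "log 2 (real n) \<le> real n"
  proof -
    have "real n \<le> 2 powr real n" using of_nat_mono[OF less_imp_le[OF less_exp[of n]], where 'a=real]
      by (simp add: powr_realpow)
    then show ?thesis using assms by (subst log_le_iff) auto
  qed
  then have "real (max_word_length n) \<le> real (2 * n)" using le assms by simp
  then show "max_word_length n \<le> 2 * n" by (simp only: of_nat_le_iff)
qed

text \<open>
  Room for the \<open>2 * k\<close> letters and for one row for each of the words up to index \<open>n\<^sup>2\<close>.
\<close>

definition rows_memory :: "nat \<Rightarrow> nat \<Rightarrow> nat" where
  "rows_memory k n = 2 * k * Suc n + Suc (n\<^sup>2) * Suc n"

definition word_size :: "nat \<Rightarrow> nat \<Rightarrow> nat" where
  "word_size k n = rows_memory k n + Suc n * Suc n + 1"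

lemma poly_le_cube:
  fixes n :: nat
  assumes "n \<ge> 2"
  shows "Suc n \<le> 2 * n ^ 3" "n \<le> n ^ 3" "Suc n * Suc n \<le> 4 * n ^ 3" "Suc n * n\<^sup>2 \<le> 2 * n ^ 3"
    "Suc (n\<^sup>2) * Suc n \<le> 4 * n ^ 3" "1 \<le> n ^ 3"
proof -
  have "n ^ 1 \<le> n ^ 3" "n ^ 2 \<le> n ^ 3" using assms by (intro power_increasing; simp)+
  then show n: "n \<le> n ^ 3" and "Suc n \<le> 2 * n ^ 3" "1 \<le> n ^ 3" using assms by simp_all
  have sn: "Suc n \<le> 2 * n" using assms by simp
  have "Suc n * Suc n \<le> (2 * n) * (2 * n)" using sn by (intro mult_le_mono)
  then show "Suc n * Suc n \<le> 4 * n ^ 3" using \<open>n ^ 2 \<le> n ^ 3\<close> by (simp add: power2_eq_square)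
  show "Suc n * n\<^sup>2 \<le> 2 * n ^ 3" using mult_le_mono1[OF sn, of "n\<^sup>2"]
    by (simp add: power2_eq_square power3_eq_cube)
  have "1 \<le> n\<^sup>2" using assms by (simp add: power2_eq_square)
  then have "Suc (n\<^sup>2) \<le> 2 * n\<^sup>2" by simp
  from mult_le_mono[OF this sn] show "Suc (n\<^sup>2) * Suc n \<le> 4 * n ^ 3"
    by (simp add: power2_eq_square power3_eq_cube)
qed

context
  fixes n k :: nat and s :: "(nat \<Rightarrow> nat) list" and r :: nat
  assumes n: "n \<ge> 2" and k: "k \<ge> 2" and s: "length s = k" "\<forall>p\<in>set s. p permutes {1..n}"
    and r: "hits n s r" "\<And>j. j < r \<Longrightarrow> \<not> hits n s j" "r \<le> n\<^sup>2"
begin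

lemma step1_search_intro:
  assumes "2 * k * Suc n \<le> M" "M \<le> word_size k n"
  shows "step1_search n k (word_size k n) M s r (max_word_length n)"
proof unfold_locales
  show "Suc n * Suc n < word_size k n" by (simp add: word_size_def)
  show "length (bfs_word (2 * k) j) \<le> max_word_length n" if "j \<le> r" for j
    using that r(3) n k by (intro length_bfs_word_le) auto
  have "Suc (max_word_length n) < 4 * Suc n" using max_word_length_le(1)[OF n] by simp
  also have "\<dots> \<le> 2 * k * Suc n" using k by (intro mult_le_mono1) simp
  also have "\<dots> \<le> M" by (rule assms(1))
  finally show "Suc (max_word_length n) < M" .
qed (use assms n k s r in auto)

lemma stored_performs:
  "performs_step1 stored_step1 (word_size k n) (real (600 * k + 2560) * real n ^ 3)
     (real (memory_size (rows_memory k n))) (real n * (2 * log 2 (real n))) n s"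
proof -
  interpret step1_search n k "word_size k n" "rows_memory k n" s r "max_word_length n"
    by (intro step1_search_intro) (simp_all add: rows_memory_def word_size_def)
  interpret step1_stored_search n k "word_size k n" "rows_memory k n" s r "max_word_length n"
    by unfold_locales (simp add: rows_memory_def)
  note c = poly_le_cube[OF n] and l = max_word_length_le[OF n]
  have "k * Suc n \<le> 2 * (k * n ^ 3)" using mult_le_mono2[OF c(1), of k] by simp
  moreover have "Suc n * r \<le> 2 * n ^ 3" using mult_le_mono2[OF r(3), of "Suc n"] c(4) by linarith
  moreover have "300 * a1 + 60 * a2 + 30 * a3 + 1000 * a4 + 40 * a5 + 100 \<le> 600 * x + 2560 * y"
    if "a1 \<le> 2 * x" "a4 \<le> 2 * y" "a2 \<le> 4 * y" "a3 \<le> 2 * y" "a5 \<le> 2 * z" "z \<le> y" "1 \<le> y"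
    for a1 a2 a3 a4 a5 x y z :: nat using that by linarith
  ultimately have "300 * (k * Suc n) + 60 * (Suc n * Suc n) + 30 * Suc n + 1000 * (Suc n * r)
      + 40 * max_word_length n + 100 \<le> (600 * k + 2560) * n ^ 3"
    using c(1-3,6) l(1) unfolding distrib_right mult.assoc by blast
  then have time: "real (300 * (k * Suc n) + 60 * (Suc n * Suc n) + 30 * Suc n + 1000 * (Suc n * r)
      + 40 * max_word_length n + 100) \<le> real (600 * k + 2560) * real n ^ 3"
    by (metis of_nat_mono of_nat_mult of_nat_power)
  have "1 \<le> log 2 (real n)" using n by (simp add: le_log_iff)
  then have "real (n * max_word_length n) \<le> real n * (2 * log 2 (real n))"
    using l(2) by (simp add: mult_left_mono)
  from performs_step1_of_wp[OF wp_stored_step1 time order_refl this] show ?thesis .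
qed

lemma recomputing_performs:
  "performs_step1 recomputing_step1 (word_size k n) (real (600 * k + 4490) * real n ^ 3 * log 2 (real n))
     (real (memory_size (2 * k * Suc n))) (real n * (2 * log 2 (real n))) n s"
proof -
  interpret step1_search n k "word_size k n" "2 * k * Suc n" s r "max_word_length n"
    by (intro step1_search_intro) (simp_all add: rows_memory_def word_size_def)
  note c = poly_le_cube[OF n] and l = max_word_length_le[OF n]
  define x where "x = log 2 (real n)"
  have x: "1 \<le> x" using n by (simp add: le_log_iff x_def)
  have lx: "real (Suc (max_word_length n)) \<le> 3 * x" using l(2) x by (simp add: x_def)
  have "k * Suc n \<le> 2 * (k * n ^ 3)" using mult_le_mono2[OF c(1), of k] by simp
  moreover have "300 * a1 + 60 * a2 + 50 \<le> 600 * x + 290 * y" if "a1 \<le> 2 * x" "a2 \<le> 4 * y" "1 \<le> y"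
    for a1 a2 x y :: nat using that by linarith
  ultimately have "300 * (k * Suc n) + 60 * (Suc n * Suc n) + 50 \<le> (600 * k + 290) * n ^ 3"
    using c(3,6) unfolding distrib_right mult.assoc by blast
  then have 1: "real (300 * (k * Suc n) + 60 * (Suc n * Suc n) + 50) \<le> real (600 * k + 290) * real n ^ 3"
    by (metis of_nat_mono of_nat_mult of_nat_power)
  have 2: "real (600 * k + 290) * real n ^ 3 \<le> real (600 * k + 290) * real n ^ 3 * x"
    using mult_left_mono[OF x, of "real (600 * k + 290) * real n ^ 3"] by simp
  have "Suc n * r \<le> 2 * n ^ 3" using mult_le_mono2[OF r(3), of "Suc n"] c(4) by linarith
  then have "real (Suc n * r) \<le> 2 * real n ^ 3"
    by (metis of_nat_mono of_nat_mult of_nat_numeral of_nat_power)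
  then have *: "real (Suc n * r) * real (Suc (max_word_length n)) \<le> 2 * real n ^ 3 * (3 * x)"
    using lx by (intro mult_mono) auto
  have 3: "real (700 * (Suc n * Suc (max_word_length n)) * r) \<le> 4200 * real n ^ 3 * x"
  proof -
    have "real (700 * (Suc n * Suc (max_word_length n)) * r)
      = 700 * (real (Suc n * r) * real (Suc (max_word_length n)))"
      by (simp only: of_nat_mult of_nat_numeral mult_ac)
    then show ?thesis using * by linarith
  qed
  have time: "real (300 * (k * Suc n) + 60 * (Suc n * Suc n) + 700 * (Suc n * Suc (max_word_length n)) *
    r + 50)
      \<le> real (600 * k + 4490) * real n ^ 3 * x"
    using 1 2 3 x by (simp add: algebra_simps)
  have "real (n * max_word_length n) \<le> real n * (2 * x)"
    using l(2) x by (simp add: mult_left_mono x_def)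
  from performs_step1_of_wp[OF wp_recomputing_step1 time order_refl this] show ?thesis
    by (simp add: x_def)
qed

end

lemma memory_size_rows_bigo: "(\<lambda>n. real (memory_size (rows_memory k n))) \<in> O(\<lambda>n. real n ^ 3)"
proof (rule bigoI)
  show "\<forall>\<^sub>F n in sequentially. norm (real (memory_size (rows_memory k n)))
      \<le> real (card (UNIV :: arr set) * (4 * k + 4) + card (UNIV :: reg set)) * norm (real n ^ 3)"
    using eventually_ge_at_top[of 2]
  proof eventually_elim
    case (elim n)
    note c = poly_le_cube[OF elim]
    have "2 * k * Suc n \<le> 2 * k * (2 * n ^ 3)" by (intro mult_le_mono2 c)
    then have "rows_memory k n \<le> 2 * k * (2 * n ^ 3) + 4 * n ^ 3"
      unfolding rows_memory_def by (intro add_mono c)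
    then have "rows_memory k n \<le> (4 * k + 4) * n ^ 3" by (simp add: distrib_right)
    then have "card (UNIV :: arr set) * rows_memory k n \<le> card (UNIV :: arr set) * ((4 * k + 4) * n ^ 3)"
      by (rule mult_le_mono2)
    moreover have "card (UNIV :: reg set) * 1 \<le> card (UNIV :: reg set) * n ^ 3" using c(6)
      by (rule mult_le_mono2)
    ultimately have "card (UNIV :: arr set) * rows_memory k n + card (UNIV :: reg set) * 1
        \<le> card (UNIV :: arr set) * ((4 * k + 4) * n ^ 3) + card (UNIV :: reg set) * n ^ 3"
      by (rule add_mono)
    then have "memory_size (rows_memory k n)
        \<le> (card (UNIV :: arr set) * (4 * k + 4) + card (UNIV :: reg set)) * n ^ 3"
      by (simp only: memory_size_def distrib_right mult.assoc mult_1_right)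
    then have "real (memory_size (rows_memory k n))
        \<le> real ((card (UNIV :: arr set) * (4 * k + 4) + card (UNIV :: reg set)) * n ^ 3)"
      by (rule of_nat_mono)
    then show ?case by simp
  qed
qed

lemma memory_size_linear_bigo: "(\<lambda>n. real (memory_size (2 * k * Suc n))) \<in> O(\<lambda>n. real n)"
proof (rule bigoI)
  show "\<forall>\<^sub>F n in sequentially. norm (real (memory_size (2 * k * Suc n)))
      \<le> real (card (UNIV :: arr set) * (4 * k) + card (UNIV :: reg set)) * norm (real n)"
    using eventually_ge_at_top[of 1]
  proof eventually_elim
    case (elim n)
    have "2 * k * Suc n \<le> 2 * k * (2 * n)" using elim by (intro mult_le_mono2) simp
    then have "card (UNIV :: arr set) * (2 * k * Suc n) \<le> card (UNIV :: arr set) * (4 * k * n)"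
      by (intro mult_le_mono2) simp
    moreover have "card (UNIV :: reg set) * 1 \<le> card (UNIV :: reg set) * n" using elim
      by (rule mult_le_mono2)
    ultimately have "card (UNIV :: arr set) * (2 * k * Suc n) + card (UNIV :: reg set) * 1
        \<le> card (UNIV :: arr set) * (4 * k * n) + card (UNIV :: reg set) * n"
      by (rule add_mono)
    then have "memory_size (2 * k * Suc n)
        \<le> (card (UNIV :: arr set) * (4 * k) + card (UNIV :: reg set)) * n"
      by (simp only: memory_size_def distrib_right mult.assoc mult_1_right)
    then have "real (memory_size (2 * k * Suc n))
        \<le> real ((card (UNIV :: arr set) * (4 * k) + card (UNIV :: reg set)) * n)"
      by (rule of_nat_mono)
    then show ?case by simp
  qed
qed

lemma log_word_size_bigo: "(\<lambda>n. log 2 (real (word_size k n))) \<in> O(\<lambda>n. log 2 (real n))"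
proof (rule bigoI)
  define C where "C = log 2 (real (4 * k + 9))"
  show "\<forall>\<^sub>F n in sequentially. norm (log 2 (real (word_size k n))) \<le> (C + 3) * norm (log 2 (real n))"
    using eventually_ge_at_top[of 2]
  proof eventually_elim
    case (elim n)
    note c = poly_le_cube[OF elim]
    have "2 * k * Suc n \<le> 2 * k * (2 * n ^ 3)" by (intro mult_le_mono2 c)
    then have "word_size k n \<le> 2 * k * (2 * n ^ 3) + 4 * n ^ 3 + 4 * n ^ 3 + n ^ 3"
      unfolding word_size_def rows_memory_def by (intro add_mono c)
    then have "word_size k n \<le> (4 * k + 9) * n ^ 3" by (simp add: distrib_right)
    then have le: "real (word_size k n) \<le> real (4 * k + 9) * real n ^ 3"
      by (metis of_nat_mono of_nat_mult of_nat_power)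
    have "1 \<le> real (word_size k n)" by (simp add: word_size_def)
    moreover from this have "log 2 (real (word_size k n)) \<le> log 2 (real (4 * k + 9) * real n ^ 3)"
      using le by (subst log_le_cancel_iff) auto
    moreover have "log 2 (real (4 * k + 9) * real n ^ 3) = C + 3 * log 2 (real n)"
      using elim by (simp add: C_def log_mult log_nat_power)
    moreover have "1 \<le> log 2 (real n)" using elim by (simp add: le_log_iff)
    moreover have "0 \<le> C" unfolding C_def by simp
    then have "C * 1 \<le> C * log 2 (real n)" using calculation(4) by (intro mult_left_mono)
    ultimately show ?case by (simp add: distrib_right)
  qed
qed

theorem corollary13:
  fixes k :: nat
  assumes "k \<ge> 2"
    and "minimal_cycle_conjecture k"
  shows "\<exists>(W :: nat \<Rightarrow> nat) (L :: nat \<Rightarrow> real).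
    (\<lambda>n. log 2 (real (W n))) \<in> O(\<lambda>n. log 2 (real n)) \<and>
    L \<in> O(\<lambda>n. real n * ln (real n)) \<and>
    (\<exists>(T :: nat \<Rightarrow> real) (S :: nat \<Rightarrow> real).
      T \<in> O(\<lambda>n. real n ^ 3) \<and> S \<in> O(\<lambda>n. real n ^ 3) \<and>
      almost_always k (\<lambda>n s. performs_step1 stored_step1 (W n) (T n) (S n) (L n) n s)) \<and>
    (\<exists>(T :: nat \<Rightarrow> real) (S :: nat \<Rightarrow> real).
      T \<in> O(\<lambda>n. real n ^ 3 * ln (real n)) \<and> S \<in> O(\<lambda>n. real n) \<and>
      almost_always k (\<lambda>n s. performs_step1 recomputing_step1 (W n) (T n) (S n) (L n) n s))"
proof -
  have conj: "almost_always k (\<lambda>n s. \<exists>w\<in>set (first_words k (n\<^sup>2)). \<exists>m\<le>n.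
      is_cycle (target_length s) (word_prod s w ^^ m))"
    using assms(2) by (simp add: minimal_cycle_conjecture_def)
  have hit: "\<exists>r. hits n s r \<and> (\<forall>j<r. \<not> hits n s j) \<and> r \<le> n\<^sup>2 \<and> length s = k
    \<and> (\<forall>p\<in>set s. p permutes {1..n})"
    if "s \<in> set_pmf (random_gens k n)"
      "\<exists>w\<in>set (first_words k (n\<^sup>2)). \<exists>m\<le>n. is_cycle (target_length s) (word_prod s w ^^ m)" for n s
  proof -
    have s: "length s = k" "\<forall>p\<in>set s. p permutes {1..n}" using that(1)
      by (simp_all add: set_pmf_random_gens)
    have "k > 0" using assms(1) by simp
    from first_hit_exists[OF s(2,1) this that(2)] s show ?thesis by metis
  qed
  have stored: "almost_always k (\<lambda>n s. performs_step1 stored_step1 (word_size k n) (real (600 * k + 2560)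
    * real n ^ 3)
     (real (memory_size (rows_memory k n))) (real n * (2 * log 2 (real n))) n s)"
    by (rule almost_always_mono[OF conj])
      (use eventually_ge_at_top[of 2] in eventually_elim, use hit stored_performs[OF _ assms(1)] in
        blast)
  have recomputing: "almost_always k (\<lambda>n s. performs_step1 recomputing_step1 (word_size k n)
     (real (600 * k + 4490) * real n ^ 3 * log 2 (real n))
     (real (memory_size (2 * k * Suc n))) (real n * (2 * log 2 (real n))) n s)"
    by (rule almost_always_mono[OF conj])
      (use eventually_ge_at_top[of 2] in eventually_elim, use hit recomputing_performs[OF _ assms(1)] in
        blast)
  have L: "(\<lambda>n. real n * (2 * log 2 (real n))) \<in> O(\<lambda>n. real n * ln (real n))"
    by (rule bigoI[of _ "2 / ln 2"]) (simp add: log_def abs_mult mult_ac)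
  have T1: "(\<lambda>n. real (600 * k + 2560) * real n ^ 3) \<in> O(\<lambda>n. real n ^ 3)"
    by (rule bigoI[of _ "real (600 * k + 2560)"]) simp
  have T2: "(\<lambda>n. real (600 * k + 4490) * real n ^ 3 * log 2 (real n)) \<in> O(\<lambda>n. real n ^ 3 * ln (real n))"
    by (rule bigoI[of _ "real (600 * k + 4490) / ln 2"]) (simp add: log_def abs_mult mult_ac)
  show ?thesis
    using log_word_size_bigo L T1 memory_size_rows_bigo stored T2 memory_size_linear_bigo recomputing
      by blast
qed

end
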